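(* Let $D\ge3$ and let $B$ be a connected bipartite graph properly edge-colored with colors $1,\dots,D$ (exactly one edge of each color at each vertex), with $2q$ vertices. Any graph $G_q\in\mathbb{G}^q_D(\mathbb{B}_4^m)$ with boundary graph $B$ satisfies $$\delta(G_q)\ge1+(D-1)\bigl(q+L_m(B_{/\Omega_{\mathrm{opt}}})\bigr),$$ where $\Omega_{\mathrm{opt}}$ is an optimal pairing of $B$. This bound is optimal, i.e. it is attained by some $G_q\in\mathbb{G}^q_D(\mathbb{B}_4^m)$ with boundary graph $B$.
   Context: All graphs are finite, multiple edges allowed, with vertices colored black/white. For $i\in\{1,\dots,D\}$, the quartic melonic bubble $B_i$ is the graph with two black–white pairs $\{\bullet_1,\circ_1\},\{\bullet_2,\circ_2\}$, the vertices of each pair being joined by $D-1$ parallel edges with the colors of $\{1,\dots,D\}\setminus\{i\}$, and with color-$i$ edges $\bullet_1\circ_2$, $\bullet_2\circ_1$; $\mathbb{B}_4^m=\{B_1,\dots,B_D\}$. $\mathbb{G}^q_D(\mathbb{B}_4^m)$: connected bipartite edge-colored graphs in which each vertex has exactly one incident edge of each color in $\{0,\dots,D\}$, except for $q$ white and $q$ black vertices ("degree-$D$ vertices") with one edge of each color in $\{1,\dots,D\}$ and none of color $0$, such that all components left after deleting color-$0$ edges (the bubbles; their number is $b(G)$) are isomorphic to elements of $\mathbb{B}_4^m$. The degree is $\delta(G)=D+(D-1)b(G)-\Phi_0(G)$, where $\Phi_0(G)$ is the number of cycles (closed) alternating colors $0$ and $i$, summed over $i=1,\dots,D$. Boundary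 graph $\partial G$: its vertices are the degree-$D$ vertices of $G$, with an edge of color $i$ between a black and a white one if they are the endpoints of a path of $G$ alternating colors $i$ and $0$ (starting and ending with color $i$). A pairing $\Omega$ of $B$ is a partition of its vertices into black–white pairs; $B^\Omega$ is obtained from $B$ by adding a color-$0$ edge between the vertices of each pair; $\Omega$ is optimal if it maximizes $\Phi_0(B^\Omega)$. $B_{/\Omega}$ is the graph obtained by contracting each pair into one vertex (keeping all edges of $B$, possibly as loops); $L_m(B_{/\Omega})=L(B_{/\Omega})-\sum_{i=1}^DL(B_{/\Omega}^{(i)})$, where $L=E-V+K$ is the circuit-rank and $B_{/\Omega}^{(i)}$ is the subgraph with all vertices and only color-$i$ edges. *)

theory Defs
  imports "Graph_Theory.Digraph_Component" "HOL-Library.Disjoint_Sets"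
begin

section \<open>Bipartite edge-colored graphs\<close>

text \<open>
  All colored graphs considered here have at most one edge of each color at every vertex. An edge
  is therefore determined by its black end, its white end and its color, and is encoded as the
  triple (black end, white end, color). Parallel edges are triples with the same ends and different
  colors.
\<close>

record 'v cgraph =
  blacks :: "'v set"
  whites :: "'v set"
  cedges :: "('v \<times> 'v \<times> nat) set"

definition cverts :: "'v cgraph \<Rightarrow> 'v set" where
  "cverts G = blacks G \<union> whites G"

definition ecolor :: "'v \<times> 'v \<times> nat \<Rightarrow> nat" where
  "ecolor e = snd (snd e)"

definition wf_cgraph :: "'v cgraph \<Rightarrow> bool" where
  "wf_cgraph G \<longleftrightarrow> finite (blacks G) \<and> finite (whites G) \<and> finite (cedges G) \<and>
     blacks G \<inter> whites G = {} \<and> cedges G \<subseteq> blacks G \<times> whites G \<times> UNIV"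

definition color_degree :: "'v cgraph \<Rightarrow> nat \<Rightarrow> 'v \<Rightarrow> nat" where
  "color_degree G c v = card {e \<in> cedges G. ecolor e = c \<and> (v = fst e \<or> v = fst (snd e))}"

definition cadj :: "'v cgraph \<Rightarrow> nat \<Rightarrow> 'v \<Rightarrow> 'v \<Rightarrow> bool" where
  "cadj G c u v \<longleftrightarrow> (u, v, c) \<in> cedges G \<or> (v, u, c) \<in> cedges G"

text \<open>
  Undirected multigraphs are represented by \<open>pre_digraph\<close>s whose arcs carry an
  irrelevant orientation; only the symmetric closure is used for connectivity.
\<close>

definition multigraph_of :: "'v cgraph \<Rightarrow> ('v, 'v \<times> 'v \<times> nat) pre_digraph" where
  "multigraph_of G =
     \<lparr> verts = cverts G, arcs = cedges G, tail = fst, head = (\<lambda>e. fst (snd e)) \<rparr>"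

definition components :: "('a, 'b) pre_digraph \<Rightarrow> 'a set set" where
  "components H = pre_digraph.sccs_verts (with_proj (mk_symmetric H))"

text \<open>Connected graphs are non-empty.\<close>

definition connected_cgraph :: "'v cgraph \<Rightarrow> bool" where
  "connected_cgraph G \<longleftrightarrow> connected (multigraph_of G)"

definition induced_cgraph :: "'v cgraph \<Rightarrow> 'v set \<Rightarrow> 'v cgraph" where
  "induced_cgraph G S =
     \<lparr> blacks = blacks G \<inter> S, whites = whites G \<inter> S, cedges = cedges G \<inter> (S \<times> S \<times> UNIV) \<rparr>"

definition cgraph_iso :: "'v cgraph \<Rightarrow> 'w cgraph \<Rightarrow> bool" where
  "cgraph_iso G H \<longleftrightarrow> (\<exists>f. inj_on f (cverts G) \<and>
     f ` blacks G = blacks H \<and> f ` whites G = whites H \<and>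
     (\<lambda>(b, w, c). (f b, f w, c)) ` cedges G = cedges H)"

text \<open>Closed graphs with colors $1, \dots, D$, such as the boundary graphs.\<close>

definition regular_cgraph :: "nat \<Rightarrow> 'v cgraph \<Rightarrow> bool" where
  "regular_cgraph D B \<longleftrightarrow> wf_cgraph B \<and> ecolor ` cedges B \<subseteq> {1..D} \<and>
     (\<forall>v\<in>cverts B. \<forall>c\<in>{1..D}. color_degree B c v = 1)"


section \<open>Alternating paths and cycles\<close>

definition alt_walk :: "'v cgraph \<Rightarrow> nat \<Rightarrow> nat \<Rightarrow> 'v list \<Rightarrow> bool" where
  "alt_walk G c c' vs \<longleftrightarrow> set vs \<subseteq> cverts G \<and>
     (\<forall>k. Suc k < length vs \<longrightarrow> cadj G (if even k then c else c') (vs ! k) (vs ! Suc k))"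

text \<open>
  A path with an even number of vertices has an odd number of edges, so it starts and ends
  with color \<open>c\<close>.
\<close>

definition alt_path :: "'v cgraph \<Rightarrow> nat \<Rightarrow> nat \<Rightarrow> 'v list \<Rightarrow> bool" where
  "alt_path G c c' vs \<longleftrightarrow> vs \<noteq> [] \<and> distinct vs \<and> even (length vs) \<and> alt_walk G c c' vs"

text \<open>
  Closing such a path by an edge of color \<open>c'\<close> gives an alternating cycle. A cycle of length
  two consists of two parallel edges of different colors.
\<close>

definition alt_cycle :: "'v cgraph \<Rightarrow> nat \<Rightarrow> nat \<Rightarrow> 'v list \<Rightarrow> bool" where
  "alt_cycle G c c' vs \<longleftrightarrow> alt_path G c c' vs \<and> cadj G c' (last vs) (hd vs)"

text \<open>
  Since every vertex has at most one edge of each color, an alternating cycle is determined by its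
  vertex set; counting vertex sets makes the count independent of starting point and direction.
\<close>

definition Phi0 :: "nat \<Rightarrow> 'v cgraph \<Rightarrow> nat" where
  "Phi0 D G = (\<Sum>i=1..D. card {set vs | vs. alt_cycle G 0 i vs})"


section \<open>Graphs built from bubbles\<close>

datatype quartic_vertex = Black1 | White1 | Black2 | White2

definition quartic_melonic :: "nat \<Rightarrow> nat \<Rightarrow> quartic_vertex cgraph" where
  "quartic_melonic D i =
     \<lparr> blacks = {Black1, Black2}, whites = {White1, White2},
       cedges = {Black1} \<times> {White1} \<times> ({1..D} - {i}) \<union> {Black2} \<times> {White2} \<times> ({1..D} - {i}) \<union>
         {(Black1, White2, i), (Black2, White1, i)} \<rparr>"

definition B4m :: "nat \<Rightarrow> quartic_vertex cgraph set" where
  "B4m D = quartic_melonic D ` {1..D}"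

definition delete0 :: "'v cgraph \<Rightarrow> 'v cgraph" where
  "delete0 G = G \<lparr> cedges := {e \<in> cedges G. ecolor e \<noteq> 0} \<rparr>"

definition bubbles :: "'v cgraph \<Rightarrow> 'v cgraph set" where
  "bubbles G = induced_cgraph (delete0 G) ` components (multigraph_of (delete0 G))"

definition degD_vertices :: "'v cgraph \<Rightarrow> 'v set" where
  "degD_vertices G = {v \<in> cverts G. color_degree G 0 v = 0}"

definition GG :: "nat \<Rightarrow> nat \<Rightarrow> 'w cgraph set \<Rightarrow> 'v cgraph set" where
  "GG D q Bs = {G. wf_cgraph G \<and> connected_cgraph G \<and> ecolor ` cedges G \<subseteq> {0..D} \<and>
     (\<forall>v\<in>cverts G. \<forall>c\<in>{1..D}. color_degree G c v = 1) \<and>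
     (\<forall>v\<in>cverts G - degD_vertices G. color_degree G 0 v = 1) \<and>
     card (blacks G \<inter> degD_vertices G) = q \<and> card (whites G \<inter> degD_vertices G) = q \<and>
     (\<forall>H\<in>bubbles G. \<exists>B\<in>Bs. cgraph_iso H B)}"

definition graph_degree :: "nat \<Rightarrow> 'v cgraph \<Rightarrow> int" where
  "graph_degree D G = int D + (int D - 1) * int (card (bubbles G)) - int (Phi0 D G)"

definition boundary_graph :: "nat \<Rightarrow> 'v cgraph \<Rightarrow> 'v cgraph" where
  "boundary_graph D G =
     \<lparr> blacks = blacks G \<inter> degD_vertices G, whites = whites G \<inter> degD_vertices G,
       cedges = {(b, w, i). b \<in> blacks G \<inter> degD_vertices G \<and> w \<in> whites G \<inter> degD_vertices G \<and>
         i \<in> {1..D} \<and> (\<exists>vs. alt_path G i 0 vs \<and> hd vs = b \<and> last vs = w)} \<rparr>"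


section \<open>Pairings\<close>

definition pairing :: "'v cgraph \<Rightarrow> 'v set set \<Rightarrow> bool" where
  "pairing B \<Omega> \<longleftrightarrow> partition_on (cverts B) \<Omega> \<and>
     (\<forall>P\<in>\<Omega>. \<exists>b\<in>blacks B. \<exists>w\<in>whites B. P = {b, w})"

definition add_pairing :: "'v cgraph \<Rightarrow> 'v set set \<Rightarrow> 'v cgraph" where
  "add_pairing B \<Omega> = B \<lparr> cedges := cedges B \<union>
     {(b, w, 0) | b w. b \<in> blacks B \<and> w \<in> whites B \<and> {b, w} \<in> \<Omega>} \<rparr>"

definition optimal_pairing :: "nat \<Rightarrow> 'v cgraph \<Rightarrow> 'v set set \<Rightarrow> bool" where
  "optimal_pairing D B \<Omega> \<longleftrightarrow> is_arg_max (\<lambda>\<Omega>'. Phi0 D (add_pairing B \<Omega>')) (pairing B) \<Omega>"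

definition block_of :: "'v set set \<Rightarrow> 'v \<Rightarrow> 'v set" where
  "block_of \<Omega> v = (THE P. P \<in> \<Omega> \<and> v \<in> P)"

definition contraction :: "'v cgraph \<Rightarrow> 'v set set \<Rightarrow> ('v set, 'v \<times> 'v \<times> nat) pre_digraph" where
  "contraction B \<Omega> =
     \<lparr> verts = \<Omega>, arcs = cedges B,
       tail = (\<lambda>e. block_of \<Omega> (fst e)), head = (\<lambda>e. block_of \<Omega> (fst (snd e))) \<rparr>"

definition circuit_rank :: "('a, 'b) pre_digraph \<Rightarrow> int" where
  "circuit_rank H = int (card (arcs H)) - int (card (verts H)) + int (card (components H))"

definition color_subgraph ::
  "('a, 'v \<times> 'v \<times> nat) pre_digraph \<Rightarrow> nat \<Rightarrow> ('a, 'v \<times> 'v \<times> nat) pre_digraph" where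
  "color_subgraph H i = H \<lparr> arcs := {e \<in> arcs H. ecolor e = i} \<rparr>"

definition Lm :: "nat \<Rightarrow> ('a, 'v \<times> 'v \<times> nat) pre_digraph \<Rightarrow> int" where
  "Lm D H = circuit_rank H - (\<Sum>i=1..D. circuit_rank (color_subgraph H i))"

end

theory Submission
  imports Defs
begin

text \<open>
  Contract every pair of vertices of a bubble that is joined by \<open>D - 1\<close> edges. The color \<open>0\<close> edges
  turn into a partial injection of the set \<open>P\<close> of these pairs, which is closed up to a permutation
  \<open>\<sigma>\<close> with \<open>q\<close> marked cycles, one for each pair of a pairing of the boundary graph. The bubbles of
  color \<open>i\<close> are transpositions of \<open>P\<close>, the closed faces of color \<open>i\<close> are the unmarked cycles of \<open>\<sigma>\<close>
  times these transpositions, and the marked cycles are the faces of the paired boundary graph.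
  Counting how each transposition joins or splits cycles bounds the number of closed faces by
  \<open>(D - 1) * (b - D * q + \<Phi>)\<close>, where \<open>\<Phi>\<close> is the number of faces of the paired boundary graph.
  Since \<open>L\<^sub>m\<close> equals \<open>(D - 1) * q + 1 - \<Phi>\<close>, this is the asserted bound. For equality the boundary
  permutations are written as shortest products of transpositions, one bubble for each factor;
  bubbles with a loop preserve equality.
\<close>

text \<open>A bubble changes the permutation of its own color only, so a count made color by color
  cannot see that the graph is connected. The induction therefore carries along one partition that
  is coarser than the cycles of all colors. Before any bubble is glued in, an unmarked cycle of
  \<sigma> counts as a closed face in each of the \<open>D\<close> colors, hence the weight
  \<open>D\<close> of an unmarked class. At the end connectedness forces every class to meet the
  marked set, and this term vanishes.

  The pairing produced by closing the color \<open>0\<close> paths depends on the graph; the optimal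
  pairing enters only as an upper bound for its number of faces.

  In the attaining graph only faces of length two are counted. This bounds its degree from above,
  and the lower bound, applied to the same graph, gives equality.\<close>

section \<open>Cycles of permutations and transpositions\<close>

text \<open>Forward iterates only. For an injective self-map of a finite set they make up the whole
  cycle, because every point has a period (\<open>orb_sym\<close>).\<close>

definition orb :: "('a \<Rightarrow> 'a) \<Rightarrow> 'a \<Rightarrow> 'a set" where
  "orb f x = {y. \<exists>n. y = (f ^^ n) x}"

lemma funpow_in_orb: "(f ^^ n) x \<in> orb f x"
  unfolding orb_def by (intro CollectI exI) (rule refl)

lemma orbE:
  assumes "y \<in> orb f x" obtains n where "y = (f ^^ n) x"
  using assms unfolding orb_def by (elim CollectE exE)

lemma orb_self [simp]: "x \<in> orb f x"
  using funpow_in_orb[of 0 f x] by simp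

lemma orb_step: "y \<in> orb f x \<Longrightarrow> f y \<in> orb f x"
  using funpow_in_orb[of "Suc _" f x] by (elim orbE) simp

lemma orb_least:
  assumes "x \<in> S" "\<And>y. y \<in> S \<Longrightarrow> f y \<in> S"
  shows "orb f x \<subseteq> S"
proof -
  have "(f ^^ n) x \<in> S" for n by (induction n) (use assms in auto)
  then show ?thesis by (metis orbE subsetI)
qed

lemma orb_subset: "f ` P \<subseteq> P \<Longrightarrow> x \<in> P \<Longrightarrow> orb f x \<subseteq> P"
  by (rule orb_least) auto

lemma orb_mono: "y \<in> orb f x \<Longrightarrow> orb f y \<subseteq> orb f x"
  by (rule orb_least) (auto intro: orb_step)

lemma funpow_inj_on:
  assumes "inj_on f P" "f ` P \<subseteq> P" "x \<in> P" "y \<in> P" "(f ^^ n) x = (f ^^ n) y"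
  shows "x = y"
  using assms(5)
proof (induction n)
  case (Suc n)
  have "(f ^^ n) x \<in> P" "(f ^^ n) y \<in> P"
    using orb_subset[OF assms(2,3)] orb_subset[OF assms(2,4)] funpow_in_orb[of n f] by (auto dest: subsetD)
  then show ?case using Suc assms(1) by (auto dest: inj_onD)
qed simp

lemma funpow_diff:
  assumes "inj_on f P" "f ` P \<subseteq> P" "x \<in> P" "m \<le> n" "(f ^^ m) x = (f ^^ n) x"
  shows "(f ^^ (n - m)) x = x"
proof -
  have "(f ^^ m) ((f ^^ (n - m)) x) = (f ^^ (m + (n - m))) x" by (simp add: funpow_add)
  with assms(4,5) have "(f ^^ m) ((f ^^ (n - m)) x) = (f ^^ m) x" by simp
  moreover have "(f ^^ (n - m)) x \<in> P"
    using orb_subset[OF assms(2,3)] funpow_in_orb[of "n - m" f x] by (rule subsetD)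
  ultimately show ?thesis using funpow_inj_on[OF assms(1,2) _ assms(3)] by blast
qed

lemma funpow_period:
  assumes "finite P" "inj_on f P" "f ` P \<subseteq> P" "x \<in> P"
  obtains n where "n > 0" "(f ^^ n) x = x"
proof -
  have "finite (orb f x)"
    using finite_subset[OF orb_subset[OF assms(3,4)] assms(1)] .
  then have "\<not> inj (\<lambda>n. (f ^^ n) x)"
    using finite_imageD[of "\<lambda>n. (f ^^ n) x" UNIV] finite_subset[of "range (\<lambda>n. (f ^^ n) x)" "orb f x"]
      funpow_in_orb[of _ f x] infinite_UNIV_nat by blast
  then obtain m n where "m < n" and mn: "(f ^^ m) x = (f ^^ n) x"
    unfolding inj_def by (metis nat_neq_iff)
  have "(f ^^ (n - m)) x = x" using funpow_diff[OF assms(2-4) _ mn] \<open>m < n\<close> by simp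
  with \<open>m < n\<close> show ?thesis by (intro that[of "n - m"]) auto
qed

lemma orb_sym:
  assumes "finite P" "inj_on f P" "f ` P \<subseteq> P" "x \<in> P" "y \<in> orb f x"
  shows "x \<in> orb f y"
proof -
  obtain n where n: "y = (f ^^ n) x" using assms(5) by (rule orbE)
  obtain N where N: "N > 0" "(f ^^ N) x = x" using funpow_period[OF assms(1-4)] .
  have *: "(f ^^ (N * k)) x = x" for k
    by (induction k) (auto simp: funpow_add N)
  \<comment> \<open>\<open>N * n\<close> steps lead from \<open>x\<close> back to \<open>x\<close>;
    the first \<open>n\<close> of them end in \<open>y\<close>.\<close>
  have "n \<le> N * n" using N by simp
  then have "(f ^^ (N * n - n)) y = (f ^^ (N * n)) x"
    by (metis n comp_apply funpow_add le_add_diff_inverse2)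
  then show ?thesis using * funpow_in_orb[of "N * n - n" f y] by simp
qed

lemma orb_eq:
  assumes "finite P" "inj_on f P" "f ` P \<subseteq> P" "x \<in> P" "y \<in> orb f x"
  shows "orb f y = orb f x"
  using orb_mono[OF assms(5)] orb_mono[OF orb_sym[OF assms]] by blast

lemma orb_back:
  assumes "finite P" "inj_on f P" "f ` P \<subseteq> P" "x \<in> P" "y \<in> P" "f y \<in> orb f x"
  shows "y \<in> orb f x"
  by (metis assms orb_eq orb_self orb_step)

lemma orb_partition:
  assumes "finite P" "inj_on f P" "f ` P \<subseteq> P"
  shows "partition_on P (orb f ` P)"
proof (rule partition_onI)
  show "\<Union> (orb f ` P) = P"
    using orb_subset[OF assms(3)] by fastforce
  show "{} \<notin> orb f ` P" by (metis empty_iff imageE orb_self)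
  fix p q assume "p \<in> orb f ` P" "q \<in> orb f ` P" and ne: "p \<noteq> q"
  then obtain x y where xy: "x \<in> P" "y \<in> P" "p = orb f x" "q = orb f y" by auto
  show "disjnt p q"
    unfolding disjnt_def
  proof (rule ccontr)
    assume "p \<inter> q \<noteq> {}"
    then obtain z where "z \<in> orb f x" "z \<in> orb f y" using xy by blast
    then show False using ne xy orb_eq[OF assms] by metis
  qed
qed

section \<open>Composition of a permutation with one transposition\<close>

text \<open>The transposition of \<open>a\<close> and \<open>b\<close> is applied first and
  \<open>f\<close> afterwards; for \<open>a = b\<close> this is \<open>f\<close> itself.\<close>

definition swap_args :: "('a \<Rightarrow> 'b) \<Rightarrow> 'a \<Rightarrow> 'a \<Rightarrow> 'a \<Rightarrow> 'b" where
  "swap_args f a b x = (if x = a then f b else if x = b then f a else f x)"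

lemma swap_args_simps [simp]:
  "swap_args f a b a = f b" "swap_args f a b b = f a"
  "x \<noteq> a \<Longrightarrow> x \<noteq> b \<Longrightarrow> swap_args f a b x = f x"
  by (auto simp: swap_args_def)

lemma swap_args_twice [simp]: "swap_args (swap_args f a b) a b = f"
  by (auto simp: swap_args_def fun_eq_iff)

lemma swap_args_inj:
  assumes "inj_on f P" "f ` P \<subseteq> P" "a \<in> P" "b \<in> P"
  shows "inj_on (swap_args f a b) P" "swap_args f a b ` P \<subseteq> P"
  using assms by (auto simp: inj_on_def swap_args_def)

lemma orb_swap_args_away:
  assumes "a \<notin> orb f x" "b \<notin> orb f x"
  shows "orb (swap_args f a b) x = orb f x"
proof -
  have "(swap_args f a b ^^ n) x = (f ^^ n) x" for n
  proof (induction n)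
    case (Suc n)
    have "(f ^^ n) x \<noteq> a" "(f ^^ n) x \<noteq> b" using assms funpow_in_orb by metis+
    then show ?case using Suc by auto
  qed simp
  then show ?thesis unfolding orb_def by simp
qed

text \<open>From \<open>a\<close> the new map enters the old cycle of \<open>b\<close> at
  \<open>f b\<close> and follows it, with no exit before \<open>b\<close>: only \<open>a\<close> and
  \<open>b\<close> have changed images, and \<open>a\<close> lies on another cycle.\<close>

lemma orb_swap_args_reach:
  assumes fin: "finite P" "inj_on f P" "f ` P \<subseteq> P" and ab: "a \<in> P" "b \<in> P" and ne: "b \<notin> orb f a"
  shows "b \<in> orb (swap_args f a b) a"
proof (rule ccontr)
  let ?g = "swap_args f a b"
  assume no: "b \<notin> orb ?g a"
  have nea: "a \<notin> orb f b" using ne orb_sym[OF fin ab(2)] by blast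
  have *: "(f ^^ Suc k) b \<in> orb ?g a" for k
  proof (induction k)
    case 0
    have "?g a \<in> orb ?g a" by (rule orb_step) simp
    moreover have "?g a = f b" by simp
    ultimately show ?case by simp
  next
    case (Suc k)
    have "(f ^^ Suc k) b \<noteq> b" using Suc no by metis
    moreover have "(f ^^ Suc k) b \<noteq> a" using nea funpow_in_orb by metis
    ultimately have "?g ((f ^^ Suc k) b) = (f ^^ Suc (Suc k)) b" by simp
    then show ?case using orb_step[OF Suc] by metis
  qed
  obtain N where "N > 0" "(f ^^ N) b = b" using funpow_period[OF fin ab(2)] .
  then show False using *[of "N - 1"] no by simp
qed

lemma orb_swap_args_subset:
  "orb (swap_args f a b) a \<union> orb (swap_args f a b) b \<subseteq> orb f a \<union> orb f b"
proof -
  have "swap_args f a b z \<in> orb f a \<union> orb f b" if "z \<in> orb f a \<union> orb f b" for z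
    using that orb_step[of z f] orb_step[of a f a] orb_step[of b f b] by (auto simp: swap_args_def)
  then have "orb (swap_args f a b) z \<subseteq> orb f a \<union> orb f b" if "z = a \<or> z = b" for z
    using that by (intro orb_least) auto
  then show ?thesis by blast
qed

text \<open>The reverse of \<open>orb_swap_args_subset\<close> is that inclusion for the swapped
  map, since swapping twice gives back \<open>f\<close>.\<close>

lemma orb_swap_args_union:
  "orb (swap_args f a b) a \<union> orb (swap_args f a b) b = orb f a \<union> orb f b"
  using orb_swap_args_subset[of f a b] orb_swap_args_subset[of "swap_args f a b" a b]
  unfolding swap_args_twice by (rule equalityI)

lemma orb_image_split:
  assumes fin: "finite P" "inj_on f P" "f ` P \<subseteq> P" and ab: "a \<in> P" "b \<in> P"
  shows "orb f ` (P - (orb f a \<union> orb f b)) = orb f ` P - {orb f a, orb f b}"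
    and "orb f ` (orb f a \<union> orb f b) = {orb f a, orb f b}"
proof -
  have "orb f z \<in> {orb f a, orb f b}" if "z \<in> orb f a \<union> orb f b" for z
    using that orb_eq[OF fin ab(1), of z] orb_eq[OF fin ab(2), of z] by (elim UnE) simp_all
  moreover have "orb f z \<notin> {orb f a, orb f b}" if "z \<notin> orb f a \<union> orb f b" for z
    using that orb_self[of z f] by (intro notI) (elim insertE emptyE, simp_all)
  ultimately show "orb f ` (P - (orb f a \<union> orb f b)) = orb f ` P - {orb f a, orb f b}"
    "orb f ` (orb f a \<union> orb f b) = {orb f a, orb f b}" by auto
qed

text \<open>Cycles through neither point are untouched, and the new cycles of the two points fill
  the same set as the old ones.\<close>

lemma orb_image_swap_args:
  assumes fin: "finite P" "inj_on f P" "f ` P \<subseteq> P" and ab: "a \<in> P" "b \<in> P"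
  shows "orb (swap_args f a b) ` P =
    orb f ` P - {orb f a, orb f b} \<union> {orb (swap_args f a b) a, orb (swap_args f a b) b}"
proof -
  let ?g = "swap_args f a b" and ?U = "orb f a \<union> orb f b"
  have "orb ?g z = orb f z" if z: "z \<in> P - ?U" for z
    using z orb_sym[OF fin, of z a] orb_sym[OF fin, of z b]
    by (intro orb_swap_args_away) (elim DiffE, erule contrapos_nn, simp)+
  then have "orb ?g ` (P - ?U) = orb f ` (P - ?U)" by (rule image_cong[OF refl])
  moreover have "orb ?g ` P = orb ?g ` (P - ?U) \<union> orb ?g ` ?U"
    using orb_subset[OF fin(3)] ab by (simp add: image_Un[symmetric] Un_absorb2)
  ultimately show ?thesis
    using orb_image_split[OF fin ab] orb_image_split(2)[OF fin(1) swap_args_inj[OF fin(2,3) ab] ab]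
    by (simp only: orb_swap_args_union)
qed

lemma orb_swap_args_merge:
  assumes fin: "finite P" "inj_on f P" "f ` P \<subseteq> P" and ab: "a \<in> P" "b \<in> P" and ne: "b \<notin> orb f a"
  shows "orb (swap_args f a b) ` P = orb f ` P - {orb f a, orb f b} \<union> {orb f a \<union> orb f b}"
proof -
  have "orb (swap_args f a b) b = orb (swap_args f a b) a"
    by (rule orb_eq[OF fin(1) swap_args_inj[OF fin(2,3) ab] ab(1) orb_swap_args_reach[OF fin ab ne]])
  then show ?thesis using orb_image_swap_args[OF fin ab] orb_swap_args_union[of f a b] by simp
qed

text \<open>The two new cycles are not shown to be distinct, and they coincide for
  \<open>a = b\<close>: \<open>glue_bound\<close> only takes an upper bound on the number of cycles
  from a split.\<close>

lemma orb_swap_args_same: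
  assumes fin: "finite P" "inj_on f P" "f ` P \<subseteq> P" and ab: "a \<in> P" "b \<in> P" and same: "b \<in> orb f a"
  shows "orb (swap_args f a b) ` P =
      orb f ` P - {orb f a} \<union> {orb (swap_args f a b) a, orb (swap_args f a b) b}"
    and "orb (swap_args f a b) a \<union> orb (swap_args f a b) b = orb f a"
  using orb_image_swap_args[OF fin ab] orb_swap_args_union[of f a b] orb_eq[OF fin ab(1) same] by simp_all

section \<open>Marked and unmarked classes when classes are joined or split\<close>

text \<open>Exactly one class disappears: a marked one if both were marked, and an unmarked one
  otherwise. This is applied to the cycles of one color and also to the partition common to all
  colors.\<close>

lemma card_meeting_merge:
  assumes fin: "finite P" and part: "partition_on P R" and AB: "A \<in> R" "B \<in> R" "A \<noteq> B"
  defines "R' \<equiv> R - {A, B} \<union> {A \<union> B}"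
  shows "partition_on P R'" and "card R = card R' + 1"
    and "card {C\<in>R. C \<inter> Q = {}} = card {C\<in>R'. C \<inter> Q = {}} + (if A \<inter> Q \<noteq> {} \<and> B \<inter> Q \<noteq> {} then 0 else 1)"
    and "card {C\<in>R. C \<inter> Q \<noteq> {}} = card {C\<in>R'. C \<inter> Q \<noteq> {}} + (if A \<inter> Q \<noteq> {} \<and> B \<inter> Q \<noteq> {} then 1 else 0)"
proof -
  have finP: "finite R" using finite_elements[OF fin part] .
  have dis: "X \<inter> Y = {}" if "X \<in> R" "Y \<in> R" "X \<noteq> Y" for X Y
    using partition_onD2[OF part] that by (auto simp: disjoint_def)
  have ne: "X \<noteq> {}" if "X \<in> R" for X using partition_onD3[OF part] that by blast
  have UP: "\<Union>R = P" using partition_onD1[OF part] by simp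
  have notin: "A \<union> B \<notin> R"
  proof
    assume *: "A \<union> B \<in> R"
    then have "A \<union> B = A" using dis[OF * AB(1)] ne[OF AB(1)] by blast
    moreover have "A \<union> B = B" using dis[OF * AB(2)] ne[OF AB(2)] by blast
    ultimately show False using AB by simp
  qed
  show "partition_on P R'"
  proof (rule partition_onI)
    show "\<Union>R' = P" using UP AB unfolding R'_def by blast
    show "{} \<notin> R'" using ne AB unfolding R'_def by auto
    fix X Y assume "X \<in> R'" "Y \<in> R'" "X \<noteq> Y"
    then show "disjnt X Y" using dis AB unfolding R'_def disjnt_def by auto
  qed
  have R: "R = insert A (insert B (R - {A, B}))" using AB by auto
  have gen: "card {C\<in>R. pr C} = card {C\<in>R - {A, B}. pr C} + (if pr A then 1 else 0) + (if pr B then 1 else 0)" for pr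
  proof -
    have "{C\<in>R. pr C} = {C\<in>R - {A, B}. pr C} \<union> (if pr A then {A} else {}) \<union> (if pr B then {B} else {})"
      using AB by auto
    then show ?thesis using AB finP by (auto simp: card_insert_if)
  qed
  have gen': "card {C\<in>R'. pr C} = card {C\<in>R - {A, B}. pr C} + (if pr (A \<union> B) then 1 else 0)" for pr
  proof -
    have "{C\<in>R'. pr C} = {C\<in>R - {A, B}. pr C} \<union> (if pr (A \<union> B) then {A \<union> B} else {})"
      unfolding R'_def by auto
    then show ?thesis using notin finP by (auto simp: card_insert_if)
  qed
  show "card R = card R' + 1" using gen[of "\<lambda>_. True"] gen'[of "\<lambda>_. True"] by simp
  show "card {C\<in>R. C \<inter> Q = {}} = card {C\<in>R'. C \<inter> Q = {}} + (if A \<inter> Q \<noteq> {} \<and> B \<inter> Q \<noteq> {} then 0 else 1)"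
    unfolding gen gen' by (auto simp: Int_Un_distrib2)
  show "card {C\<in>R. C \<inter> Q \<noteq> {}} = card {C\<in>R'. C \<inter> Q \<noteq> {}} + (if A \<inter> Q \<noteq> {} \<and> B \<inter> Q \<noteq> {} then 1 else 0)"
    unfolding gen gen' by (auto simp: Int_Un_distrib2)
qed

lemma card_meeting_split:
  assumes fin: "finite P" and part: "partition_on P R" and A: "A \<in> R" "B \<union> C = A"
    and ne: "B \<noteq> {}" "C \<noteq> {}"
  defines "R' \<equiv> R - {A} \<union> {B, C}"
  shows "card R' \<le> card R + 1" and "card {X\<in>R. X \<inter> Q \<noteq> {}} \<le> card {X\<in>R'. X \<inter> Q \<noteq> {}}"
proof -
  have finR: "finite R" using finite_elements[OF fin part] .
  have "card R' \<le> card (R - {A}) + card {B, C}" unfolding R'_def by (rule card_Un_le)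
  also have "\<dots> \<le> card R + 1"
    using card_Suc_Diff1[OF finR A(1)] card_insert_le_m1[of 2 "{C}" B] by simp
  finally show "card R' \<le> card R + 1" .
  have "X \<inter> A = {}" if "X \<in> R - {A}" for X
    using partition_onD2[OF part] that A(1) by (auto simp: disjoint_def)
  then have nin: "B \<notin> R - {A}" "C \<notin> R - {A}" using A(2) ne by blast+
  \<comment> \<open>\<open>A\<close> goes to a part of it that meets \<open>Q\<close> whenever
    \<open>A\<close> does. The parts are no other classes of \<open>R\<close>, so this is
    injective.\<close>
  let ?h = "\<lambda>X. if X = A then (if B \<inter> Q \<noteq> {} then B else C) else X"
  show "card {X\<in>R. X \<inter> Q \<noteq> {}} \<le> card {X\<in>R'. X \<inter> Q \<noteq> {}}"
  proof (rule card_inj_on_le)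
    show "inj_on ?h {X\<in>R. X \<inter> Q \<noteq> {}}" using nin by (auto simp: inj_on_def)
    show "?h ` {X\<in>R. X \<inter> Q \<noteq> {}} \<subseteq> {X\<in>R'. X \<inter> Q \<noteq> {}}"
      unfolding R'_def using A(2) by auto
    show "finite {X\<in>R'. X \<inter> Q \<noteq> {}}" unfolding R'_def using finR by simp
  qed
qed

section \<open>One permutation per color, one transposition per bubble\<close>

text \<open>The state is a family of permutations indexed by colors, all equal to \<open>f\<close>
  at the start. A triple \<open>(x, y, c)\<close> is a bubble of color \<open>c\<close> on the
  vertex pairs \<open>x\<close> and \<open>y\<close>; the head of the list is the bubble added
  last.\<close>

primrec glue :: "('a \<Rightarrow> 'a) \<Rightarrow> ('a \<times> 'a \<times> nat) list \<Rightarrow> nat \<Rightarrow> 'a \<Rightarrow> 'a" where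
  "glue f [] = (\<lambda>i. f)"
| "glue f (e # es) = (glue f es)(snd (snd e) :=
     swap_args (glue f es (snd (snd e))) (fst e) (fst (snd e)))"

lemma glue_perm:
  assumes "inj_on f P" "f ` P \<subseteq> P" "set es \<subseteq> P \<times> P \<times> UNIV"
  shows "inj_on (glue f es i) P \<and> glue f es i ` P \<subseteq> P"
  using assms(3)
proof (induction es arbitrary: i)
  case (Cons e es)
  obtain x y c where e: "e = (x, y, c)" by (cases e)
  have IH: "inj_on (glue f es i) P" "glue f es i ` P \<subseteq> P" for i
    using Cons.IH Cons.prems by simp_all
  have "x \<in> P" "y \<in> P" using Cons.prems e by auto
  then show ?case using swap_args_inj[OF IH, of x y c] IH[of i] by (cases "i = c") (simp_all add: e)
qed (use assms in simp)

lemma sum_fun_upd: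
  fixes a :: "'b \<Rightarrow> int"
  assumes "finite A" "i \<in> A"
  shows "(\<Sum>j\<in>A. a ((u(i := v)) j)) = (\<Sum>j\<in>A. a (u j)) - a (u i) + a v"
proof -
  have "(\<Sum>j\<in>A - {i}. a ((u(i := v)) j)) = (\<Sum>j\<in>A - {i}. a (u j))" by (rule sum.cong) auto
  then show ?thesis using sum.remove[OF assms, of "\<lambda>j. a ((u(i := v)) j)"] sum.remove[OF assms, of "\<lambda>j. a (u j)"]
    by simp
qed

text \<open>Joining two cycles lowers the left side minus \<open>(D - 1)\<close> times the number of transpositions by
  \<open>D\<close>, which is compensated by the loss of at most one marked cycle or unmarked class of \<open>E\<close>.
  Splitting a cycle changes it by \<open>1 - (D - 1) \<le> 0\<close> and loses neither.\<close>

lemma glue_bound: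
  fixes D :: nat
  defines "cyc \<equiv> (\<lambda>P f. int (card (orb f ` P)))"
    and "mcyc \<equiv> (\<lambda>P Q f. int (card {C\<in>orb f ` P. C \<inter> Q \<noteq> {}}))"
  assumes D: "D \<ge> 2" and fin: "finite P" and f: "inj_on f P" "f ` P \<subseteq> P"
    and Q: "mcyc P Q f = int q"
    and es: "set es \<subseteq> P \<times> P \<times> {1..D}"
  shows "\<exists>E. partition_on P E \<and> (\<forall>i. \<forall>z\<in>P. \<exists>C\<in>E. orb (glue f es i) z \<subseteq> C) \<and>
    (\<forall>C\<in>E. \<forall>z\<in>C. f z \<in> C) \<and> (\<forall>C\<in>E. \<forall>(x, y, i)\<in>set es. x \<in> C \<longleftrightarrow> y \<in> C) \<and>
    (\<Sum>i=1..D. cyc P (glue f es i)) \<le> (int D - 1) * int (length es)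
       + int D * (\<Sum>i=1..D. mcyc P Q (glue f es i))
       - int D * (int D - 1) * int q + int D * int (card {C\<in>E. C \<inter> Q = {}})"
  using es
proof (induction es)
  \<comment> \<open>Every color has the same cycles, \<open>q\<close> marked and say
    \<open>u\<close> unmarked ones, and both sides are \<open>D * (q + u)\<close>. This fixes the
    constant \<open>- D * (D - 1) * q\<close>.\<close>
  case Nil
  note part = orb_partition[OF fin f]
  have split: "int (card (orb f ` P)) = int q + int (card {C\<in>orb f ` P. C \<inter> Q = {}})"
  proof -
    have "card (orb f ` P) = card ({C\<in>orb f ` P. C \<inter> Q \<noteq> {}} \<union> {C\<in>orb f ` P. C \<inter> Q = {}})"
      by (rule arg_cong[of _ _ card]) auto
    also have "\<dots> = card {C\<in>orb f ` P. C \<inter> Q \<noteq> {}} + card {C\<in>orb f ` P. C \<inter> Q = {}}"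
      using fin by (intro card_Un_disjoint) auto
    finally show ?thesis using Q unfolding mcyc_def by simp
  qed
  show ?case
  proof (intro exI[of _ "orb f ` P"] conjI part)
    show "\<forall>C\<in>orb f ` P. \<forall>z\<in>C. f z \<in> C" by (auto intro: orb_step)
    show "(\<Sum>i=1..D. cyc P (glue f [] i)) \<le> (int D - 1) * int (length [])
       + int D * (\<Sum>i=1..D. mcyc P Q (glue f [] i))
       - int D * (int D - 1) * int q + int D * int (card {C\<in>orb f ` P. C \<inter> Q = {}})"
      using Q split by (simp add: cyc_def algebra_simps)
  qed auto
next
  case (Cons e es)
  obtain x y i where e: "e = (x, y, i)" by (cases e)
  have xy: "x \<in> P" "y \<in> P" and i: "i \<in> {1..D}" and es: "set es \<subseteq> P \<times> P \<times> {1..D}"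
    using Cons.prems e by auto
  let ?f = "glue f es i"
  let ?g = "swap_args ?f x y"
  obtain E where E: "partition_on P E"
    and ref0: "\<forall>i. \<forall>z\<in>P. \<exists>C\<in>E. orb (glue f es i) z \<subseteq> C"
    and fcl0: "\<forall>C\<in>E. \<forall>z\<in>C. f z \<in> C"
    and ecl0: "\<forall>C\<in>E. \<forall>(x, y, i)\<in>set es. x \<in> C \<longleftrightarrow> y \<in> C"
    and ineq: "(\<Sum>i=1..D. cyc P (glue f es i)) \<le> (int D - 1) * int (length es)
       + int D * (\<Sum>i=1..D. mcyc P Q (glue f es i))
       - int D * (int D - 1) * int q + int D * int (card {C\<in>E. C \<inter> Q = {}})"
    using Cons.IH[OF es] by (elim exE conjE) (rule that)
  have ref: "\<exists>C\<in>E. orb (glue f es i) z \<subseteq> C" if "z \<in> P" for i z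
    using bspec[OF spec[OF ref0] that] .
  have fcl: "f z \<in> C" if "C \<in> E" "z \<in> C" for C z
    using bspec[OF bspec[OF fcl0 that(1)] that(2)] .
  have ecl: "x \<in> C \<longleftrightarrow> y \<in> C" if "C \<in> E" "(x, y, i) \<in> set es" for C x y i
    using bspec[OF bspec[OF ecl0 that(1)] that(2)] by simp
  have perm: "inj_on ?f P" "?f ` P \<subseteq> P" using glue_perm[OF f, of es i] es by auto
  note fp = fin perm
  note part = orb_partition[OF fp]
  have glue: "glue f (e # es) = (glue f es)(i := ?g)" by (simp add: e)
  have sums: "(\<Sum>j=1..D. cyc P (glue f (e # es) j)) = (\<Sum>j=1..D. cyc P (glue f es j)) - cyc P ?f + cyc P ?g"
    "(\<Sum>j=1..D. mcyc P Q (glue f (e # es) j)) = (\<Sum>j=1..D. mcyc P Q (glue f es j)) - mcyc P Q ?f + mcyc P Q ?g"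
    unfolding glue
    by (rule sum_fun_upd[OF finite_atLeastAtMost i, of "cyc P" "glue f es" ?g])
      (rule sum_fun_upd[OF finite_atLeastAtMost i, of "mcyc P Q" "glue f es" ?g])
  have len: "(int D - 1) * int (length (e # es)) = (int D - 1) * int (length es) + int D - 1"
    by (simp add: algebra_simps)
  have Dm: "int D * (S - m + m') = int D * S - int D * m + int D * m'" for S m m'
    by (simp add: algebra_simps)
  have disE: "A \<inter> B = {}" if "A \<in> E" "B \<in> E" "A \<noteq> B" for A B
    using partition_onD2[OF E] that by (auto simp: disjoint_def)
  obtain X where X: "X \<in> E" "x \<in> X" using partition_onD1[OF E] xy by auto
  obtain Y where Y: "Y \<in> E" "y \<in> Y" using partition_onD1[OF E] xy by auto
  have oX: "orb ?f x \<subseteq> X" using ref[OF xy(1), of i] disE[OF X(1)] X(2) orb_self[of x ?f] by blast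
  have oY: "orb ?f y \<subseteq> Y" using ref[OF xy(2), of i] disE[OF Y(1)] Y(2) orb_self[of y ?f] by blast
  show ?case
  proof (cases "y \<in> orb ?f x")
    case True
    note O = orb_swap_args_same[OF fp xy True]
    \<comment> \<open>The class of \<open>x\<close> contains the whole cycle, hence also
      \<open>y\<close>, so a split leaves the partition alone.\<close>
    have XY: "X = Y" using True oX disE[OF X(1) Y(1)] Y(2) by blast
    note cs = card_meeting_split[OF fin part imageI[OF xy(1)] O(2), folded O(1)]
    have ne: "orb ?g x \<noteq> {}" "orb ?g y \<noteq> {}" using orb_self by fast+
    have d: "cyc P ?g \<le> cyc P ?f + 1" "mcyc P Q ?f \<le> mcyc P Q ?g"
      using cs(1)[OF ne] cs(2)[OF ne, of Q] unfolding cyc_def mcyc_def by simp_all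
    have refg: "\<exists>C\<in>E. orb ?g z \<subseteq> C" if z: "z \<in> P" for z
    proof -
      have "orb ?g z \<in> orb ?f ` P - {orb ?f x} \<union> {orb ?g x, orb ?g y}" using O(1) z by blast
      then consider w where "w \<in> P" "orb ?g z = orb ?f w" | "orb ?g z \<subseteq> orb ?f x"
        using O(2) by blast
      then show ?thesis using ref[of _ i] oX X(1) by cases (metis, blast)
    qed
    show ?thesis
    proof (intro exI[of _ E] conjI E)
      show "\<forall>j. \<forall>z\<in>P. \<exists>C\<in>E. orb (glue f (e # es) j) z \<subseteq> C"
        unfolding glue using ref refg by simp
      show "\<forall>C\<in>E. \<forall>z\<in>C. f z \<in> C" using fcl by blast
      show "\<forall>C\<in>E. \<forall>(x, y, i)\<in>set (e # es). x \<in> C \<longleftrightarrow> y \<in> C"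
      proof (intro ballI)
        fix C t assume C: "C \<in> E" and t: "t \<in> set (e # es)"
        have "y \<in> X" using XY Y(2) by simp
        have "x \<in> C \<longleftrightarrow> y \<in> C"
        proof (cases "C = X")
          case True
          then show ?thesis using X(2) \<open>y \<in> X\<close> by simp
        next
          case False
          then show ?thesis using disE[OF C X(1) False] X(2) \<open>y \<in> X\<close> by blast
        qed
        moreover have "\<forall>(x, y, i)\<in>set es. x \<in> C \<longleftrightarrow> y \<in> C" using ecl0 C by (rule bspec)
        ultimately show "case t of (x, y, i) \<Rightarrow> x \<in> C \<longleftrightarrow> y \<in> C" using t by (auto simp: e)
      qed
      have "int D * mcyc P Q ?f \<le> int D * mcyc P Q ?g" using d(2) by (intro mult_left_mono) auto
      then show "(\<Sum>i=1..D. cyc P (glue f (e # es) i)) \<le> (int D - 1) * int (length (e # es))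
       + int D * (\<Sum>i=1..D. mcyc P Q (glue f (e # es) i))
       - int D * (int D - 1) * int q + int D * int (card {C\<in>E. C \<inter> Q = {}})"
        unfolding sums len Dm using ineq d(1) D by linarith
    qed
  next
    case False
    have neq: "orb ?f x \<noteq> orb ?f y" using False orb_self[of y ?f] by metis
    note O = orb_swap_args_merge[OF fp xy False]
    note cm = card_meeting_merge[OF fin part imageI[OF xy(1)] imageI[OF xy(2)] neq, folded O]
    let ?b = "orb ?f x \<inter> Q \<noteq> {} \<and> orb ?f y \<inter> Q \<noteq> {}"
    have d: "cyc P ?g = cyc P ?f - 1" "mcyc P Q ?g = mcyc P Q ?f - (if ?b then 1 else 0)"
      using cm(2) cm(4)[of Q] unfolding cyc_def mcyc_def by simp_all
    \<comment> \<open>The two cycles may already share a class because of earlier bubbles; then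
      there is nothing to join in the partition.\<close>
    define E' where "E' = (if X = Y then E else E - {X, Y} \<union> {X \<union> Y})"
    have E': "partition_on P E'"
      unfolding E'_def using E card_meeting_merge(1)[OF fin E X(1) Y(1)] by simp
    \<comment> \<open>If both cycles are marked, so are the classes around them, and no unmarked
      class disappears. Hence a bubble never costs a marked cycle and an unmarked class at the same
      time.\<close>
    have V: "int (card {C\<in>E. C \<inter> Q = {}}) \<le> int (card {C\<in>E'. C \<inter> Q = {}}) + (if ?b then 0 else 1)"
    proof (cases "X = Y")
      case False
      have "X \<inter> Q \<noteq> {} \<and> Y \<inter> Q \<noteq> {}" if ?b using that oX oY by blast
      then show ?thesis unfolding E'_def using card_meeting_merge(3)[OF fin E X(1) Y(1) False, of Q] False
        by auto
    qed (simp add: E'_def)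
    have up: "\<exists>C'\<in>E'. C \<subseteq> C'" if "C \<in> E" for C
      using that unfolding E'_def by auto
    have E'cl: "pr C" if "\<And>C. C \<in> E \<Longrightarrow> pr C" "C \<in> E'" "\<And>A B. pr A \<Longrightarrow> pr B \<Longrightarrow> pr (A \<union> B)" for pr C
      using that(1,2) that(3)[OF that(1)[OF X(1)] that(1)[OF Y(1)]] unfolding E'_def by (auto split: if_splits)
    have XYE': "X \<union> Y \<in> E'" unfolding E'_def using X(1) by auto
    have refg: "\<exists>C\<in>E'. orb ?g z \<subseteq> C" if z: "z \<in> P" for z
    proof -
      have "orb ?g z \<in> orb ?f ` P - {orb ?f x, orb ?f y} \<union> {orb ?f x \<union> orb ?f y}" using O z by blast
      then consider w where "w \<in> P" "orb ?g z = orb ?f w" | "orb ?g z = orb ?f x \<union> orb ?f y"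
        by blast
      then show ?thesis
      proof cases
        case 1
        then show ?thesis using ref[OF 1(1), of i] up by (metis subset_trans)
      next
        case 2
        then show ?thesis using oX oY XYE' by (metis Un_mono)
      qed
    qed
    show ?thesis
    proof (intro exI[of _ E'] conjI E')
      show "\<forall>j. \<forall>z\<in>P. \<exists>C\<in>E'. orb (glue f (e # es) j) z \<subseteq> C"
      proof (intro allI ballI)
        fix j z assume z: "z \<in> P"
        show "\<exists>C\<in>E'. orb (glue f (e # es) j) z \<subseteq> C"
          unfolding glue using ref[OF z, of j] up refg[OF z] by (cases "j = i") (simp, metis fun_upd_apply subset_trans)
      qed
      show "\<forall>C\<in>E'. \<forall>z\<in>C. f z \<in> C"
        by (intro ballI impI, rule E'cl[of "\<lambda>C. \<forall>z\<in>C. f z \<in> C", rule_format]) (use fcl in auto)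
      show "\<forall>C\<in>E'. \<forall>(x, y, i)\<in>set (e # es). x \<in> C \<longleftrightarrow> y \<in> C"
      proof (intro ballI)
        fix C t assume C: "C \<in> E'" and t: "t \<in> set (e # es)"
        have "\<forall>(x, y, i)\<in>set es. x \<in> C \<longleftrightarrow> y \<in> C"
          by (rule E'cl[OF _ C]) (use ecl in fastforce)+
        moreover have "x \<in> C \<longleftrightarrow> y \<in> C"
        proof -
          have "C \<inter> (X \<union> Y) = {}" if "C \<noteq> X \<union> Y"
            using partition_onD2[OF E'] C XYE' that by (auto simp: disjoint_def)
          then show ?thesis using X(2) Y(2) by blast
        qed
        ultimately show "case t of (x, y, i) \<Rightarrow> x \<in> C \<longleftrightarrow> y \<in> C" using t by (auto simp: e)
      qed
      have Db: "int D * int (card {C\<in>E. C \<inter> Q = {}}) - int D * int (card {C\<in>E'. C \<inter> Q = {}})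
          + int D * mcyc P Q ?f - int D * mcyc P Q ?g \<le> int D"
      proof -
        have "int (card {C\<in>E. C \<inter> Q = {}}) - int (card {C\<in>E'. C \<inter> Q = {}}) + mcyc P Q ?f - mcyc P Q ?g \<le> 1"
        proof (cases ?b)
          case True
          then show ?thesis using V[unfolded if_P[OF True]] d(2)[unfolded if_P[OF True]] by linarith
        next
          case False
          then show ?thesis using V[unfolded if_not_P[OF False]] d(2)[unfolded if_not_P[OF False]] by linarith
        qed
        from mult_left_mono[OF this, of "int D"] show ?thesis by (simp add: algebra_simps)
      qed
      show "(\<Sum>i=1..D. cyc P (glue f (e # es) i)) \<le> (int D - 1) * int (length (e # es))
       + int D * (\<Sum>i=1..D. mcyc P Q (glue f (e # es) i))
       - int D * (int D - 1) * int q + int D * int (card {C\<in>E'. C \<inter> Q = {}})"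
        unfolding sums len Dm using ineq d(1) D Db by linarith
    qed
  qed
qed

section \<open>Connected components\<close>

text \<open>Sets that no edge enters or leaves, that is, unions of components. Connectedness and
  components are handled through them, so that later arguments need no walks between
  vertices.\<close>

definition closed_in :: "('a, 'b) pre_digraph \<Rightarrow> 'a set \<Rightarrow> bool" where
  "closed_in H S \<longleftrightarrow> (\<forall>e\<in>arcs H. tail H e \<in> S \<longleftrightarrow> head H e \<in> S)"

abbreviation linked :: "('a, 'b) pre_digraph \<Rightarrow> 'a \<Rightarrow> 'a \<Rightarrow> bool" where
  "linked H u v \<equiv> u \<rightarrow>\<^sup>*\<^bsub>with_proj (mk_symmetric H)\<^esub> v"

lemma linked_def:
  "linked H u v \<longleftrightarrow> (u, v) \<in> rtrancl_on (verts H) (\<Union>e\<in>arcs H. {(tail H e, head H e), (head H e, tail H e)})"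
  unfolding reachable_def by (simp add: parcs_mk_symmetric)

lemma linked_refl: "u \<in> verts H \<Longrightarrow> linked H u u"
  unfolding linked_def by simp

lemma linked_sym: "linked H u v \<Longrightarrow> linked H v u"
  unfolding linked_def by (rule rtrancl_on_sym[THEN symD]) (auto simp: sym_def)

lemma linked_trans: "linked H u v \<Longrightarrow> linked H v w \<Longrightarrow> linked H u w"
  unfolding linked_def by (rule rtrancl_on_trans)

lemma linked_verts: "linked H u v \<Longrightarrow> u \<in> verts H \<and> v \<in> verts H"
  unfolding linked_def by (auto dest: in_rtrancl_on_in_F)

lemma linked_arc:
  assumes "wf_digraph H" "e \<in> arcs H" shows "linked H (tail H e) (head H e)"
proof -
  have "tail H e \<in> verts H" "head H e \<in> verts H"
    using assms by (auto simp: wf_digraph_def)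
  then show ?thesis
    unfolding linked_def using assms(2) by (intro rtrancl_on_into_rtrancl_on[OF rtrancl_on_refl]) auto
qed

lemma linked_closed:
  assumes "linked H u v" "closed_in H S" "u \<in> S" shows "v \<in> S"
  using assms(1) unfolding linked_def
  by (induction rule: rtrancl_on_induct) (use assms(2,3) in \<open>auto simp: closed_in_def\<close>)

lemma closed_in_linked:
  assumes "wf_digraph H" shows "closed_in H {v. linked H u v}"
  unfolding closed_in_def mem_Collect_eq
  using linked_arc[OF assms] by (metis linked_sym linked_trans)

text \<open>\<open>mk_symmetric\<close> makes reachability symmetric, so strongly connected
  components are plain reachability classes.\<close>

lemma components_eq: "components H = (\<lambda>u. {v. linked H u v}) ` verts H"
proof
  show "components H \<subseteq> (\<lambda>u. {v. linked H u v}) ` verts H"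
  proof
    fix S assume S: "S \<in> components H"
    then have ne: "S \<noteq> {}" and all: "\<forall>u\<in>S. \<forall>v\<in>S. linked H u v"
      "\<forall>u\<in>S. \<forall>v. v \<notin> S \<longrightarrow> \<not> linked H u v \<or> \<not> linked H v u"
      unfolding components_def pre_digraph.sccs_verts_def by simp_all
    then obtain u where u: "u \<in> S" by blast
    have "v \<in> S \<longleftrightarrow> linked H u v" for v using u all linked_sym[of H u v] by blast
    then have "S = {v. linked H u v}" by blast
    moreover have "u \<in> verts H" using u all(1) linked_verts[of H u u] by blast
    ultimately show "S \<in> (\<lambda>u. {v. linked H u v}) ` verts H" by blast
  qed
  show "(\<lambda>u. {v. linked H u v}) ` verts H \<subseteq> components H"
  proof
    fix S assume "S \<in> (\<lambda>u. {v. linked H u v}) ` verts H"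
    then obtain u where u: "u \<in> verts H" and S: "S = {v. linked H u v}" by blast
    have "\<forall>x\<in>S. \<forall>y\<in>S. linked H x y"
      unfolding S by (metis linked_sym linked_trans mem_Collect_eq)
    moreover have "\<forall>x\<in>S. \<forall>y. y \<notin> S \<longrightarrow> \<not> linked H x y \<or> \<not> linked H y x"
      unfolding S by (metis linked_trans mem_Collect_eq)
    moreover have "S \<noteq> {}" using linked_refl[OF u] unfolding S by blast
    ultimately show "S \<in> components H"
      unfolding components_def pre_digraph.sccs_verts_def by simp
  qed
qed

lemma components_partition: "partition_on (verts H) (components H)"
proof (rule partition_onI)
  show "\<Union> (components H) = verts H"
  proof
    show "\<Union> (components H) \<subseteq> verts H" unfolding components_eq using linked_verts[of H] by blast
    show "verts H \<subseteq> \<Union> (components H)" unfolding components_eq using linked_refl[of _ H] by blast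
  qed
  show "{} \<notin> components H" unfolding components_eq using linked_refl[of _ H] by blast
  fix A B assume "A \<in> components H" "B \<in> components H" and ne: "A \<noteq> B"
  then obtain u v where uv: "A = {w. linked H u w}" "B = {w. linked H v w}"
    unfolding components_eq by blast
  show "disjnt A B"
    unfolding disjnt_def
  proof (rule ccontr)
    assume "A \<inter> B \<noteq> {}"
    then obtain w where w: "linked H u w" "linked H v w" using uv by blast
    have "linked H u x \<longleftrightarrow> linked H v x" for x
      using w by (metis linked_sym linked_trans)
    then show False using ne uv by blast
  qed
qed

lemma component_closed:
  assumes "wf_digraph H" "C \<in> components H" shows "closed_in H C"
  using assms(2) closed_in_linked[OF assms(1)] unfolding components_eq by (elim imageE) simp

text \<open>A component is a least closed set; minimality around one of its points is
  enough.\<close>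

lemma componentI:
  assumes "wf_digraph H" "closed_in H C" "x \<in> C" "x \<in> verts H"
    and least: "\<And>S. closed_in H S \<Longrightarrow> x \<in> S \<Longrightarrow> C \<subseteq> S"
  shows "C \<in> components H"
proof -
  have "C = {v. linked H x v}"
  proof
    show "C \<subseteq> {v. linked H x v}"
      using least[OF closed_in_linked[OF assms(1)], of x] linked_refl[OF assms(4)] by simp
    show "{v. linked H x v} \<subseteq> C" using linked_closed[OF _ assms(2,3)] by (intro subsetI) simp
  qed
  then show ?thesis unfolding components_eq using assms(4) by (rule image_eqI)
qed

lemma connected_least:
  assumes "connected H" "closed_in H S" "x \<in> S" "x \<in> verts H" shows "verts H \<subseteq> S"
proof
  fix v assume "v \<in> verts H"
  then have "linked H x v"
    using assms(1,4) unfolding connected_def strongly_connected_def by simp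
  then show "v \<in> S" using linked_closed[OF _ assms(2,3)] by blast
qed

lemma connectedI_closed:
  assumes "wf_digraph H" "x \<in> verts H" "\<And>S. closed_in H S \<Longrightarrow> x \<in> S \<Longrightarrow> verts H \<subseteq> S"
  shows "connected H"
proof -
  have "verts H \<subseteq> {v. linked H x v}"
    using assms(3)[OF closed_in_linked[OF assms(1)], of x] linked_refl[OF assms(2)] by simp
  then have "linked H x v" if "v \<in> verts H" for v using that by blast
  then have "linked H u v" if "u \<in> verts H" "v \<in> verts H" for u v
    using that by (metis linked_sym linked_trans)
  then show ?thesis
    unfolding connected_def using assms(2) by (intro strongly_connectedI) auto
qed

lemma wf_multigraph_of: "wf_cgraph G \<Longrightarrow> wf_digraph (multigraph_of G)"
  unfolding wf_cgraph_def wf_digraph_def multigraph_of_def cverts_def by auto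

lemma closed_in_multigraph_of:
  "closed_in (multigraph_of G) S \<longleftrightarrow> (\<forall>(b, w, c)\<in>cedges G. b \<in> S \<longleftrightarrow> w \<in> S)"
  unfolding closed_in_def multigraph_of_def by auto

section \<open>Alternating cycles and paths\<close>

text \<open>The list \<open>u 0, v 0, u 1, v 1, ...\<close>; in the uses below one sequence runs
  through black vertices and the other through white ones.\<close>

definition zigzag :: "(nat \<Rightarrow> 'a) \<Rightarrow> (nat \<Rightarrow> 'a) \<Rightarrow> nat \<Rightarrow> 'a list" where
  "zigzag u v N = map (\<lambda>k. if even k then u (k div 2) else v (k div 2)) [0..<2 * N]"

lemma length_zigzag [simp]: "length (zigzag u v N) = 2 * N"
  by (simp add: zigzag_def)

lemma nth_zigzag: "k < 2 * N \<Longrightarrow> zigzag u v N ! k = (if even k then u (k div 2) else v (k div 2))"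
  by (simp add: zigzag_def)

lemma set_zigzag: "set (zigzag u v N) = u ` {..<N} \<union> v ` {..<N}"
proof
  show "set (zigzag u v N) \<subseteq> u ` {..<N} \<union> v ` {..<N}"
    by (auto simp: zigzag_def)
  have "u n \<in> set (zigzag u v N)" "v n \<in> set (zigzag u v N)" if "n < N" for n
    using nth_mem[of "2 * n" "zigzag u v N"] nth_mem[of "2 * n + 1" "zigzag u v N"] that
    by (auto simp: nth_zigzag)
  then show "u ` {..<N} \<union> v ` {..<N} \<subseteq> set (zigzag u v N)" by auto
qed

lemma distinct_zigzag:
  assumes "inj_on u {..<N}" "inj_on v {..<N}" "u ` {..<N} \<inter> v ` {..<N} = {}"
  shows "distinct (zigzag u v N)"
  unfolding distinct_conv_nth
proof (intro allI impI)
  fix j k assume jk: "j < length (zigzag u v N)" "k < length (zigzag u v N)" "j \<noteq> k"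
  then have lt: "j div 2 < N" "k div 2 < N" by auto
  have ne: "j div 2 \<noteq> k div 2" if "even j = even k"
    using jk(3) that by (metis dvd_mult_div_cancel odd_two_times_div_two_succ)
  have "u a \<noteq> v b" if "a < N" "b < N" for a b using assms(3) that by blast
  moreover have "u (j div 2) \<noteq> u (k div 2)" "v (j div 2) \<noteq> v (k div 2)" if "even j = even k"
    using ne[OF that] lt assms(1,2) by (auto dest!: inj_onD)
  ultimately show "zigzag u v N ! j \<noteq> zigzag u v N ! k"
    using jk lt by (auto simp: nth_zigzag) metis
qed

lemma hd_last_zigzag:
  assumes "N > 0"
  shows "zigzag u v N \<noteq> []" "hd (zigzag u v N) = u 0" "last (zigzag u v N) = v (N - 1)"
proof -
  show ne: "zigzag u v N \<noteq> []" using assms by (simp add: zigzag_def)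
  show "hd (zigzag u v N) = u 0" using assms by (simp add: hd_conv_nth[OF ne] nth_zigzag)
  have "odd (2 * N - 1)" "(2 * N - 1) div 2 = N - 1" using assms by presburger+
  then show "last (zigzag u v N) = v (N - 1)" using assms by (simp add: last_conv_nth[OF ne] nth_zigzag)
qed

lemma alt_walk_zigzag:
  assumes "u ` {..<N} \<union> v ` {..<N} \<subseteq> cverts G"
    and "\<And>n. n < N \<Longrightarrow> cadj G c (u n) (v n)" "\<And>n. Suc n < N \<Longrightarrow> cadj G c' (v n) (u (Suc n))"
  shows "alt_walk G c c' (zigzag u v N)"
  unfolding alt_walk_def set_zigzag
proof (intro conjI assms(1) allI impI)
  fix k assume k: "Suc k < length (zigzag u v N)"
  show "cadj G (if even k then c else c') (zigzag u v N ! k) (zigzag u v N ! Suc k)"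
  proof (cases "even k")
    case True
    then show ?thesis using k assms(2)[of "k div 2"] by (simp add: nth_zigzag)
  next
    case False
    then have "Suc k div 2 = Suc (k div 2)" "Suc (k div 2) < N" using k by simp_all presburger+
    then show ?thesis using k False assms(3)[of "k div 2"] by (simp add: nth_zigzag)
  qed
qed

section \<open>Faces and paths of one color as orbits of a permutation\<close>

text \<open>The color \<open>0\<close> and \<open>i\<close> edges of a graph, after completing the color \<open>0\<close> edges to a perfect
  matching \<open>\<beta>\<close>; the black vertices in \<open>Q\<close> are the ones without an edge of color \<open>0\<close>.\<close>

locale face_perm =
  fixes K :: "'v cgraph" and i :: nat and Q :: "'v set" and \<alpha> \<beta> f :: "'v \<Rightarrow> 'v"
  assumes wf: "wf_cgraph K"
    and \<alpha>_white: "b \<in> blacks K \<Longrightarrow> \<alpha> b \<in> whites K"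
    and \<alpha>_inj: "inj_on \<alpha> (blacks K)"
    and edge_i: "(b, w, i) \<in> cedges K \<longleftrightarrow> b \<in> blacks K \<and> w = \<alpha> b"
    and \<beta>_bij: "bij_betw \<beta> (blacks K) (whites K)"
    and edge_0: "(b, w, 0) \<in> cedges K \<longleftrightarrow> b \<in> blacks K \<and> b \<notin> Q \<and> w = \<beta> b"
    and f_black: "b \<in> blacks K \<Longrightarrow> f b \<in> blacks K"
    and \<beta>_f: "b \<in> blacks K \<Longrightarrow> \<beta> (f b) = \<alpha> b"
begin

lemma fin: "finite (blacks K)" and disj: "b \<in> blacks K \<Longrightarrow> b \<notin> whites K"
  using wf unfolding wf_cgraph_def by auto

lemma \<beta>_white: "b \<in> blacks K \<Longrightarrow> \<beta> b \<in> whites K"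
  using \<beta>_bij by (rule bij_betwE[rule_format])

lemma \<beta>_eq: "a \<in> blacks K \<Longrightarrow> b \<in> blacks K \<Longrightarrow> \<beta> a = \<beta> b \<longleftrightarrow> a = b"
  using \<beta>_bij unfolding bij_betw_def inj_on_def by blast

lemma \<alpha>_eq: "a \<in> blacks K \<Longrightarrow> b \<in> blacks K \<Longrightarrow> \<alpha> a = \<alpha> b \<longleftrightarrow> a = b"
  using \<alpha>_inj unfolding inj_on_def by blast

lemma f_inj: "inj_on f (blacks K)"
  using \<beta>_f \<alpha>_eq by (auto simp: inj_on_def) metis

lemma f_into: "f ` blacks K \<subseteq> blacks K"
  using f_black by blast

lemma f_surj: "b \<in> blacks K \<Longrightarrow> \<exists>a\<in>blacks K. f a = b"
  using endo_inj_surj[OF fin f_into f_inj] by (metis imageE)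

lemma f_pow: "b \<in> blacks K \<Longrightarrow> (f ^^ n) b \<in> blacks K"
  by (induction n) (auto intro: f_black)

lemmas perm = fin f_inj f_into

lemma cadj_i: "cadj K i u v \<longleftrightarrow> (u \<in> blacks K \<and> v = \<alpha> u) \<or> (v \<in> blacks K \<and> u = \<alpha> v)"
  unfolding cadj_def edge_i by blast

lemma cadj_0: "cadj K 0 u v \<longleftrightarrow> (u \<in> blacks K \<and> u \<notin> Q \<and> v = \<beta> u) \<or> (v \<in> blacks K \<and> v \<notin> Q \<and> u = \<beta> v)"
  unfolding cadj_def edge_0 by blast

definition face :: "'v set \<Rightarrow> 'v set" where
  "face X = X \<union> \<alpha> ` X"

text \<open>The cycle runs through \<open>\<beta> x\<close>, \<open>x\<close>,
  \<open>\<beta> (f x)\<close>, \<open>f x\<close> and so on. A color \<open>0\<close> edge joins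
  \<open>\<beta> b\<close> to \<open>b\<close> as long as \<open>b\<close> is outside
  \<open>Q\<close>, and the color \<open>i\<close> edge at \<open>b\<close> ends in
  \<open>\<alpha> b = \<beta> (f b)\<close>.\<close>

lemma alt_cycle_face:
  assumes "x \<in> blacks K" and avoid: "orb f x \<inter> Q = {}"
  shows "\<exists>vs. alt_cycle K 0 i vs \<and> set vs = face (orb f x)"
proof -
  \<comment> \<open>Stopping at the least period keeps the listed vertices distinct.\<close>
  define N where "N = (LEAST n. n > 0 \<and> (f ^^ n) x = x)"
  have ex: "\<exists>n. n > 0 \<and> (f ^^ n) x = x" using funpow_period[OF perm assms(1)] by metis
  have N: "N > 0" "(f ^^ N) x = x" using LeastI_ex[OF ex] unfolding N_def by auto
  have least: "\<not> (n > 0 \<and> (f ^^ n) x = x)" if "n < N" for n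
    using not_less_Least[of n "\<lambda>n. n > 0 \<and> (f ^^ n) x = x"] that unfolding N_def by simp
  have neq: "(f ^^ m) x \<noteq> (f ^^ n) x" if "m < n" "n < N" for m n
  proof
    assume "(f ^^ m) x = (f ^^ n) x"
    then have "(f ^^ (n - m)) x = x"
      using funpow_diff[OF perm(2,3) assms(1)] that(1) by simp
    moreover have "n - m < N" "n - m > 0" using that by linarith+
    ultimately show False using least[of "n - m"] by simp
  qed
  let ?v = "\<lambda>n. (f ^^ n) x" and ?u = "\<lambda>n. \<beta> ((f ^^ n) x)"
  let ?vs = "zigzag ?u ?v N"
  note bl = f_pow[OF assms(1)]
  have inj: "inj_on ?v {..<N}" using neq by (auto simp: inj_on_def) (metis nat_neq_iff)
  then have inj': "inj_on ?u {..<N}" using \<beta>_eq[OF bl bl] by (auto simp: inj_on_def)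
  have nQ: "(f ^^ n) x \<notin> Q" for n using avoid funpow_in_orb by fast
  have "alt_walk K 0 i ?vs"
  proof (rule alt_walk_zigzag)
    show "?u ` {..<N} \<union> ?v ` {..<N} \<subseteq> cverts K"
      using bl \<beta>_white[OF bl] unfolding cverts_def by blast
    show "cadj K 0 (?u n) (?v n)" for n unfolding cadj_0 using bl nQ by blast
    show "cadj K i (?v n) (?u (Suc n))" for n unfolding cadj_i using bl \<beta>_f[OF bl, of n] by simp
  qed
  moreover have "distinct ?vs"
    using inj inj' disj[OF bl] \<beta>_white[OF bl] by (intro distinct_zigzag) (auto, metis)
  moreover have "cadj K i (last ?vs) (hd ?vs)"
  proof -
    have "f ((f ^^ (N - 1)) x) = x" using N by (metis Suc_diff_1 comp_apply funpow.simps(2))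
    then show ?thesis
      using hd_last_zigzag[OF N(1), of ?u ?v] \<beta>_f[OF bl, of "N - 1"] bl[of "N - 1"] unfolding cadj_i by simp
  qed
  ultimately have "alt_cycle K 0 i ?vs"
    unfolding alt_cycle_def alt_path_def using hd_last_zigzag(1)[OF N(1)] by simp
  moreover have "set ?vs = face (orb f x)"
  proof -
    have "orb f x \<subseteq> ?v ` {..<N}"
    proof (rule orb_least)
      show "x \<in> ?v ` {..<N}" using N by (intro image_eqI[of _ _ 0]) auto
      fix y assume "y \<in> ?v ` {..<N}"
      then obtain n where n: "n < N" "y = (f ^^ n) x" by blast
      show "f y \<in> ?v ` {..<N}"
      proof (cases "Suc n = N")
        case True
        then have "f y = (f ^^ 0) x" using N n by (metis comp_apply funpow.simps(2) funpow_0)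
        then show ?thesis using N by blast
      next
        case False
        then show ?thesis using n by (intro image_eqI[of _ _ "Suc n"]) auto
      qed
    qed
    then have o: "?v ` {..<N} = orb f x" using funpow_in_orb by fast
    have sub: "orb f x \<subseteq> blacks K" by (rule orb_subset[OF f_into assms(1)])
    \<comment> \<open>The list shows the white vertices as images under \<beta>, \<open>face\<close>
      as images under \<alpha>. They agree because \<open>f\<close> permutes the orbit.\<close>
    have "f ` orb f x = orb f x"
      using orb_step[of _ f x] by (intro endo_inj_surj finite_subset[OF sub fin] inj_on_subset[OF f_inj sub]) blast
    moreover have "\<beta> ` f ` orb f x = \<alpha> ` orb f x"
      unfolding image_image by (rule image_cong[OF refl]) (use sub \<beta>_f in blast)
    ultimately have "\<beta> ` orb f x = \<alpha> ` orb f x" by simp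
    moreover have "?u ` {..<N} = \<beta> ` orb f x" unfolding o[symmetric] by (simp add: image_image)
    ultimately show ?thesis unfolding set_zigzag face_def o by auto
  qed
  ultimately show ?thesis by blast
qed

text \<open>With the closing edge every vertex of the cycle has a neighbour of either color on it,
  whatever the starting point and the direction of the list. The converse below can then argue
  mostly with vertex sets.\<close>

lemma alt_cycle_neighbours:
  assumes "alt_cycle K 0 i vs" "v \<in> set vs"
  shows "\<exists>u\<in>set vs. cadj K 0 v u" "\<exists>u\<in>set vs. cadj K i v u"
proof -
  have ne: "vs \<noteq> []" and ev: "even (length vs)" and cl: "cadj K i (last vs) (hd vs)"
    and ad: "\<And>k. Suc k < length vs \<Longrightarrow> cadj K (if even k then 0 else i) (vs ! k) (vs ! Suc k)"
    using assms(1) unfolding alt_cycle_def alt_path_def alt_walk_def by auto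
  have sym: "cadj K c u v \<Longrightarrow> cadj K c v u" for c u v unfolding cadj_def by blast
  obtain k where k: "k < length vs" "v = vs ! k" using assms(2) by (metis in_set_conv_nth)
  show "\<exists>u\<in>set vs. cadj K 0 v u"
  proof (cases "even k")
    case True
    then have "Suc k < length vs" using k ev by (metis Suc_lessI even_Suc)
    then show ?thesis using ad[of k] True k by auto
  next
    case False
    then obtain j where "k = Suc j" "even j" by (metis even_Suc not0_implies_Suc even_zero)
    then show ?thesis using ad[of j] k sym[of 0 "vs ! j" "vs ! k"] nth_mem[of j vs] by (metis Suc_lessD)
  qed
  show "\<exists>u\<in>set vs. cadj K i v u"
  proof (cases "even k")
    case True
    show ?thesis
    proof (cases k)
      case 0
      then show ?thesis using cl k sym ne by (metis hd_conv_nth last_in_set)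
    next
      case (Suc j)
      then have "cadj K i (vs ! j) (vs ! k)" using ad[of j] k True by auto
      then show ?thesis using k Suc sym[of i "vs ! j" "vs ! k"] nth_mem[of j vs] by (metis Suc_lessD)
    qed
  next
    case False
    show ?thesis
    proof (cases "Suc k < length vs")
      case True
      then show ?thesis using ad[of k] False k by auto
    next
      case False
      then have "v = last vs" using k ne by (metis Suc_lessI diff_Suc_1 last_conv_nth)
      then show ?thesis using cl ne by (metis hd_in_set)
    qed
  qed
qed

text \<open>The black vertices of the cycle are closed under \<open>f\<close>, so it contains the
  face of some \<open>x\<close>. Conversely an edge of color \<open>0\<close> or \<open>i\<close>
  has both ends in that face or none, so the cycle cannot leave it.\<close>

lemma face_of_alt_cycle:
  assumes "alt_cycle K 0 i vs"
  shows "\<exists>x\<in>blacks K. orb f x \<inter> Q = {} \<and> set vs = face (orb f x)"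
proof -
  note nb = alt_cycle_neighbours[OF assms]
  have cv: "set vs \<subseteq> blacks K \<union> whites K" and ne: "vs \<noteq> []"
    and ad: "\<And>k. Suc k < length vs \<Longrightarrow> cadj K (if even k then 0 else i) (vs ! k) (vs ! Suc k)"
    using assms unfolding alt_cycle_def alt_path_def alt_walk_def cverts_def by auto
  have bQ: "b \<notin> Q" if "b \<in> set vs" "b \<in> blacks K" for b
    using nb(1)[OF that(1)] that(2) disj \<beta>_white unfolding cadj_0 by blast
  have b\<alpha>: "\<alpha> b \<in> set vs" if "b \<in> set vs" "b \<in> blacks K" for b
    using nb(2)[OF that(1)] that(2) disj \<alpha>_white unfolding cadj_i by blast
  have bf: "f b \<in> set vs" if b: "b \<in> set vs" "b \<in> blacks K" for b
  proof -
    obtain u where "u \<in> set vs" "cadj K 0 (\<alpha> b) u" using nb(1)[OF b\<alpha>[OF b]] by blast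
    then have "u \<in> blacks K \<and> \<beta> u = \<beta> (f b) \<and> u \<in> set vs"
      unfolding cadj_0 using disj[of "\<alpha> b"] \<alpha>_white[OF b(2)] \<beta>_f[OF b(2)] by auto
    then show ?thesis using \<beta>_eq[of u "f b"] f_black[OF b(2)] by simp
  qed
  obtain x where x: "x \<in> set vs" "x \<in> blacks K"
  proof -
    have "hd vs \<in> set vs" using ne by simp
    then show ?thesis using nb(1)[of "hd vs"] that unfolding cadj_0 by blast
  qed
  have sub: "orb f x \<subseteq> set vs \<inter> blacks K"
    using x bf f_black by (intro orb_least) auto
  have oB: "orb f x \<subseteq> blacks K" using sub by blast
  let ?S = "face (orb f x)"
  have Sb: "b \<in> ?S \<longleftrightarrow> b \<in> orb f x" if "b \<in> blacks K" for b
    unfolding face_def using that disj \<alpha>_white oB by blast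
  have S\<alpha>: "\<alpha> b \<in> ?S \<longleftrightarrow> b \<in> orb f x" if "b \<in> blacks K" for b
  proof -
    have "\<alpha> b \<notin> orb f x" using \<alpha>_white[OF that] disj oB by blast
    then show ?thesis unfolding face_def using \<alpha>_eq[OF that] oB by blast
  qed
  have S\<beta>: "\<beta> b \<in> ?S \<longleftrightarrow> b \<in> orb f x" if b: "b \<in> blacks K" for b
  proof -
    obtain a where a: "a \<in> blacks K" "f a = b" using f_surj[OF b] by blast
    have "\<beta> b = \<alpha> a" using \<beta>_f[OF a(1)] a(2) by simp
    then show ?thesis
      using S\<alpha>[OF a(1)] a orb_step[of a f x] orb_back[OF perm x(2) a(1)] by metis
  qed
  have adS: "u \<in> ?S \<longleftrightarrow> v \<in> ?S" if "cadj K c u v" "c = 0 \<or> c = i" for c u v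
  proof (cases "c = 0")
    case True
    then show ?thesis using that(1) unfolding True cadj_0 using Sb S\<beta> by blast
  next
    case False
    then have "cadj K i u v" using that by simp
    then show ?thesis unfolding cadj_i using Sb S\<alpha> by blast
  qed
  have all: "vs ! k \<in> ?S \<longleftrightarrow> vs ! 0 \<in> ?S" if "k < length vs" for k
    using that
  proof (induction k)
    case (Suc k)
    then show ?case using adS[OF ad[OF Suc.prems]] by (auto split: if_splits)
  qed simp
  have "x \<in> ?S" using Sb[OF x(2)] by simp
  then have "vs ! 0 \<in> ?S" using all x(1) by (metis in_set_conv_nth)
  then have "set vs \<subseteq> ?S" using all by (metis in_set_conv_nth subsetI)
  moreover have "?S \<subseteq> set vs" unfolding face_def using sub b\<alpha> by blast
  ultimately show ?thesis using x(2) sub bQ by blast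
qed

lemma alt_cycles_eq:
  "{set vs | vs. alt_cycle K 0 i vs} = face ` {X \<in> orb f ` blacks K. X \<inter> Q = {}}" (is "?L = ?R")
proof
  show "?L \<subseteq> ?R"
  proof
    fix Y assume "Y \<in> ?L"
    then obtain vs where vs: "alt_cycle K 0 i vs" "Y = set vs" by blast
    obtain x where "x \<in> blacks K" "orb f x \<inter> Q = {}" "set vs = face (orb f x)"
      using face_of_alt_cycle[OF vs(1)] by blast
    then show "Y \<in> ?R" using vs(2) by simp
  qed
  show "?R \<subseteq> ?L"
  proof
    fix Y assume "Y \<in> ?R"
    then obtain x where x: "x \<in> blacks K" "orb f x \<inter> Q = {}" "Y = face (orb f x)" by auto
    obtain vs where "alt_cycle K 0 i vs" "set vs = face (orb f x)" using alt_cycle_face[OF x(1,2)] by blast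
    then show "Y \<in> ?L" using x(3) by blast
  qed
qed

lemma card_alt_cycles:
  "card {set vs | vs. alt_cycle K 0 i vs} = card {X \<in> orb f ` blacks K. X \<inter> Q = {}}"
proof -
  have "face X \<inter> blacks K = X" if "X \<in> orb f ` blacks K" for X
  proof -
    have "X \<subseteq> blacks K" using that orb_subset[OF f_into] by blast
    then show ?thesis unfolding face_def using \<alpha>_white disj by blast
  qed
  then have "inj_on face {X \<in> orb f ` blacks K. X \<inter> Q = {}}"
    by (intro inj_on_inverseI[of _ "\<lambda>Y. Y \<inter> blacks K"]) auto
  then show ?thesis unfolding alt_cycles_eq by (rule card_image)
qed

text \<open>The path is forced: from \<open>b\<close> color \<open>i\<close> leads to
  \<open>\<alpha> b\<close>, and color \<open>0\<close> leads on to \<open>f b\<close>, along an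
  edge that exists only for \<open>f b\<close> outside \<open>Q\<close>.\<close>

lemma alt_path_iff:
  assumes z: "z \<in> blacks K" "z \<in> Q"
  shows "(\<exists>vs. alt_path K i 0 vs \<and> hd vs = z \<and> last vs = w) \<longleftrightarrow>
    (\<exists>m. w = \<alpha> ((f ^^ m) z) \<and> (\<forall>n\<in>{1..m}. (f ^^ n) z \<notin> Q))"
proof
  assume "\<exists>vs. alt_path K i 0 vs \<and> hd vs = z \<and> last vs = w"
  then obtain vs where ne: "vs \<noteq> []" and ev: "even (length vs)" and hl: "hd vs = z" "last vs = w"
    and ad: "\<And>k. Suc k < length vs \<Longrightarrow> cadj K (if even k then i else 0) (vs ! k) (vs ! Suc k)"
    unfolding alt_path_def alt_walk_def by auto
  note bl = f_pow[OF z(1)]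
  have step: "vs ! k = (if even k then (f ^^ (k div 2)) z else \<alpha> ((f ^^ (k div 2)) z)) \<and>
      (even k \<longrightarrow> k > 0 \<longrightarrow> (f ^^ (k div 2)) z \<notin> Q)" if "k < length vs" for k
    using that
  proof (induction k)
    case 0
    then show ?case using hl ne by (simp add: hd_conv_nth)
  next
    case (Suc k)
    have IH: "vs ! k = (if even k then (f ^^ (k div 2)) z else \<alpha> ((f ^^ (k div 2)) z))"
      using Suc by simp
    show ?case
    proof (cases "even k")
      case True
      then have "cadj K i ((f ^^ (k div 2)) z) (vs ! Suc k)" using ad[OF Suc.prems] IH by simp
      then have "vs ! Suc k = \<alpha> ((f ^^ (k div 2)) z)"
        unfolding cadj_i using bl disj \<alpha>_white by metis
      then show ?thesis using True by simp
    next
      case False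
      let ?b = "(f ^^ (k div 2)) z"
      have "cadj K 0 (\<alpha> ?b) (vs ! Suc k)" using ad[OF Suc.prems] IH False by simp
      then have "vs ! Suc k \<in> blacks K \<and> vs ! Suc k \<notin> Q \<and> \<beta> (f ?b) = \<beta> (vs ! Suc k)"
        unfolding cadj_0 using bl disj \<alpha>_white \<beta>_f by metis
      then have "vs ! Suc k = f ?b" "f ?b \<notin> Q" using \<beta>_eq f_black[OF bl] by auto
      moreover have "Suc k div 2 = Suc (k div 2)" using False by presburger
      ultimately show ?thesis using False by simp
    qed
  qed
  \<comment> \<open>The number of color \<open>0\<close> edges; the path has \<open>Suc m\<close>
    black and as many white vertices.\<close>
  define m where "m = length vs div 2 - 1"
  have len: "length vs = 2 * Suc m" using ne ev unfolding m_def by (cases vs) auto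
  show "\<exists>m. w = \<alpha> ((f ^^ m) z) \<and> (\<forall>n\<in>{1..m}. (f ^^ n) z \<notin> Q)"
  proof (intro exI[of _ m] conjI ballI)
    have "w = vs ! (2 * m + 1)" using hl(2) ne len by (simp add: last_conv_nth)
    then show "w = \<alpha> ((f ^^ m) z)" using step[of "2 * m + 1"] len by simp
    fix n assume "n \<in> {1..m}"
    then show "(f ^^ n) z \<notin> Q" using step[of "2 * n"] len by simp
  qed
next
  assume "\<exists>m. w = \<alpha> ((f ^^ m) z) \<and> (\<forall>n\<in>{1..m}. (f ^^ n) z \<notin> Q)"
  then obtain m where w: "w = \<alpha> ((f ^^ m) z)" and nQ: "\<And>n. n > 0 \<Longrightarrow> n \<le> m \<Longrightarrow> (f ^^ n) z \<notin> Q" by auto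
  note bl = f_pow[OF z(1)]
  let ?u = "\<lambda>n. (f ^^ n) z" and ?v = "\<lambda>n. \<alpha> ((f ^^ n) z)"
  let ?vs = "zigzag ?u ?v (Suc m)"
  \<comment> \<open>A repetition would return the orbit to \<open>z\<close> after at most
    \<open>m\<close> steps, but \<open>z\<close> lies in \<open>Q\<close>.\<close>
  have neq: "?u a \<noteq> ?u b" if "a < b" "b \<le> m" for a b
  proof
    assume "?u a = ?u b"
    then have "(f ^^ (b - a)) z = z"
      using funpow_diff[OF perm(2,3) z(1)] that(1) by simp
    moreover have "b - a \<le> m" "b - a > 0" using that by linarith+
    ultimately show False using nQ[of "b - a"] z by simp
  qed
  have inj: "inj_on ?u {..<Suc m}" using neq by (auto simp: inj_on_def) (metis less_Suc_eq_le nat_neq_iff)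
  then have inj': "inj_on ?v {..<Suc m}" using \<alpha>_eq[OF bl bl] by (auto simp: inj_on_def)
  have "alt_walk K i 0 ?vs"
  proof (rule alt_walk_zigzag)
    show "?u ` {..<Suc m} \<union> ?v ` {..<Suc m} \<subseteq> cverts K"
      using bl \<alpha>_white[OF bl] unfolding cverts_def by blast
    show "cadj K i (?u n) (?v n)" for n unfolding cadj_i using bl by blast
    show "cadj K 0 (?v n) (?u (Suc n))" if "Suc n < Suc m" for n
      unfolding cadj_0 using bl[of "Suc n"] \<beta>_f[OF bl, of n] nQ[of "Suc n"] that by simp
  qed
  moreover have "distinct ?vs"
    using inj inj' disj[OF bl] \<alpha>_white[OF bl] by (intro distinct_zigzag) (auto, metis)
  ultimately show "\<exists>vs. alt_path K i 0 vs \<and> hd vs = z \<and> last vs = w"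
    unfolding alt_path_def w using hd_last_zigzag[of "Suc m" ?u ?v] by (intro exI[of _ ?vs]) simp
qed

end

section \<open>Pairings and contractions\<close>

lemma color_degree_black:
  assumes "wf_cgraph G" "b \<in> blacks G"
  shows "color_degree G c b = card {w. (b, w, c) \<in> cedges G}"
proof -
  have "{e \<in> cedges G. ecolor e = c \<and> (b = fst e \<or> b = fst (snd e))} = (\<lambda>w. (b, w, c)) ` {w. (b, w, c) \<in> cedges G}"
    using assms unfolding wf_cgraph_def ecolor_def by force
  moreover have "inj_on (\<lambda>w. (b, w, c)) {w. (b, w, c) \<in> cedges G}" by (auto simp: inj_on_def)
  ultimately show ?thesis unfolding color_degree_def by (simp add: card_image)
qed

lemma color_degree_white:
  assumes "wf_cgraph G" "w \<in> whites G"
  shows "color_degree G c w = card {b. (b, w, c) \<in> cedges G}"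
proof -
  have "{e \<in> cedges G. ecolor e = c \<and> (w = fst e \<or> w = fst (snd e))} = (\<lambda>b. (b, w, c)) ` {b. (b, w, c) \<in> cedges G}"
    using assms unfolding wf_cgraph_def ecolor_def by force
  moreover have "inj_on (\<lambda>b. (b, w, c)) {b. (b, w, c) \<in> cedges G}" by (auto simp: inj_on_def)
  ultimately show ?thesis unfolding color_degree_def by (simp add: card_image)
qed

lemma cedges_ends:
  assumes "wf_cgraph G" "(b, w, c) \<in> cedges G" shows "b \<in> blacks G" "w \<in> whites G"
  using assms unfolding wf_cgraph_def by auto

text \<open>Reads a color with degrees \<open>0\<close> and \<open>1\<close> as a bijection;
  \<open>Z\<close> will be empty for the colors \<open>1\<close> to \<open>D\<close> and the set of
  degree-D vertices for color \<open>0\<close>.\<close>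

lemma partial_matching_obtain:
  assumes wf: "wf_cgraph G"
    and deg: "\<And>v. v \<in> cverts G \<Longrightarrow> color_degree G c v = (if v \<in> Z then 0 else 1)"
  obtains \<alpha> where "bij_betw \<alpha> (blacks G - Z) (whites G - Z)"
    "\<And>b w. (b, w, c) \<in> cedges G \<longleftrightarrow> b \<in> blacks G \<and> b \<notin> Z \<and> w = \<alpha> b"
proof -
  define \<alpha> where "\<alpha> b = (THE w. (b, w, c) \<in> cedges G)" for b
  have finE: "finite (cedges G)" using wf unfolding wf_cgraph_def by blast
  have single: "\<exists>w. {w. (b, w, c) \<in> cedges G} = {w}" if "b \<in> blacks G" "b \<notin> Z" for b
    using deg[of b] color_degree_black[OF wf that(1)] that unfolding cverts_def
    by (metis UnI1 card_1_singletonE)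
  have singlew: "\<exists>b. {b. (b, w, c) \<in> cedges G} = {b}" if "w \<in> whites G" "w \<notin> Z" for w
    using deg[of w] color_degree_white[OF wf that(1)] that unfolding cverts_def
    by (metis UnI2 card_1_singletonE)
  have Z: "b \<notin> Z" "w \<notin> Z" if e: "(b, w, c) \<in> cedges G" for b w
  proof -
    \<comment> \<open>Finiteness comes first, since \<open>card\<close> of an infinite set would
      also be \<open>0\<close>.\<close>
    have "finite (fst ` cedges G)" "finite ((fst \<circ> snd) ` cedges G)" using finE by simp_all
    moreover have "{b. (b, w, c) \<in> cedges G} \<subseteq> fst ` cedges G" "{w. (b, w, c) \<in> cedges G} \<subseteq> (fst \<circ> snd) ` cedges G"
      by (auto simp: image_iff) force+
    ultimately have "finite {b. (b, w, c) \<in> cedges G}" "finite {w. (b, w, c) \<in> cedges G}"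
      by (metis finite_subset)+
    moreover have "b \<in> {b. (b, w, c) \<in> cedges G}" "w \<in> {w. (b, w, c) \<in> cedges G}" using e by simp_all
    ultimately have "card {b. (b, w, c) \<in> cedges G} \<noteq> 0" "card {w. (b, w, c) \<in> cedges G} \<noteq> 0"
      by (metis card_0_eq empty_iff)+
    then show "b \<notin> Z" "w \<notin> Z"
      using deg[of b] deg[of w] color_degree_white[OF wf cedges_ends(2)[OF wf e], of c] color_degree_black[OF wf cedges_ends(1)[OF wf e], of c]
        cedges_ends[OF wf e] unfolding cverts_def by auto
  qed
  have \<alpha>: "(b, w, c) \<in> cedges G \<longleftrightarrow> w = \<alpha> b" if b: "b \<in> blacks G" "b \<notin> Z" for b w
  proof -
    obtain u where "{w. (b, w, c) \<in> cedges G} = {u}" using single[OF b] by blast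
    then have u: "(b, w, c) \<in> cedges G \<longleftrightarrow> w = u" for w by blast
    then have "\<alpha> b = u" unfolding \<alpha>_def by simp
    then show ?thesis using u by simp
  qed
  have edge: "(b, w, c) \<in> cedges G \<longleftrightarrow> b \<in> blacks G \<and> b \<notin> Z \<and> w = \<alpha> b" for b w
    using \<alpha>[of b w] cedges_ends(1)[OF wf, of b w c] Z(1)[of b w] by blast
  have "bij_betw \<alpha> (blacks G - Z) (whites G - Z)"
    unfolding bij_betw_def
  proof (intro conjI inj_onI equalityI subsetI)
    fix a b assume ab: "a \<in> blacks G - Z" "b \<in> blacks G - Z" "\<alpha> a = \<alpha> b"
    have e: "(a, \<alpha> a, c) \<in> cedges G" "(b, \<alpha> a, c) \<in> cedges G" using edge ab by auto
    obtain x where x: "{b. (b, \<alpha> a, c) \<in> cedges G} = {x}"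
      using singlew[OF cedges_ends(2)[OF wf e(1)] Z(2)[OF e(1)]] by blast
    have "a \<in> {b. (b, \<alpha> a, c) \<in> cedges G}" "b \<in> {b. (b, \<alpha> a, c) \<in> cedges G}" using e by simp_all
    then show "a = b" unfolding x by simp
  next
    fix w assume "w \<in> \<alpha> ` (blacks G - Z)"
    then obtain b where "b \<in> blacks G" "b \<notin> Z" "w = \<alpha> b" by blast
    then have e: "(b, w, c) \<in> cedges G" using edge by simp
    then show "w \<in> whites G - Z" using cedges_ends(2)[OF wf e] Z(2)[OF e] by simp
  next
    fix w assume "w \<in> whites G - Z"
    then obtain b where "{b. (b, w, c) \<in> cedges G} = {b}" using singlew[of w] by blast
    then have "(b, w, c) \<in> cedges G" by blast
    then show "w \<in> \<alpha> ` (blacks G - Z)" using edge[of b w] by simp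
  qed
  then show ?thesis using that edge by blast
qed

lemma perfect_matching_obtain:
  assumes "wf_cgraph G" and "\<And>v. v \<in> cverts G \<Longrightarrow> color_degree G c v = 1"
  obtains \<alpha> where "bij_betw \<alpha> (blacks G) (whites G)"
    "\<And>b w. (b, w, c) \<in> cedges G \<longleftrightarrow> b \<in> blacks G \<and> w = \<alpha> b"
  using partial_matching_obtain[OF assms(1), of c "{}"] assms(2) by auto

section \<open>Pairings as bijections from black to white vertices\<close>

definition pairs_of :: "'v cgraph \<Rightarrow> ('v \<Rightarrow> 'v) \<Rightarrow> 'v set set" where
  "pairs_of B \<phi> = (\<lambda>b. {b, \<phi> b}) ` blacks B"

lemma pairing_pairs_of:
  assumes "wf_cgraph B" "bij_betw \<phi> (blacks B) (whites B)"
  shows "pairing B (pairs_of B \<phi>)"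
  unfolding pairing_def
proof (intro conjI partition_onI)
  have disj: "blacks B \<inter> whites B = {}" using assms(1) unfolding wf_cgraph_def by blast
  have im: "\<phi> ` blacks B = whites B" and inj: "inj_on \<phi> (blacks B)"
    using assms(2) unfolding bij_betw_def by auto
  show "\<Union> (pairs_of B \<phi>) = cverts B" unfolding pairs_of_def cverts_def im[symmetric] by auto
  show "{} \<notin> pairs_of B \<phi>" unfolding pairs_of_def by auto
  show "\<forall>P\<in>pairs_of B \<phi>. \<exists>b\<in>blacks B. \<exists>w\<in>whites B. P = {b, w}"
    unfolding pairs_of_def im[symmetric] by blast
  fix p p' assume "p \<in> pairs_of B \<phi>" "p' \<in> pairs_of B \<phi>" and ne: "p \<noteq> p'"
  then obtain a b where ab: "a \<in> blacks B" "b \<in> blacks B" "p = {a, \<phi> a}" "p' = {b, \<phi> b}"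
    unfolding pairs_of_def by blast
  have "a \<noteq> b" using ab ne by auto
  moreover have "\<phi> a \<noteq> \<phi> b" using inj_onD[OF inj] ab(1,2) \<open>a \<noteq> b\<close> by blast
  moreover have "\<phi> a \<in> whites B" "\<phi> b \<in> whites B" using im ab by blast+
  ultimately show "disjnt p p'" using ab disj unfolding disjnt_def by auto
qed

lemma pairing_obtain:
  assumes wf: "wf_cgraph B" and \<Omega>: "pairing B \<Omega>"
  obtains \<phi> where "bij_betw \<phi> (blacks B) (whites B)" "\<Omega> = pairs_of B \<phi>"
proof -
  have disj: "blacks B \<inter> whites B = {}" using wf unfolding wf_cgraph_def by blast
  have cov: "\<Union>\<Omega> = blacks B \<union> whites B" and dis: "\<And>P P'. P \<in> \<Omega> \<Longrightarrow> P' \<in> \<Omega> \<Longrightarrow> P \<noteq> P' \<Longrightarrow> P \<inter> P' = {}"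
    and bw: "\<And>P. P \<in> \<Omega> \<Longrightarrow> \<exists>b\<in>blacks B. \<exists>w\<in>whites B. P = {b, w}"
    using \<Omega> unfolding pairing_def partition_on_def cverts_def disjoint_def by auto
  have "\<exists>w. w \<in> whites B \<and> {b, w} \<in> \<Omega>" if b: "b \<in> blacks B" for b
  proof -
    obtain P where P: "P \<in> \<Omega>" "b \<in> P" using cov b by blast
    obtain b' w where bw': "b' \<in> blacks B" "w \<in> whites B" "P = {b', w}" using bw[OF P(1)] by blast
    then have "b' = b" using P(2) b disj by auto
    then show ?thesis using P bw' by blast
  qed
  then obtain \<phi> where \<phi>: "\<And>b. b \<in> blacks B \<Longrightarrow> \<phi> b \<in> whites B" "\<And>b. b \<in> blacks B \<Longrightarrow> {b, \<phi> b} \<in> \<Omega>"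
    by metis
  have surj: "\<exists>b\<in>blacks B. P = {b, \<phi> b}" if P: "P \<in> \<Omega>" for P
  proof -
    obtain b w where bw': "b \<in> blacks B" "w \<in> whites B" "P = {b, w}" using bw[OF P] by blast
    have "P = {b, \<phi> b}" using dis[OF P \<phi>(2)[OF bw'(1)]] bw'(3) by blast
    then show ?thesis using bw'(1) by blast
  qed
  have eq: "\<Omega> = pairs_of B \<phi>" unfolding pairs_of_def using surj \<phi>(2) by blast
  have "bij_betw \<phi> (blacks B) (whites B)"
    unfolding bij_betw_def
  proof (intro conjI inj_onI equalityI subsetI)
    fix a b assume ab: "a \<in> blacks B" "b \<in> blacks B" "\<phi> a = \<phi> b"
    then have "{a, \<phi> a} = {b, \<phi> b}" using dis[OF \<phi>(2)[OF ab(1)] \<phi>(2)[OF ab(2)]] by auto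
    then have "a \<in> {b, \<phi> b}" by blast
    then show "a = b" using ab(1) \<phi>(1)[OF ab(2)] disj by auto
  next
    fix w assume "w \<in> \<phi> ` blacks B" then show "w \<in> whites B" using \<phi>(1) by blast
  next
    fix w assume w: "w \<in> whites B"
    then obtain P where P: "P \<in> \<Omega>" "w \<in> P" using cov by blast
    obtain b where "b \<in> blacks B" "P = {b, \<phi> b}" using surj[OF P(1)] by blast
    then show "w \<in> \<phi> ` blacks B" using P(2) w disj by auto
  qed
  then show ?thesis using that eq by blast
qed

section \<open>Faces, contraction and circuit rank of a paired graph\<close>

text \<open>\<open>h c\<close> is \<open>\<alpha> c\<close> followed by the inverse of \<phi>. On
  the black vertices it is the face permutation of the colors \<open>0\<close> and \<open>c\<close>
  of the paired graph, and it also describes the color \<open>c\<close> edges of the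
  contraction.\<close>

locale paired_graph =
  fixes D :: nat and B :: "'v cgraph" and \<alpha> :: "nat \<Rightarrow> 'v \<Rightarrow> 'v" and \<phi> :: "'v \<Rightarrow> 'v" and h :: "nat \<Rightarrow> 'v \<Rightarrow> 'v"
  assumes wf: "wf_cgraph B" and colors: "ecolor ` cedges B \<subseteq> {1..D}"
    and \<alpha>_bij: "c \<in> {1..D} \<Longrightarrow> bij_betw (\<alpha> c) (blacks B) (whites B)"
    and edge: "c \<in> {1..D} \<Longrightarrow> (b, w, c) \<in> cedges B \<longleftrightarrow> b \<in> blacks B \<and> w = \<alpha> c b"
    and \<phi>_bij: "bij_betw \<phi> (blacks B) (whites B)"
    and h_black: "c \<in> {1..D} \<Longrightarrow> b \<in> blacks B \<Longrightarrow> h c b \<in> blacks B"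
    and \<phi>_h: "c \<in> {1..D} \<Longrightarrow> b \<in> blacks B \<Longrightarrow> \<phi> (h c b) = \<alpha> c b"
begin

lemma fin: "finite (blacks B)" and disj: "b \<in> blacks B \<Longrightarrow> b \<notin> whites B"
  using wf unfolding wf_cgraph_def by auto

lemma \<phi>_white: "b \<in> blacks B \<Longrightarrow> \<phi> b \<in> whites B"
  using \<phi>_bij by (rule bij_betwE[rule_format])

lemma \<phi>_eq: "a \<in> blacks B \<Longrightarrow> b \<in> blacks B \<Longrightarrow> \<phi> a = \<phi> b \<longleftrightarrow> a = b"
  using \<phi>_bij unfolding bij_betw_def inj_on_def by blast

lemma pair_in_iff: "b \<in> blacks B \<Longrightarrow> w \<in> whites B \<Longrightarrow> {b, w} \<in> pairs_of B \<phi> \<longleftrightarrow> w = \<phi> b"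
  unfolding pairs_of_def using disj \<phi>_white by (auto simp: doubleton_eq_iff)

lemma edge_color: "(b, w, c) \<in> cedges B \<Longrightarrow> c \<in> {1..D}"
  using colors unfolding ecolor_def by (metis image_subset_iff snd_conv)

lemma face_perm_add_pairing:
  assumes c: "c \<in> {1..D}"
  shows "face_perm (add_pairing B (pairs_of B \<phi>)) c {} (\<alpha> c) \<phi> (h c)"
proof -
  let ?K = "add_pairing B (pairs_of B \<phi>)"
  have K: "blacks ?K = blacks B" "whites ?K = whites B"
    "cedges ?K = cedges B \<union> {(b, w, 0) | b w. b \<in> blacks B \<and> w \<in> whites B \<and> {b, w} \<in> pairs_of B \<phi>}"
    unfolding add_pairing_def by simp_all
  have e0: "(b, w, 0) \<notin> cedges B" for b w using edge_color[of b w 0] by auto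
  show ?thesis
  proof
    have "finite ((\<lambda>b. (b, \<phi> b, 0 :: nat)) ` blacks B)" using fin by simp
    moreover have "{(b, w, 0 :: nat) | b w. b \<in> blacks B \<and> w \<in> whites B \<and> {b, w} \<in> pairs_of B \<phi>}
        \<subseteq> (\<lambda>b. (b, \<phi> b, 0)) ` blacks B" using pair_in_iff by auto
    ultimately have "finite {(b, w, 0 :: nat) | b w. b \<in> blacks B \<and> w \<in> whites B \<and> {b, w} \<in> pairs_of B \<phi>}"
      by (rule finite_subset[rotated])
    then show "wf_cgraph ?K" using wf unfolding wf_cgraph_def K by auto
    show "\<alpha> c b \<in> whites ?K" if "b \<in> blacks ?K" for b
      using bij_betwE[OF \<alpha>_bij[OF c]] that unfolding K by blast
    show "inj_on (\<alpha> c) (blacks ?K)" using \<alpha>_bij[OF c] unfolding K bij_betw_def by blast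
    show "(b, w, c) \<in> cedges ?K \<longleftrightarrow> b \<in> blacks ?K \<and> w = \<alpha> c b" for b w
      using edge[OF c] c unfolding K by auto
    show "bij_betw \<phi> (blacks ?K) (whites ?K)" using \<phi>_bij unfolding K .
    show "(b, w, 0) \<in> cedges ?K \<longleftrightarrow> b \<in> blacks ?K \<and> b \<notin> {} \<and> w = \<phi> b" for b w
      using e0 pair_in_iff[of b w] \<phi>_white[of b] unfolding K by auto
    show "h c b \<in> blacks ?K" if "b \<in> blacks ?K" for b using h_black[OF c] that unfolding K .
    show "\<phi> (h c b) = \<alpha> c b" if "b \<in> blacks ?K" for b using \<phi>_h[OF c] that unfolding K .
  qed
qed

lemma Phi0_add_pairing:
  "Phi0 D (add_pairing B (pairs_of B \<phi>)) = (\<Sum>i=1..D. card (orb (h i) ` blacks B))"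
  unfolding Phi0_def
proof (rule sum.cong)
  fix i assume i: "i \<in> {1..D}"
  interpret face_perm "add_pairing B (pairs_of B \<phi>)" i "{}" "\<alpha> i" \<phi> "h i"
    using face_perm_add_pairing[OF i] .
  show "card {set vs |vs. alt_cycle (add_pairing B (pairs_of B \<phi>)) 0 i vs} = card (orb (h i) ` blacks B)"
    using card_alt_cycles by (simp add: add_pairing_def)
qed simp

lemma h_perm:
  assumes c: "c \<in> {1..D}" shows "inj_on (h c) (blacks B)" "h c ` blacks B \<subseteq> blacks B"
proof -
  interpret face_perm "add_pairing B (pairs_of B \<phi>)" c "{}" "\<alpha> c" \<phi> "h c"
    using face_perm_add_pairing[OF c] .
  show "inj_on (h c) (blacks B)" "h c ` blacks B \<subseteq> blacks B"
    using f_inj f_into by (simp_all add: add_pairing_def)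
qed

lemma block_of_pairs:
  assumes b: "b \<in> blacks B"
  shows "block_of (pairs_of B \<phi>) b = {b, \<phi> b}" "block_of (pairs_of B \<phi>) (\<phi> b) = {b, \<phi> b}"
proof -
  have in_b: "P \<in> pairs_of B \<phi> \<and> b \<in> P \<longleftrightarrow> P = {b, \<phi> b}" for P
    unfolding pairs_of_def using b disj[OF b] \<phi>_white by auto
  have in_w: "P \<in> pairs_of B \<phi> \<and> \<phi> b \<in> P \<longleftrightarrow> P = {b, \<phi> b}" for P
    unfolding pairs_of_def using b disj \<phi>_white[OF b] \<phi>_eq[OF b] by auto
  show "block_of (pairs_of B \<phi>) b = {b, \<phi> b}" unfolding block_of_def in_b by simp
  show "block_of (pairs_of B \<phi>) (\<phi> b) = {b, \<phi> b}" unfolding block_of_def in_w by simp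
qed

lemma pair_inj: "inj_on (\<lambda>b. {b, \<phi> b}) (blacks B)"
  using disj \<phi>_white by (auto simp: inj_on_def doubleton_eq_iff)

lemma contraction_ends:
  assumes "(b, w, c) \<in> cedges B"
  shows "b \<in> blacks B" "c \<in> {1..D}" "w = \<alpha> c b"
    "block_of (pairs_of B \<phi>) b = {b, \<phi> b}" "block_of (pairs_of B \<phi>) w = {h c b, \<phi> (h c b)}"
proof -
  show c: "c \<in> {1..D}" using edge_color[OF assms] .
  show b: "b \<in> blacks B" and w: "w = \<alpha> c b" using edge[OF c] assms by auto
  show "block_of (pairs_of B \<phi>) b = {b, \<phi> b}" using block_of_pairs(1)[OF b] .
  show "block_of (pairs_of B \<phi>) w = {h c b, \<phi> (h c b)}"
    using block_of_pairs(2)[OF h_black[OF c b]] \<phi>_h[OF c b] w by simp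
qed

lemma wf_contraction: "wf_digraph (contraction B (pairs_of B \<phi>))"
proof
  fix e assume "e \<in> arcs (contraction B (pairs_of B \<phi>))"
  then obtain b w c where e: "e = (b, w, c)" "(b, w, c) \<in> cedges B"
    by (cases e) (auto simp: contraction_def)
  note ends = contraction_ends[OF e(2)]
  show "tail (contraction B (pairs_of B \<phi>)) e \<in> verts (contraction B (pairs_of B \<phi>))"
    using ends e by (auto simp: contraction_def pairs_of_def)
  show "head (contraction B (pairs_of B \<phi>)) e \<in> verts (contraction B (pairs_of B \<phi>))"
    using ends e h_black[OF ends(2,1)] by (auto simp: contraction_def pairs_of_def)
qed

lemma card_color_edges:
  assumes "c \<in> {1..D}" shows "card {e \<in> cedges B. ecolor e = c} = card (blacks B)"
proof -
  have "{e \<in> cedges B. ecolor e = c} = (\<lambda>b. (b, \<alpha> c b, c)) ` blacks B"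
    using edge[OF assms] unfolding ecolor_def by force
  moreover have "inj_on (\<lambda>b. (b, \<alpha> c b, c)) (blacks B)" by (auto simp: inj_on_def)
  ultimately show ?thesis by (simp add: card_image)
qed

lemma card_cedges: "card (cedges B) = D * card (blacks B)"
proof -
  have "cedges B = (\<Union>c\<in>{1..D}. {e \<in> cedges B. ecolor e = c})"
    using colors by auto
  then have "card (cedges B) = card (\<Union>c\<in>{1..D}. {e \<in> cedges B. ecolor e = c})" by simp
  also have "\<dots> = (\<Sum>c\<in>{1..D}. card {e \<in> cedges B. ecolor e = c})"
    using wf unfolding wf_cgraph_def by (intro card_UN_disjoint) auto
  also have "\<dots> = (\<Sum>c\<in>{1..D}. card (blacks B))" by (rule sum.cong) (use card_color_edges in auto)
  finally show ?thesis by simp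
qed

text \<open>In the contraction the color \<open>c\<close> edge at \<open>b\<close> leads from the
  pair of \<open>b\<close> to the pair of \<open>h c b\<close>, so the components are the cycles of
  \<open>h c\<close>.\<close>

lemma card_components_color:
  assumes c: "c \<in> {1..D}"
  shows "card (components (color_subgraph (contraction B (pairs_of B \<phi>)) c)) = card (orb (h c) ` blacks B)"
proof -
  let ?H = "color_subgraph (contraction B (pairs_of B \<phi>)) c"
  let ?blk = "\<lambda>b. {b, \<phi> b}"
  note perm = fin h_perm[OF c]
  have verts: "verts ?H = ?blk ` blacks B" by (simp add: color_subgraph_def contraction_def pairs_of_def)
  have wfH: "wf_digraph ?H"
    using wf_contraction unfolding wf_digraph_def color_subgraph_def by simp
  have closed: "closed_in ?H S \<longleftrightarrow> (\<forall>b\<in>blacks B. ?blk b \<in> S \<longleftrightarrow> ?blk (h c b) \<in> S)" for S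
  proof -
    have "closed_in ?H S \<longleftrightarrow> (\<forall>(b, w, c')\<in>cedges B. c' = c \<longrightarrow>
        (block_of (pairs_of B \<phi>) b \<in> S \<longleftrightarrow> block_of (pairs_of B \<phi>) w \<in> S))"
      unfolding closed_in_def color_subgraph_def contraction_def ecolor_def by auto
    also have "\<dots> \<longleftrightarrow> (\<forall>b\<in>blacks B. ?blk b \<in> S \<longleftrightarrow> ?blk (h c b) \<in> S)"
    proof
      assume L: "\<forall>(b, w, c')\<in>cedges B. c' = c \<longrightarrow>
        (block_of (pairs_of B \<phi>) b \<in> S \<longleftrightarrow> block_of (pairs_of B \<phi>) w \<in> S)"
      show "\<forall>b\<in>blacks B. ?blk b \<in> S \<longleftrightarrow> ?blk (h c b) \<in> S"
      proof
        fix b assume "b \<in> blacks B"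
        then have e: "(b, \<alpha> c b, c) \<in> cedges B" using edge[OF c] by blast
        show "?blk b \<in> S \<longleftrightarrow> ?blk (h c b) \<in> S"
          using bspec[OF L e] contraction_ends(4,5)[OF e] by simp
      qed
    next
      assume R: "\<forall>b\<in>blacks B. ?blk b \<in> S \<longleftrightarrow> ?blk (h c b) \<in> S"
      show "\<forall>(b, w, c')\<in>cedges B. c' = c \<longrightarrow>
        (block_of (pairs_of B \<phi>) b \<in> S \<longleftrightarrow> block_of (pairs_of B \<phi>) w \<in> S)"
      proof (clarify)
        fix b w assume e: "(b, w, c) \<in> cedges B"
        show "block_of (pairs_of B \<phi>) b \<in> S \<longleftrightarrow> block_of (pairs_of B \<phi>) w \<in> S"
          using bspec[OF R contraction_ends(1)[OF e]] contraction_ends(4,5)[OF e] by simp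
      qed
    qed
    finally show ?thesis .
  qed
  have sub: "Z \<subseteq> blacks B" if "Z \<in> orb (h c) ` blacks B" for Z
    using that orb_subset[OF perm(3)] by blast
  have in_img: "?blk b \<in> ?blk ` Z \<longleftrightarrow> b \<in> Z" if "b \<in> blacks B" "Z \<subseteq> blacks B" for b Z
    using inj_on_image_mem_iff[OF pair_inj that] .
  have comp: "?blk ` orb (h c) x \<in> components ?H" if x: "x \<in> blacks B" for x
  proof (rule componentI[OF wfH, of _ "?blk x"])
    have s: "orb (h c) x \<subseteq> blacks B" using sub x by blast
    show "closed_in ?H (?blk ` orb (h c) x)"
      unfolding closed
    proof
      fix b assume b: "b \<in> blacks B"
      have "b \<in> orb (h c) x \<longleftrightarrow> h c b \<in> orb (h c) x"
        using orb_step[of b "h c" x] orb_back[OF perm x b] by blast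
      then show "?blk b \<in> ?blk ` orb (h c) x \<longleftrightarrow> ?blk (h c b) \<in> ?blk ` orb (h c) x"
        using in_img[OF b s] in_img[OF h_black[OF c b] s] by simp
    qed
    show "?blk x \<in> ?blk ` orb (h c) x" by simp
    show "?blk x \<in> verts ?H" unfolding verts using x by blast
    fix S assume S: "closed_in ?H S" "?blk x \<in> S"
    have "orb (h c) x \<subseteq> {b \<in> blacks B. ?blk b \<in> S}"
    proof (rule orb_least)
      show "x \<in> {b \<in> blacks B. ?blk b \<in> S}" using x S(2) by simp
      fix y assume "y \<in> {b \<in> blacks B. ?blk b \<in> S}"
      then show "h c y \<in> {b \<in> blacks B. ?blk b \<in> S}"
        using S(1) h_black[OF c, of y] unfolding closed by blast
    qed
    then show "?blk ` orb (h c) x \<subseteq> S" by blast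
  qed
  have "components ?H = (\<lambda>Z. ?blk ` Z) ` (orb (h c) ` blacks B)"
  proof
    show "(\<lambda>Z. ?blk ` Z) ` (orb (h c) ` blacks B) \<subseteq> components ?H" using comp by blast
    show "components ?H \<subseteq> (\<lambda>Z. ?blk ` Z) ` (orb (h c) ` blacks B)"
    proof
      fix C assume C: "C \<in> components ?H"
      note part = components_partition[of ?H]
      have "C \<noteq> {}" "C \<subseteq> ?blk ` blacks B"
        using C part unfolding partition_on_def verts by blast+
      then obtain x where x: "x \<in> blacks B" "?blk x \<in> C" by blast
      have "C \<inter> ?blk ` orb (h c) x \<noteq> {}" using x(2) orb_self[of x "h c"] by blast
      then have "C = ?blk ` orb (h c) x"
        using disjointD[OF partition_onD2[OF part] C comp[OF x(1)]] by metis
      then show "C \<in> (\<lambda>Z. ?blk ` Z) ` (orb (h c) ` blacks B)" using x(1) by blast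
    qed
  qed
  moreover have "inj_on (\<lambda>Z. ?blk ` Z) (orb (h c) ` blacks B)"
  proof (rule inj_onI)
    fix X Y assume X: "X \<in> orb (h c) ` blacks B" and Y: "Y \<in> orb (h c) ` blacks B" and eq: "?blk ` X = ?blk ` Y"
    show "X = Y" by (rule iffD1[OF inj_on_image_eq_iff[OF pair_inj sub[OF X] sub[OF Y]] eq])
  qed
  ultimately show ?thesis by (simp add: card_image)
qed

text \<open>The vertices whose pairs lie in a closed set of the contraction form a closed set of
  \<open>B\<close>, which is connected.\<close>

lemma components_contraction:
  assumes conn: "connected_cgraph B"
  shows "components (contraction B (pairs_of B \<phi>)) = {pairs_of B \<phi>}"
proof -
  let ?H = "contraction B (pairs_of B \<phi>)"
  let ?blk = "block_of (pairs_of B \<phi>)"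
  have verts: "verts ?H = pairs_of B \<phi>" by (simp add: contraction_def)
  note part = components_partition[of ?H, unfolded verts]
  have blk_mem: "?blk v \<in> pairs_of B \<phi>" if "v \<in> cverts B" for v
  proof -
    have "v \<in> blacks B \<or> v \<in> \<phi> ` blacks B" using that \<phi>_bij unfolding cverts_def bij_betw_def by blast
    then obtain b where "b \<in> blacks B" "v = b \<or> v = \<phi> b" by blast
    then show ?thesis using block_of_pairs unfolding pairs_of_def by auto
  qed
  have all: "C = pairs_of B \<phi>" if C: "C \<in> components ?H" for C
  proof -
    have sub: "C \<subseteq> pairs_of B \<phi>" and ne: "C \<noteq> {}" using C part unfolding partition_on_def by blast+
    have cl: "closed_in ?H C" by (rule component_closed[OF wf_contraction C])
    have clB: "closed_in (multigraph_of B) {v. ?blk v \<in> C}"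
      using cl unfolding closed_in_def contraction_def multigraph_of_def by simp
    obtain b where b: "b \<in> blacks B" "{b, \<phi> b} \<in> C"
      using sub ne unfolding pairs_of_def by blast
    have "verts (multigraph_of B) \<subseteq> {v. ?blk v \<in> C}"
    proof (rule connected_least[OF _ clB])
      show "connected (multigraph_of B)" using conn unfolding connected_cgraph_def .
      show "b \<in> {v. ?blk v \<in> C}" using b block_of_pairs(1) by simp
      show "b \<in> verts (multigraph_of B)" using b by (simp add: multigraph_of_def cverts_def)
    qed
    then have "{a, \<phi> a} \<in> C" if "a \<in> blacks B" for a
      using that block_of_pairs(1)[OF that] by (auto simp: multigraph_of_def cverts_def)
    then show ?thesis using sub unfolding pairs_of_def by blast
  qed
  have "verts (multigraph_of B) \<noteq> {}"
    using conn unfolding connected_cgraph_def connected_def strongly_connected_def by simp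
  then have "pairs_of B \<phi> \<noteq> {}"
    using \<phi>_bij unfolding pairs_of_def multigraph_of_def cverts_def bij_betw_def by auto
  then have "components ?H \<noteq> {}" using part unfolding partition_on_def by auto
  then show ?thesis using all by blast
qed

text \<open>Each color has as many edges as the contraction has vertices, so its circuit rank is its
  number of components, the faces of that color. The whole contraction has \<open>D * q\<close>
  edges, \<open>q\<close> vertices and one component.\<close>

lemma Lm_contraction:
  assumes conn: "connected_cgraph B" and q: "card (blacks B) = q"
  shows "Lm D (contraction B (pairs_of B \<phi>)) =
    (int D - 1) * int q + 1 - int (\<Sum>i=1..D. card (orb (h i) ` blacks B))"
proof -
  let ?H = "contraction B (pairs_of B \<phi>)"
  have cardv: "card (pairs_of B \<phi>) = q"
    unfolding pairs_of_def using card_image[OF pair_inj] q by simp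
  have "circuit_rank ?H = int D * int q - int q + 1"
    unfolding circuit_rank_def components_contraction[OF conn]
    using cardv card_cedges q by (simp add: contraction_def)
  moreover have "circuit_rank (color_subgraph ?H i) = int (card (orb (h i) ` blacks B))" if i: "i \<in> {1..D}" for i
    unfolding circuit_rank_def card_components_color[OF i]
    using cardv card_color_edges[OF i] q by (simp add: color_subgraph_def contraction_def)
  ultimately show ?thesis unfolding Lm_def by (simp add: algebra_simps)
qed

end

section \<open>Bubbles of melonic graphs\<close>

lemma wf_delete0: "wf_cgraph G \<Longrightarrow> wf_cgraph (delete0 G)"
  unfolding wf_cgraph_def delete0_def by auto

lemma cverts_delete0 [simp]: "cverts (delete0 G) = cverts G"
  by (simp add: cverts_def delete0_def)

lemma verts_multigraph_of [simp]: "verts (multigraph_of G) = cverts G"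
  by (simp add: multigraph_of_def)

lemma cverts_induced: "cverts (induced_cgraph G C) = cverts G \<inter> C"
  by (auto simp: cverts_def induced_cgraph_def)

lemma bubble_components:
  "partition_on (cverts G) (components (multigraph_of (delete0 G)))"
  using components_partition[of "multigraph_of (delete0 G)"] by simp

text \<open>Isomorphic bubbles are not identified: an induced subgraph still determines its vertex
  set.\<close>

lemma card_bubbles: "card (bubbles G) = card (components (multigraph_of (delete0 G)))"
proof -
  have "inj_on (induced_cgraph (delete0 G)) (components (multigraph_of (delete0 G)))"
  proof (rule inj_onI)
    fix C C' assume C: "C \<in> components (multigraph_of (delete0 G))" "C' \<in> components (multigraph_of (delete0 G))"
      and eq: "induced_cgraph (delete0 G) C = induced_cgraph (delete0 G) C'"
    have "C \<subseteq> cverts G" "C' \<subseteq> cverts G"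
      using C bubble_components[of G] unfolding partition_on_def by blast+
    moreover have "cverts G \<inter> C = cverts G \<inter> C'"
      using arg_cong[OF eq, of cverts] unfolding cverts_induced by simp
    ultimately show "C = C'" by blast
  qed
  then show ?thesis unfolding bubbles_def by (rule card_image)
qed

lemma quartic_edges:
  assumes "c \<in> {1..D}" "i \<in> {1..D}"
  shows "(Black1, if c = i then White2 else White1, c) \<in> cedges (quartic_melonic D i)"
    "(Black2, if c = i then White1 else White2, c) \<in> cedges (quartic_melonic D i)"
  using assms unfolding quartic_melonic_def by auto

text \<open>\<open>x\<close>, \<open>y\<close>, \<open>u\<close>, \<open>v\<close> are the preimages
  of \<open>Black1\<close>, \<open>Black2\<close>, \<open>White1\<close>, \<open>White2\<close>, and
  the two edges of each color are pulled back along the isomorphism.\<close>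

lemma melonic_bubble_shape:
  assumes sub: "C \<subseteq> cverts G" and iso: "cgraph_iso (induced_cgraph (delete0 G) C) (quartic_melonic D i)"
    and i: "i \<in> {1..D}"
  shows "\<exists>x y u v. x \<noteq> y \<and> u \<noteq> v \<and> blacks G \<inter> C = {x, y} \<and> whites G \<inter> C = {u, v} \<and>
    (\<forall>c\<in>{1..D}. (x, if c = i then v else u, c) \<in> cedges G \<and> (y, if c = i then u else v, c) \<in> cedges G)"
proof -
  let ?I = "induced_cgraph (delete0 G) C"
  have I: "cverts ?I = C" "blacks ?I = blacks G \<inter> C" "whites ?I = whites G \<inter> C"
    using sub unfolding cverts_induced cverts_delete0 by (auto simp: induced_cgraph_def delete0_def)
  have Isub: "cedges ?I \<subseteq> cedges G" "cedges ?I \<subseteq> C \<times> C \<times> UNIV" by (auto simp: induced_cgraph_def delete0_def)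
  obtain f where inj: "inj_on f C" and fb: "f ` (blacks G \<inter> C) = {Black1, Black2}"
    and fw: "f ` (whites G \<inter> C) = {White1, White2}"
    and fe: "(\<lambda>(b, w, c). (f b, f w, c)) ` cedges ?I = cedges (quartic_melonic D i)"
    using iso unfolding cgraph_iso_def I by (auto simp: quartic_melonic_def)
  obtain x where x: "x \<in> blacks G \<inter> C" "f x = Black1" using fb by (metis imageE insertI1)
  obtain y where y: "y \<in> blacks G \<inter> C" "f y = Black2" using fb by (metis imageE insertI1 insertI2)
  obtain u where u: "u \<in> whites G \<inter> C" "f u = White1" using fw by (metis imageE insertI1)
  obtain v where v: "v \<in> whites G \<inter> C" "f v = White2" using fw by (metis imageE insertI1 insertI2)
  have eqI: "a = b" if "a \<in> C" "b \<in> C" "f a = f b" for a b using inj_onD[OF inj that(3) that(1,2)] .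
  have bl: "blacks G \<inter> C = {x, y}"
  proof
    show "blacks G \<inter> C \<subseteq> {x, y}"
    proof
      fix b assume b: "b \<in> blacks G \<inter> C"
      then have "f b \<in> {Black1, Black2}" using fb by blast
      then show "b \<in> {x, y}" using eqI[of b x] eqI[of b y] b x y by auto
    qed
  qed (use x y in blast)
  have wh: "whites G \<inter> C = {u, v}"
  proof
    show "whites G \<inter> C \<subseteq> {u, v}"
    proof
      fix b assume b: "b \<in> whites G \<inter> C"
      then have "f b \<in> {White1, White2}" using fw by blast
      then show "b \<in> {u, v}" using eqI[of b u] eqI[of b v] b u v by auto
    qed
  qed (use u v in blast)
  have lift: "(a, w, c) \<in> cedges G" if q: "(f a, f w, c) \<in> cedges (quartic_melonic D i)" "a \<in> C" "w \<in> C" for a w c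
  proof -
    obtain a' w' where e: "(a', w', c) \<in> cedges ?I" "f a' = f a" "f w' = f w"
      using q(1) unfolding fe[symmetric] by auto
    then have "a' \<in> C" "w' \<in> C" using Isub(2) by auto
    then have "a' = a" "w' = w" using eqI q(2,3) e by metis+
    then show ?thesis using e Isub(1) by blast
  qed
  have "x \<noteq> y" "u \<noteq> v" using x y u v by auto
  moreover have "(x, if c = i then v else u, c) \<in> cedges G \<and> (y, if c = i then u else v, c) \<in> cedges G"
    if c: "c \<in> {1..D}" for c
    using quartic_edges[OF c i] x y u v lift by (cases "c = i") auto
  ultimately show ?thesis using bl wh by blast
qed

text \<open>Here \<open>p b\<close> is the white vertex joined to \<open>b\<close> by \<open>D - 1\<close> edges, \<open>\<tau> b\<close> is the other black vertex
  of the bubble of \<open>b\<close>, and \<open>col b\<close> is the color of this bubble.\<close>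

lemma melonic_structure:
  assumes D: "D \<ge> 3" and G: "G \<in> GG D q (B4m D)"
  obtains p \<tau> col S where "bij_betw p (blacks G) (whites G)"
    "\<And>b. b \<in> blacks G \<Longrightarrow> \<tau> b \<in> blacks G \<and> \<tau> (\<tau> b) = b \<and> col b \<in> {1..D} \<and> col (\<tau> b) = col b"
    "\<And>b w c. c \<in> {1..D} \<Longrightarrow> (b, w, c) \<in> cedges G \<longleftrightarrow> b \<in> blacks G \<and> w = (if c = col b then p (\<tau> b) else p b)"
    "S \<union> \<tau> ` S = blacks G" "S \<inter> \<tau> ` S = {}" "card S = card (bubbles G)"
proof -
  let ?comps = "components (multigraph_of (delete0 G))"
  have wf: "wf_cgraph G" and deg: "\<And>v c. v \<in> cverts G \<Longrightarrow> c \<in> {1..D} \<Longrightarrow> color_degree G c v = 1"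
    and bub: "\<And>H. H \<in> bubbles G \<Longrightarrow> \<exists>B\<in>B4m D. cgraph_iso H B"
    using G unfolding GG_def by auto
  note part = bubble_components[of G]
  have sub: "C \<subseteq> cverts G" if "C \<in> ?comps" for C using part that unfolding partition_on_def by blast
  have dis: "C = C'" if "C \<in> ?comps" "C' \<in> ?comps" "z \<in> C" "z \<in> C'" for C C' z
    using disjointD[OF partition_onD2[OF part] that(1,2)] that(3,4) by blast
  have "\<exists>i x y u v. i \<in> {1..D} \<and> x \<noteq> y \<and> u \<noteq> v \<and> blacks G \<inter> C = {x, y} \<and> whites G \<inter> C = {u, v} \<and>
    (\<forall>c\<in>{1..D}. (x, if c = i then v else u, c) \<in> cedges G \<and> (y, if c = i then u else v, c) \<in> cedges G)"
    if C: "C \<in> ?comps" for C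
  proof -
    have "induced_cgraph (delete0 G) C \<in> bubbles G" unfolding bubbles_def using C by blast
    then obtain i where i: "i \<in> {1..D}" "cgraph_iso (induced_cgraph (delete0 G) C) (quartic_melonic D i)"
      using bub unfolding B4m_def by blast
    show ?thesis using melonic_bubble_shape[OF sub[OF C] i(2,1)] i(1) by blast
  qed
  then obtain I X Y U V where shape: "\<And>C. C \<in> ?comps \<Longrightarrow> I C \<in> {1..D} \<and> X C \<noteq> Y C \<and> U C \<noteq> V C \<and>
    blacks G \<inter> C = {X C, Y C} \<and> whites G \<inter> C = {U C, V C} \<and>
    (\<forall>c\<in>{1..D}. (X C, if c = I C then V C else U C, c) \<in> cedges G \<and> (Y C, if c = I C then U C else V C, c) \<in> cedges G)"
    by metis
  define cm where "cm b = (THE C. C \<in> ?comps \<and> b \<in> C)" for b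
  have cm: "cm b = C" if "C \<in> ?comps" "b \<in> C" for b C
    unfolding cm_def by (rule the_equality) (use that dis in blast)+
  define \<tau> where "\<tau> b = (if b = X (cm b) then Y (cm b) else X (cm b))" for b
  define p where "p b = (if b = X (cm b) then U (cm b) else V (cm b))" for b
  define col where "col b = I (cm b)" for b
  \<comment> \<open>One black vertex from every bubble.\<close>
  let ?S = "X ` ?comps"
  have inC: "X C \<in> C" "Y C \<in> C" "U C \<in> C" "V C \<in> C" if "C \<in> ?comps" for C
    using shape[OF that] by blast+
  have cmX: "cm (X C) = C" "cm (Y C) = C" if "C \<in> ?comps" for C
    using cm[OF that] inC[OF that] by simp_all
  have \<tau>X: "\<tau> (X C) = Y C" "\<tau> (Y C) = X C" if "C \<in> ?comps" for C
    unfolding \<tau>_def using cmX[OF that] shape[OF that] by auto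
  have pX: "p (X C) = U C" "p (Y C) = V C" if "C \<in> ?comps" for C
    unfolding p_def using cmX[OF that] shape[OF that] by auto
  have colX: "col (X C) = I C" "col (Y C) = I C" if "C \<in> ?comps" for C
    unfolding col_def using cmX[OF that] by auto
  have bl: "X C \<in> blacks G" "Y C \<in> blacks G" if "C \<in> ?comps" for C using shape[OF that] by blast+
  have wh: "U C \<in> whites G" "V C \<in> whites G" if "C \<in> ?comps" for C using shape[OF that] by blast+
  have cov: "\<exists>C\<in>?comps. z \<in> C" if "z \<in> cverts G" for z
    using part that unfolding partition_on_def by blast
  have bcase: "\<exists>C\<in>?comps. b = X C \<or> b = Y C" if b: "b \<in> blacks G" for b
  proof -
    obtain C where C: "C \<in> ?comps" "b \<in> C" using cov[of b] b unfolding cverts_def by blast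
    then have "b \<in> {X C, Y C}" using b shape[OF C(1)] by blast
    then show ?thesis using C by blast
  qed
  have wcase: "\<exists>C\<in>?comps. w = U C \<or> w = V C" if w: "w \<in> whites G" for w
  proof -
    obtain C where C: "C \<in> ?comps" "w \<in> C" using cov[of w] w unfolding cverts_def by blast
    then have "w \<in> {U C, V C}" using w shape[OF C(1)] by blast
    then show ?thesis using C by blast
  qed
  have edgeI: "(b, if c = col b then p (\<tau> b) else p b, c) \<in> cedges G" if b: "b \<in> blacks G" and c: "c \<in> {1..D}" for b c
  proof -
    obtain C where C: "C \<in> ?comps" "b = X C \<or> b = Y C" using bcase[OF b] by blast
    have "(X C, if c = I C then V C else U C, c) \<in> cedges G" "(Y C, if c = I C then U C else V C, c) \<in> cedges G"
      using shape[OF C(1)] c by blast+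
    then show ?thesis using C(2) by (elim disjE) (simp_all only: \<tau>X[OF C(1)] pX[OF C(1)] colX[OF C(1)])
  qed
  have edge: "(b, w, c) \<in> cedges G \<longleftrightarrow> b \<in> blacks G \<and> w = (if c = col b then p (\<tau> b) else p b)"
    if c: "c \<in> {1..D}" for b w c
  proof -
    \<comment> \<open>Color \<open>c\<close> is a perfect matching, so the edge found in the bubble
      is the only one at \<open>b\<close>.\<close>
    obtain \<alpha> where "bij_betw \<alpha> (blacks G) (whites G)" and \<alpha>: "\<And>b w. (b, w, c) \<in> cedges G \<longleftrightarrow> b \<in> blacks G \<and> w = \<alpha> b"
      using perfect_matching_obtain[OF wf deg[OF _ c]] by blast
    define t where "t = (if c = col b then p (\<tau> b) else p b)"
    show ?thesis
      using \<alpha>[of b w] \<alpha>[of b t] edgeI[OF _ c, of b, folded t_def] unfolding t_def[symmetric] by blast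
  qed
  have pbij: "bij_betw p (blacks G) (whites G)"
    unfolding bij_betw_def
  proof (intro conjI inj_onI equalityI subsetI)
    fix a b assume ab: "a \<in> blacks G" "b \<in> blacks G" and eq: "p a = p b"
    \<comment> \<open>Of three colors one differs from the colors of both bubbles. It joins
      \<open>a\<close> to \<open>p a\<close> and \<open>b\<close> to \<open>p b\<close>, and it is a
      matching. The bound \<open>D \<ge> 3\<close> enters here.\<close>
    have "{1, 2, 3} - {col a, col b} \<noteq> {}"
      using card_mono[of "{col a, col b}" "{1, 2, 3 :: nat}"] card_insert_le_m1[of 2 "{col b}" "col a"] by auto
    then obtain c where c: "c \<in> {1, 2, 3}" "c \<noteq> col a" "c \<noteq> col b" by blast
    have cD: "c \<in> {1..D}" using c(1) D by auto
    obtain \<alpha> where inj: "bij_betw \<alpha> (blacks G) (whites G)" and \<alpha>: "\<And>b w. (b, w, c) \<in> cedges G \<longleftrightarrow> b \<in> blacks G \<and> w = \<alpha> b"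
      using perfect_matching_obtain[OF wf deg[OF _ cD]] by blast
    have "(a, p a, c) \<in> cedges G" "(b, p b, c) \<in> cedges G"
      using edgeI[OF ab(1) cD] edgeI[OF ab(2) cD] c(2,3) by simp_all
    then have "p a = \<alpha> a" "p b = \<alpha> b" using \<alpha>[of a "p a"] \<alpha>[of b "p b"] by blast+
    then have "\<alpha> a = \<alpha> b" using eq by simp
    then show "a = b" using inj_onD[OF bij_betw_imp_inj_on[OF inj]] ab by blast
  next
    fix w assume "w \<in> p ` blacks G"
    then obtain b where b: "b \<in> blacks G" "w = p b" by blast
    obtain C where C: "C \<in> ?comps" "b = X C \<or> b = Y C" using bcase[OF b(1)] by blast
    then show "w \<in> whites G" using pX[OF C(1)] wh[OF C(1)] b(2) by auto
  next
    fix w assume "w \<in> whites G"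
    then obtain C where C: "C \<in> ?comps" "w = U C \<or> w = V C" using wcase by blast
    then show "w \<in> p ` blacks G" using pX[OF C(1)] bl[OF C(1)] by (metis imageI)
  qed
  have \<tau>p: "\<tau> b \<in> blacks G \<and> \<tau> (\<tau> b) = b \<and> col b \<in> {1..D} \<and> col (\<tau> b) = col b" if b: "b \<in> blacks G" for b
  proof -
    obtain C where C: "C \<in> ?comps" "b = X C \<or> b = Y C" using bcase[OF b] by blast
    then show ?thesis using \<tau>X[OF C(1)] colX[OF C(1)] bl[OF C(1)] shape[OF C(1)] by auto
  qed
  have \<tau>S: "\<tau> ` ?S = Y ` ?comps" unfolding image_image by (rule image_cong) (use \<tau>X in auto)
  have un: "?S \<union> \<tau> ` ?S = blacks G" unfolding \<tau>S using bl bcase by blast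
  have int: "?S \<inter> \<tau> ` ?S = {}"
  proof -
    have "X C \<noteq> Y C'" if C: "C \<in> ?comps" "C' \<in> ?comps" for C C'
    proof
      assume eq: "X C = Y C'"
      then have "C = C'" using cmX(1)[OF C(1)] cmX(2)[OF C(2)] by simp
      then show False using eq shape[OF C(1)] by simp
    qed
    then show ?thesis unfolding \<tau>S by blast
  qed
  have cardS: "card ?S = card (bubbles G)"
    unfolding card_bubbles using cmX(1) by (intro card_image inj_on_inverseI[of _ cm]) auto
  show ?thesis by (rule that[OF pbij \<tau>p edge un int cardS])
qed

section \<open>The lower bound\<close>

text \<open>A chain of \<open>g\<close> that starts outside the image of \<open>g\<close> ends
  outside the domain \<open>M\<close>. Sending each end back to its start gives \<sigma>, whose new
  cycles contain one chain each; hence no two starting points share a cycle.\<close>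

lemma partial_injection_extend:
  assumes fin: "finite P" and M: "M \<subseteq> P" and inj: "inj_on g M" and into: "g ` M \<subseteq> P"
  obtains \<sigma> where "inj_on \<sigma> P" "\<sigma> ` P \<subseteq> P" "\<And>b. b \<in> M \<Longrightarrow> \<sigma> b = g b"
    "\<And>x y. x \<in> P - g ` M \<Longrightarrow> y \<in> P - g ` M \<Longrightarrow> y \<in> orb \<sigma> x \<Longrightarrow> y = x"
proof -
  let ?Q = "P - g ` M" and ?T = "P - M"
  \<comment> \<open>A chain that stays in \<open>M\<close> forever is periodic, so its starting
    point would have a preimage in \<open>M\<close>.\<close>
  have stop: "\<exists>n. (g ^^ n) z \<in> ?T" if z: "z \<in> ?Q" for z
  proof (rule ccontr)
    assume no: "\<not> (\<exists>n. (g ^^ n) z \<in> ?T)"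
    have inM: "(g ^^ n) z \<in> M" for n
    proof (induction n)
      case 0
      then show ?case using no z by (metis DiffD1 DiffI funpow_0)
    next
      case (Suc n)
      have "(g ^^ Suc n) z = g ((g ^^ n) z)" by simp
      then have "(g ^^ Suc n) z \<in> P" using Suc into by blast
      then show ?case using no by blast
    qed
    have sub: "orb g z \<subseteq> M" using inM by (auto elim: orbE)
    have "finite (orb g z)" using finite_subset[OF subset_trans[OF sub M] fin] .
    moreover have "inj_on g (orb g z)" using inj_on_subset[OF inj sub] .
    moreover have "g ` orb g z \<subseteq> orb g z" using orb_step[of _ g z] by blast
    ultimately obtain N where N: "N > 0" "(g ^^ N) z = z" using funpow_period[OF _ _ _ orb_self[of z g]] by blast
    then have "z = g ((g ^^ (N - 1)) z)" by (metis Suc_diff_1 comp_apply funpow.simps(2))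
    then show False using z inM[of "N - 1"] by blast
  qed
  define N where "N z = (LEAST n. (g ^^ n) z \<in> ?T)" for z
  define e where "e z = (g ^^ N z) z" for z
  have eT: "e z \<in> ?T" if "z \<in> ?Q" for z
    unfolding e_def N_def using stop[OF that] by (rule LeastI_ex)
  have before: "(g ^^ n) z \<in> M" if z: "z \<in> ?Q" and n: "n < N z" for z n
    using n
  proof (induction n)
    case 0
    then show ?case using not_less_Least[of 0 "\<lambda>n. (g ^^ n) z \<in> ?T"] z unfolding N_def by auto
  next
    case (Suc n)
    have "(g ^^ n) z \<in> M" using Suc by simp
    moreover have "(g ^^ Suc n) z = g ((g ^^ n) z)" by simp
    ultimately have "(g ^^ Suc n) z \<in> P" using into by blast
    moreover have "(g ^^ Suc n) z \<notin> ?T"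
      using not_less_Least[of "Suc n" "\<lambda>n. (g ^^ n) z \<in> ?T"] Suc.prems unfolding N_def by blast
    ultimately show ?case by blast
  qed
  \<comment> \<open>From a common point one walks back along both chains, by injectivity of
    \<open>g\<close>, until the shorter walk is used up.\<close>
  have cancel: "z = (g ^^ (n - m)) z'"
    if "\<forall>k<m. (g ^^ k) z \<in> M" "\<forall>k<n. (g ^^ k) z' \<in> M" "m \<le> n" "(g ^^ m) z = (g ^^ n) z'" for z z' m n
    using that
  proof (induction m arbitrary: n)
    case (Suc m)
    obtain k where k: "n = Suc k" using Suc.prems(3) by (cases n) auto
    have "g ((g ^^ m) z) = g ((g ^^ k) z')" using Suc.prems(4) k by simp
    moreover have "(g ^^ m) z \<in> M" "(g ^^ k) z' \<in> M" using Suc.prems(1,2) k by auto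
    ultimately have "(g ^^ m) z = (g ^^ k) z'" using inj_onD[OF inj] by blast
    then show ?case using Suc.IH[of k] Suc.prems k by simp
  qed simp
  \<comment> \<open>If two chains end in the same point, the shorter one starts on the other one. A
    starting point is no value of \<open>g\<close> on \<open>M\<close>, so the chains are
    equal.\<close>
  have einj0: "z = z'" if z: "z \<in> ?Q" "z' \<in> ?Q" and eq: "e z = e z'" and le: "N z \<le> N z'" for z z'
  proof -
    have *: "z = (g ^^ (N z' - N z)) z'"
      using cancel[of "N z" z "N z'" z'] before[OF z(1)] before[OF z(2)] le eq unfolding e_def by blast
    show ?thesis
    proof (cases "N z' - N z")
      case 0
      then show ?thesis using * by simp
    next
      case (Suc k)
      then have "z = g ((g ^^ k) z')" using * by simp
      moreover have "(g ^^ k) z' \<in> M" using before[OF z(2), of k] Suc by simp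
      ultimately show ?thesis using z(1) by blast
    qed
  qed
  have einj: "inj_on e ?Q"
  proof (rule inj_onI)
    fix x y assume xy: "x \<in> ?Q" "y \<in> ?Q" "e x = e y"
    show "x = y"
      using einj0[OF xy] einj0[OF xy(2,1) xy(3)[symmetric]] by (cases "N x \<le> N y") auto
  qed
  have "card ?Q = card ?T"
    using card_image[OF inj] into M fin finite_subset[OF M fin] finite_subset[OF into fin]
    by (simp add: card_Diff_subset)
  then have eimg: "e ` ?Q = ?T"
    using fin card_image[OF einj] eT by (intro card_subset_eq) auto
  define \<sigma> where "\<sigma> b = (if b \<in> M then g b else inv_into ?Q e b)" for b
  have \<sigma>M: "\<sigma> b = g b" if "b \<in> M" for b using that by (simp add: \<sigma>_def)
  have \<sigma>T: "\<sigma> b \<in> ?Q" "e (\<sigma> b) = b" if "b \<in> ?T" for b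
  proof -
    have "b \<in> e ` ?Q" using that eimg by simp
    moreover have "\<sigma> b = inv_into ?Q e b" using that by (simp add: \<sigma>_def)
    ultimately show "\<sigma> b \<in> ?Q" "e (\<sigma> b) = b" using inv_into_into[of b e ?Q] f_inv_into_f[of b e ?Q] by simp_all
  qed
  have \<sigma>e: "\<sigma> (e z) = z" if "z \<in> ?Q" for z
    using eT[OF that] inv_into_f_f[OF einj that] by (simp add: \<sigma>_def)
  have "inj_on \<sigma> P"
  proof (rule inj_onI)
    fix x y assume xy: "x \<in> P" "y \<in> P" and eq: "\<sigma> x = \<sigma> y"
    consider "x \<in> M" "y \<in> M" | "x \<in> M" "y \<in> ?T" | "x \<in> ?T" "y \<in> M" | "x \<in> ?T" "y \<in> ?T" using xy by blast
    then show "x = y"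
    proof cases
      case 1
      then show ?thesis using eq \<sigma>M inj_onD[OF inj] by simp
    next
      case 2
      have "\<sigma> y \<in> g ` M" using eq \<sigma>M[OF 2(1)] 2(1) by (metis imageI)
      then show ?thesis using \<sigma>T(1)[OF 2(2)] by blast
    next
      case 3
      have "\<sigma> x \<in> g ` M" using eq \<sigma>M[OF 3(2)] 3(2) by (metis imageI)
      then show ?thesis using \<sigma>T(1)[OF 3(1)] by blast
    next
      case 4
      then show ?thesis using eq \<sigma>T(2)[OF 4(1)] \<sigma>T(2)[OF 4(2)] by metis
    qed
  qed
  moreover have "\<sigma> ` P \<subseteq> P"
  proof (rule image_subsetI)
    fix x assume "x \<in> P"
    then consider "x \<in> M" | "x \<in> ?T" by blast
    then show "\<sigma> x \<in> P" using \<sigma>M into \<sigma>T(1) by cases auto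
  qed
  \<comment> \<open>The orbit of \<open>x\<close> is its chain, and all later points of the chain
    are values of \<open>g\<close> on \<open>M\<close>.\<close>
  moreover have "y = x" if x: "x \<in> ?Q" and y: "y \<in> ?Q" and o: "y \<in> orb \<sigma> x" for x y
  proof -
    have "orb \<sigma> x \<subseteq> (\<lambda>n. (g ^^ n) x) ` {..N x}"
    proof (rule orb_least)
      show "x \<in> (\<lambda>n. (g ^^ n) x) ` {..N x}" by (rule image_eqI[of _ _ 0]) auto
      fix w assume "w \<in> (\<lambda>n. (g ^^ n) x) ` {..N x}"
      then obtain n where n: "n \<le> N x" "w = (g ^^ n) x" by blast
      show "\<sigma> w \<in> (\<lambda>n. (g ^^ n) x) ` {..N x}"
      proof (cases "n = N x")
        case True
        then have "\<sigma> w = (g ^^ 0) x" using n \<sigma>e[OF x] by (simp add: e_def)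
        then show ?thesis by blast
      next
        case False
        then have "\<sigma> w = (g ^^ Suc n) x" using n \<sigma>M[OF before[OF x, of n]] by simp
        then show ?thesis using False n by (intro image_eqI[of _ _ "Suc n"]) auto
      qed
    qed
    then obtain n where n: "n \<le> N x" "y = (g ^^ n) x" using o by blast
    show ?thesis
    proof (cases n)
      case 0
      then show ?thesis using n by simp
    next
      case (Suc k)
      then have "y = g ((g ^^ k) x)" "(g ^^ k) x \<in> M" using n before[OF x, of k] by simp_all
      then show ?thesis using y by blast
    qed
  qed
  ultimately show ?thesis using that[of \<sigma>] \<sigma>M by blast
qed

text \<open>At most one element of each bubble occurs in \<open>xs\<close>, so the transpositions
  are disjoint and their order is irrelevant: color \<open>j\<close> ends up with \<sigma> applied
  after the restriction of \<tau> to the listed bubbles of color \<open>j\<close>.\<close>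

lemma glue_involution:
  assumes \<tau>: "\<And>b. b \<in> P \<Longrightarrow> \<tau> b \<in> P \<and> \<tau> (\<tau> b) = b \<and> col (\<tau> b) = col b"
    and xs: "distinct xs" "set xs \<subseteq> P" "set xs \<inter> \<tau> ` set xs = {}" and b: "b \<in> P"
  shows "glue \<sigma> (map (\<lambda>x. (x, \<tau> x, col x)) xs) j b =
    \<sigma> (if col b = j \<and> (b \<in> set xs \<or> \<tau> b \<in> set xs) then \<tau> b else b)"
  using xs b
proof (induction xs arbitrary: b)
  case (Cons x xs)
  have x: "x \<in> P" "x \<notin> set xs" "\<tau> x \<notin> set xs" "\<tau> x \<noteq> x"
    using Cons.prems \<tau> by (auto simp: disjoint_iff)
  note \<tau>x = \<tau>[OF x(1)]
  have IH: "glue \<sigma> (map (\<lambda>x. (x, \<tau> x, col x)) xs) j b =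
      \<sigma> (if col b = j \<and> (b \<in> set xs \<or> \<tau> b \<in> set xs) then \<tau> b else b)" if "b \<in> P" for b
    using Cons.IH[OF _ _ _ that] Cons.prems by auto
  have b: "b \<in> P" and \<tau>b: "\<tau> b = x \<longleftrightarrow> b = \<tau> x" using Cons.prems \<tau> x(1) by auto
  consider "b = x" | "b = \<tau> x" | "b \<noteq> x" "\<tau> b \<noteq> x" using \<tau>b by blast
  then show ?case
  proof cases
    case 1
    then show ?thesis using x \<tau>x IH[OF x(1)] IH[of "\<tau> x"] by auto
  next
    case 2
    then show ?thesis using x \<tau>x IH[OF x(1)] IH[of "\<tau> x"] by auto
  next
    case 3
    then show ?thesis using \<tau>b IH[OF b] by auto
  qed
qed simp

text \<open>On \<open>A\<close> the value of \<open>v\<close> is a function of the value of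
  \<open>u\<close>.\<close>

lemma card_image_le_refine:
  assumes "finite A" "\<And>x y. x \<in> A \<Longrightarrow> y \<in> A \<Longrightarrow> u x = u y \<Longrightarrow> v x = v y"
  shows "card (v ` A) \<le> card (u ` A)"
proof -
  have "v ` A \<subseteq> (\<lambda>t. v (SOME x. x \<in> A \<and> u x = t)) ` (u ` A)"
  proof
    fix s assume "s \<in> v ` A"
    then obtain x where x: "x \<in> A" "s = v x" by blast
    let ?y = "SOME y. y \<in> A \<and> u y = u x"
    have "?y \<in> A \<and> u ?y = u x" by (rule someI[of _ x]) (use x in simp)
    then have "s = v ?y" using assms(2)[of x ?y] x by simp
    then show "s \<in> (\<lambda>t. v (SOME x. x \<in> A \<and> u x = t)) ` (u ` A)" using x(1) by blast
  qed
  then have "card (v ` A) \<le> card ((\<lambda>t. v (SOME x. x \<in> A \<and> u x = t)) ` (u ` A))"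
    using assms(1) by (intro card_mono) auto
  also have "\<dots> \<le> card (u ` A)" using assms(1) by (intro card_image_le) simp
  finally show ?thesis .
qed

lemma orb_cong:
  assumes "f ` P \<subseteq> P" "\<And>y. y \<in> P \<Longrightarrow> f y = g y" "x \<in> P"
  shows "orb f x = orb g x"
proof -
  have P: "(f ^^ n) x \<in> P" for n using orb_subset[OF assms(1,3)] funpow_in_orb[of n f x] by blast
  have "(f ^^ n) x = (g ^^ n) x" for n
  proof (induction n)
    case (Suc n)
    then show ?case using assms(2)[OF P[of n]] by simp
  qed simp
  then show ?thesis unfolding orb_def by simp
qed

section \<open>Matchings and pairings of the boundary graph\<close>

lemma regular_matchings:
  assumes "regular_cgraph D B"
  obtains \<alpha> where "\<And>c. c \<in> {1..D} \<Longrightarrow> bij_betw (\<alpha> c) (blacks B) (whites B)"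
    "\<And>c b w. c \<in> {1..D} \<Longrightarrow> (b, w, c) \<in> cedges B \<longleftrightarrow> b \<in> blacks B \<and> w = \<alpha> c b"
proof -
  have wf: "wf_cgraph B" and deg: "\<And>v c. v \<in> cverts B \<Longrightarrow> c \<in> {1..D} \<Longrightarrow> color_degree B c v = 1"
    using assms unfolding regular_cgraph_def by auto
  have "\<exists>a. bij_betw a (blacks B) (whites B) \<and> (\<forall>b w. (b, w, c) \<in> cedges B \<longleftrightarrow> b \<in> blacks B \<and> w = a b)"
    if c: "c \<in> {1..D}" for c
    by (rule perfect_matching_obtain[OF wf deg[OF _ c]]) blast+
  then have "\<exists>\<alpha>. \<forall>c\<in>{1..D}. bij_betw (\<alpha> c) (blacks B) (whites B) \<and>
      (\<forall>b w. (b, w, c) \<in> cedges B \<longleftrightarrow> b \<in> blacks B \<and> w = \<alpha> c b)"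
    by (intro bchoice) blast
  then show ?thesis using that by blast
qed

lemma paired_graphI:
  assumes reg: "regular_cgraph D B"
    and \<alpha>: "\<And>c. c \<in> {1..D} \<Longrightarrow> bij_betw (\<alpha> c) (blacks B) (whites B)"
      "\<And>c b w. c \<in> {1..D} \<Longrightarrow> (b, w, c) \<in> cedges B \<longleftrightarrow> b \<in> blacks B \<and> w = \<alpha> c b"
    and \<phi>: "bij_betw \<phi> (blacks B) (whites B)"
  shows "paired_graph D B \<alpha> \<phi> (\<lambda>c b. inv_into (blacks B) \<phi> (\<alpha> c b))"
proof
  show "wf_cgraph B" "ecolor ` cedges B \<subseteq> {1..D}" using reg unfolding regular_cgraph_def by auto
  fix c b assume c: "c \<in> {1..D}" and b: "b \<in> blacks B"
  have "\<alpha> c b \<in> \<phi> ` blacks B" using bij_betwE[OF \<alpha>(1)[OF c]] b \<phi> unfolding bij_betw_def by blast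
  then show "inv_into (blacks B) \<phi> (\<alpha> c b) \<in> blacks B" "\<phi> (inv_into (blacks B) \<phi> (\<alpha> c b)) = \<alpha> c b"
    by (rule inv_into_into, rule f_inv_into_f)
qed (use \<alpha> \<phi> in blast)+

lemma regular_card_blacks:
  assumes "regular_cgraph D B" "D \<ge> 1" "card (cverts B) = 2 * q"
  shows "card (blacks B) = q"
proof -
  have wf: "wf_cgraph B" using assms(1) unfolding regular_cgraph_def by blast
  obtain \<alpha> where "\<And>c. c \<in> {1..D} \<Longrightarrow> bij_betw (\<alpha> c) (blacks B) (whites B)"
    by (rule regular_matchings[OF assms(1)]) blast
  then have "card (blacks B) = card (whites B)" using assms(2) bij_betw_same_card[of "\<alpha> 1"] by simp
  moreover have "card (cverts B) = card (blacks B) + card (whites B)"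
    unfolding cverts_def using wf unfolding wf_cgraph_def by (intro card_Un_disjoint) auto
  ultimately show ?thesis using assms(3) by simp
qed

text \<open>Replaces \<open>Lm\<close> by the number of faces, the quantity that is counted both in
  the bound and in the construction.\<close>

lemma optimal_bound_eq:
  assumes D: "D \<ge> 1" and reg: "regular_cgraph D B" and conn: "connected_cgraph B"
    and card: "card (cverts B) = 2 * q" and pair: "pairing B \<Omega>"
  shows "1 + (int D - 1) * (int q + Lm D (contraction B \<Omega>)) =
    int D + (int D - 1) * (int D * int q - int (Phi0 D (add_pairing B \<Omega>)))"
proof -
  have wf: "wf_cgraph B" using reg unfolding regular_cgraph_def by blast
  obtain \<alpha> where \<alpha>: "\<And>c. c \<in> {1..D} \<Longrightarrow> bij_betw (\<alpha> c) (blacks B) (whites B)"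
    "\<And>c b w. c \<in> {1..D} \<Longrightarrow> (b, w, c) \<in> cedges B \<longleftrightarrow> b \<in> blacks B \<and> w = \<alpha> c b"
    by (rule regular_matchings[OF reg]) blast
  obtain \<phi> where \<phi>: "bij_betw \<phi> (blacks B) (whites B)" "\<Omega> = pairs_of B \<phi>"
    by (rule pairing_obtain[OF wf pair])
  interpret paired_graph D B \<alpha> \<phi> "\<lambda>c b. inv_into (blacks B) \<phi> (\<alpha> c b)"
    by (rule paired_graphI[OF reg \<alpha> \<phi>(1)])
  show ?thesis
    unfolding \<phi>(2) Lm_contraction[OF conn regular_card_blacks[OF reg D card]] Phi0_add_pairing
    by (simp add: algebra_simps)
qed

section \<open>Counting the faces of a melonic graph\<close>

text \<open>Closed faces are the cycles of the \<open>f i\<close> that avoid the black degree-D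
  vertices. \<open>glue_bound\<close> limits the number of all cycles in terms of the marked ones,
  and these are at most as many as the faces of a paired boundary graph.\<close>

lemma melonic_face_bound:
  assumes D: "D \<ge> 3" and reg: "regular_cgraph D B" and q: "q > 0"
    and opt: "\<And>\<Omega>. pairing B \<Omega> \<Longrightarrow> Phi0 D (add_pairing B \<Omega>) \<le> \<Phi>"
    and G: "G \<in> GG D q (B4m D)" and iso: "cgraph_iso (boundary_graph D G) B"
  shows "int (Phi0 D G) \<le> (int D - 1) * (int (card (bubbles G)) + int \<Phi> - int D * int q)"
proof -
  let ?Z = "degD_vertices G" and ?P = "blacks G"
  let ?Q = "?P \<inter> ?Z"
  have wf: "wf_cgraph G" and conn: "connected_cgraph G" and colG: "ecolor ` cedges G \<subseteq> {0..D}"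
    and deg1: "\<And>v. v \<in> cverts G - ?Z \<Longrightarrow> color_degree G 0 v = 1"
    and cardQ: "card ?Q = q"
    using G unfolding GG_def by auto
  have deg0: "color_degree G 0 v = (if v \<in> ?Z then 0 else 1)" if "v \<in> cverts G" for v
    using deg1[of v] that unfolding degD_vertices_def by auto
  have fin: "finite ?P" and disj: "?P \<inter> whites G = {}" using wf unfolding wf_cgraph_def by auto
  obtain p \<tau> col S where p: "bij_betw p ?P (whites G)"
    and \<tau>: "\<And>b. b \<in> ?P \<Longrightarrow> \<tau> b \<in> ?P \<and> \<tau> (\<tau> b) = b \<and> col b \<in> {1..D} \<and> col (\<tau> b) = col b"
    and edge: "\<And>b w c. c \<in> {1..D} \<Longrightarrow> (b, w, c) \<in> cedges G \<longleftrightarrow> b \<in> ?P \<and> w = (if c = col b then p (\<tau> b) else p b)"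
    and S: "S \<union> \<tau> ` S = ?P" "S \<inter> \<tau> ` S = {}" "card S = card (bubbles G)"
    by (rule melonic_structure[OF D G]) blast
  obtain \<beta>0 where \<beta>0: "bij_betw \<beta>0 (?P - ?Z) (whites G - ?Z)"
    and edge0: "\<And>b w. (b, w, 0) \<in> cedges G \<longleftrightarrow> b \<in> ?P \<and> b \<notin> ?Z \<and> w = \<beta>0 b"
    by (rule partial_matching_obtain[OF wf deg0]) (assumption, rule that)
  \<comment> \<open>The color \<open>0\<close> edge at the white vertex of the pair of
    \<open>b\<close> leads to the pair of \<open>g b\<close>; \<open>M\<close> collects the pairs
    where this edge exists.\<close>
  define M where "M = {b \<in> ?P. p b \<notin> ?Z}"
  define g where "g b = inv_into (?P - ?Z) \<beta>0 (p b)" for b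
  have pw: "p b \<in> whites G" if "b \<in> ?P" for b using bij_betwE[OF p] that by blast
  have peq: "a = b" if "a \<in> ?P" "b \<in> ?P" "p a = p b" for a b
    using inj_onD[OF bij_betw_imp_inj_on[OF p] that(3) that(1,2)] .
  have gM: "g b \<in> ?P - ?Z" "\<beta>0 (g b) = p b" if "b \<in> M" for b
  proof -
    have "p b \<in> \<beta>0 ` (?P - ?Z)"
      using that pw[of b] bij_betw_imp_surj_on[OF \<beta>0] unfolding M_def by simp
    then show "g b \<in> ?P - ?Z" "\<beta>0 (g b) = p b" unfolding g_def by (rule inv_into_into, rule f_inv_into_f)
  qed
  have MP: "M \<subseteq> ?P" unfolding M_def by blast
  have ginj: "inj_on g M"
  proof (rule inj_onI)
    fix a b assume "a \<in> M" "b \<in> M" "g a = g b"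
    then show "a = b" using gM(2)[of a] gM(2)[of b] peq[of a b] MP by auto
  qed
  have gimg: "g ` M = ?P - ?Z"
  proof
    show "g ` M \<subseteq> ?P - ?Z" using gM(1) by blast
    show "?P - ?Z \<subseteq> g ` M"
    proof
      fix b assume b: "b \<in> ?P - ?Z"
      then have w: "\<beta>0 b \<in> whites G - ?Z" using bij_betwE[OF \<beta>0] by blast
      then obtain a where a: "a \<in> ?P" "p a = \<beta>0 b" using bij_betw_imp_surj_on[OF p] by (metis DiffD1 imageE)
      then have "a \<in> M" using w unfolding M_def by simp
      moreover have "g a = b" unfolding g_def a(2) by (rule inv_into_f_f[OF bij_betw_imp_inj_on[OF \<beta>0] b])
      ultimately show "b \<in> g ` M" by blast
    qed
  qed
  have gP: "g ` M \<subseteq> ?P" unfolding gimg by blast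
  have Qeq: "?P - g ` M = ?Q" unfolding gimg by blast
  obtain \<sigma> where \<sigma>: "inj_on \<sigma> ?P" "\<sigma> ` ?P \<subseteq> ?P" and \<sigma>M: "\<And>b. b \<in> M \<Longrightarrow> \<sigma> b = g b"
    and \<sigma>Q: "\<And>x y. x \<in> ?Q \<Longrightarrow> y \<in> ?Q \<Longrightarrow> y \<in> orb \<sigma> x \<Longrightarrow> y = x"
    by (rule partial_injection_extend[OF fin MP ginj gP, unfolded Qeq]) blast
  have \<sigma>bij: "bij_betw \<sigma> ?P ?P"
    unfolding bij_betw_def using \<sigma> endo_inj_surj[OF fin \<sigma>(2,1)] by simp
  \<comment> \<open>The color \<open>0\<close> matching completed by the edges that \<sigma> adds: a
    black vertex is sent to the white vertex of the pair preceding it under \<sigma>.\<close>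
  define \<beta> where "\<beta> b = p (inv_into ?P \<sigma> b)" for b
  have \<beta>\<sigma>: "\<beta> (\<sigma> b) = p b" if "b \<in> ?P" for b
    unfolding \<beta>_def using inv_into_f_f[OF \<sigma>(1) that] by simp
  have \<beta>bij: "bij_betw \<beta> ?P (whites G)"
    using bij_betw_trans[OF bij_betw_inv_into[OF \<sigma>bij] p] unfolding \<beta>_def[abs_def] comp_def .
  have \<beta>\<beta>0: "\<beta> b = \<beta>0 b" if b: "b \<in> ?P - ?Z" for b
  proof -
    obtain a where a: "a \<in> M" "b = g a" using b unfolding gimg[symmetric] by blast
    then have "\<beta> b = p a" using \<beta>\<sigma>[of a] \<sigma>M[OF a(1)] MP by auto
    then show ?thesis using gM(2)[OF a(1)] a(2) by simp
  qed
  have \<beta>Z: "b \<in> ?Z" if b: "b \<in> ?P" "\<beta> b \<in> ?Z" for b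
  proof (rule ccontr)
    assume "b \<notin> ?Z"
    then have "b \<in> ?P - ?Z" using b by blast
    then have "\<beta> b \<in> whites G - ?Z" using \<beta>\<beta>0[of b] bij_betwE[OF \<beta>0] by simp
    then show False using b by blast
  qed
  define t where "t i b = (if i = col b then \<tau> b else b)" for i b
  have tP: "t i b \<in> ?P" "t i (t i b) = b" if "b \<in> ?P" for i b
    using \<tau>[OF that] that unfolding t_def by auto
  define f where "f i b = \<sigma> (t i b)" for i b
  have fp: "face_perm G i ?Q (\<lambda>b. p (t i b)) \<beta> (f i)" if i: "i \<in> {1..D}" for i
  proof
    show "wf_cgraph G" by (rule wf)
    show "p (t i b) \<in> whites G" if "b \<in> ?P" for b using pw tP that by blast
    show "inj_on (\<lambda>b. p (t i b)) ?P"
      by (rule inj_onI) (metis peq tP)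
    show "(b, w, i) \<in> cedges G \<longleftrightarrow> b \<in> ?P \<and> w = p (t i b)" for b w
      using edge[OF i, of b w] unfolding t_def by simp
    show "bij_betw \<beta> ?P (whites G)" by (rule \<beta>bij)
    show "(b, w, 0) \<in> cedges G \<longleftrightarrow> b \<in> ?P \<and> b \<notin> ?Q \<and> w = \<beta> b" for b w
      using edge0[of b w] \<beta>\<beta>0[of b] by auto
    show "f i b \<in> ?P" if "b \<in> ?P" for b using tP(1)[OF that] \<sigma>(2) unfolding f_def by blast
    show "\<beta> (f i b) = p (t i b)" if "b \<in> ?P" for b using \<beta>\<sigma>[OF tP(1)[OF that]] unfolding f_def .
  qed
  define cyc where "cyc i = card (orb (f i) ` ?P)" for i
  define mcyc where "mcyc i = card {C \<in> orb (f i) ` ?P. C \<inter> ?Q \<noteq> {}}" for i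
  have faces: "card {set vs | vs. alt_cycle G 0 i vs} + mcyc i = cyc i" if i: "i \<in> {1..D}" for i
  proof -
    interpret face_perm G i ?Q "\<lambda>b. p (t i b)" \<beta> "f i" by (rule fp[OF i])
    have "orb (f i) ` ?P = {C \<in> orb (f i) ` ?P. C \<inter> ?Q = {}} \<union> {C \<in> orb (f i) ` ?P. C \<inter> ?Q \<noteq> {}}" by blast
    then have "cyc i = card ({C \<in> orb (f i) ` ?P. C \<inter> ?Q = {}} \<union> {C \<in> orb (f i) ` ?P. C \<inter> ?Q \<noteq> {}})"
      unfolding cyc_def by simp
    also have "\<dots> = card {C \<in> orb (f i) ` ?P. C \<inter> ?Q = {}} + mcyc i"
      unfolding mcyc_def using fin by (intro card_Un_disjoint) auto
    finally show ?thesis using card_alt_cycles by simp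
  qed
  have Phi0: "int (Phi0 D G) + (\<Sum>i=1..D. int (mcyc i)) = (\<Sum>i=1..D. int (cyc i))"
  proof -
    have "Phi0 D G + (\<Sum>i=1..D. mcyc i) = (\<Sum>i=1..D. cyc i)"
      unfolding Phi0_def sum.distrib[symmetric] by (rule sum.cong) (use faces in auto)
    then show ?thesis by (metis of_nat_add of_nat_sum)
  qed
  have F: "(\<Sum>i=1..D. int (cyc i)) \<le> (int D - 1) * int (card (bubbles G))
       + int D * (\<Sum>i=1..D. int (mcyc i)) - int D * (int D - 1) * int q"
  proof -
    have SP: "S \<subseteq> ?P" using S(1) by blast
    obtain xs where xs: "set xs = S" "distinct xs" using finite_distinct_list[OF finite_subset[OF SP fin]] by blast
    define es where "es = map (\<lambda>x. (x, \<tau> x, col x)) xs"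
    have len: "length es = card (bubbles G)" unfolding es_def using distinct_card[OF xs(2)] xs(1) S(3) by simp
    have esP: "set es \<subseteq> ?P \<times> ?P \<times> {1..D}"
      unfolding es_def using xs(1) SP \<tau> by auto
    have glue: "glue \<sigma> es i b = f i b" if b: "b \<in> ?P" for i b
    proof -
      have bS: "b \<in> S \<or> \<tau> b \<in> S"
      proof (cases "b \<in> S")
        case False
        then obtain s where "s \<in> S" "b = \<tau> s" using S(1) b by blast
        then show ?thesis using \<tau>[of s] SP by auto
      qed simp
      have "glue \<sigma> es i b = \<sigma> (if col b = i \<and> (b \<in> set xs \<or> \<tau> b \<in> set xs) then \<tau> b else b)"
        unfolding es_def by (rule glue_involution[of ?P]) (use \<tau> xs SP S(2) b in simp_all)
      then show ?thesis unfolding f_def t_def xs(1) using bS by (simp add: eq_commute)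
    qed
    have orbs: "orb (glue \<sigma> es i) ` ?P = orb (f i) ` ?P" for i
    proof (rule image_cong[OF refl])
      fix x assume x: "x \<in> ?P"
      have "glue \<sigma> es i ` ?P \<subseteq> ?P" using glue_perm[OF \<sigma>, of es i] esP by auto
      then show "orb (glue \<sigma> es i) x = orb (f i) x" using glue x by (intro orb_cong) auto
    qed
    \<comment> \<open>A cycle of \<sigma> holds at most one point of \<open>Q\<close>, so the marked
      cycles correspond to these \<open>q\<close> points.\<close>
    have mk: "{C \<in> orb \<sigma> ` ?P. C \<inter> ?Q \<noteq> {}} = orb \<sigma> ` ?Q"
    proof
      show "{C \<in> orb \<sigma> ` ?P. C \<inter> ?Q \<noteq> {}} \<subseteq> orb \<sigma> ` ?Q"
      proof
        fix C assume "C \<in> {C \<in> orb \<sigma> ` ?P. C \<inter> ?Q \<noteq> {}}"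
        then obtain x z where x: "x \<in> ?P" "C = orb \<sigma> x" "z \<in> C" "z \<in> ?Q" by blast
        then have "C = orb \<sigma> z" using orb_eq[OF fin \<sigma> x(1), of z] by simp
        then show "C \<in> orb \<sigma> ` ?Q" using x(4) by blast
      qed
      show "orb \<sigma> ` ?Q \<subseteq> {C \<in> orb \<sigma> ` ?P. C \<inter> ?Q \<noteq> {}}"
      proof (rule image_subsetI)
        fix x assume x: "x \<in> ?Q"
        then have "x \<in> orb \<sigma> x \<inter> ?Q" by simp
        then show "orb \<sigma> x \<in> {C \<in> orb \<sigma> ` ?P. C \<inter> ?Q \<noteq> {}}" using x by blast
      qed
    qed
    have "inj_on (orb \<sigma>) ?Q"
    proof (rule inj_onI)
      fix x y assume xy: "x \<in> ?Q" "y \<in> ?Q" and eq: "orb \<sigma> x = orb \<sigma> y"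
      have "y \<in> orb \<sigma> x" unfolding eq by (rule orb_self)
      from \<sigma>Q[OF xy this] show "x = y" by (rule sym)
    qed
    then have mq: "int (card {C \<in> orb \<sigma> ` ?P. C \<inter> ?Q \<noteq> {}}) = int q"
      unfolding mk using cardQ by (simp add: card_image)
    have D2: "D \<ge> 2" using D by simp
    obtain E where E: "partition_on ?P E" and E\<sigma>: "\<forall>C\<in>E. \<forall>z\<in>C. \<sigma> z \<in> C"
      and Ees: "\<forall>C\<in>E. \<forall>(x, y, i)\<in>set es. x \<in> C \<longleftrightarrow> y \<in> C"
      and ineq: "(\<Sum>i=1..D. int (card (orb (glue \<sigma> es i) ` ?P))) \<le> (int D - 1) * int (length es)
       + int D * (\<Sum>i=1..D. int (card {C\<in>orb (glue \<sigma> es i) ` ?P. C \<inter> ?Q \<noteq> {}}))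
       - int D * (int D - 1) * int q + int D * int (card {C\<in>E. C \<inter> ?Q = {}})"
      using glue_bound[OF D2 fin \<sigma> mq esP] by (elim exE conjE) (rule that)
    \<comment> \<open>A class is closed under \<sigma> and \<tau>. With its white partners it is
      closed in the connected graph, so it contains all black vertices, in particular those of
      \<open>Q\<close>, which is not empty by \<open>q > 0\<close>.\<close>
    have "C \<inter> ?Q \<noteq> {}" if C: "C \<in> E" for C
    proof -
      have CP: "C \<subseteq> ?P" and ne: "C \<noteq> {}" using E C unfolding partition_on_def by blast+
      have \<sigma>iff: "\<sigma> b \<in> C \<longleftrightarrow> b \<in> C" if b: "b \<in> ?P" for b
      proof
        assume "\<sigma> b \<in> C"
        obtain C' where C': "C' \<in> E" "b \<in> C'" using E b unfolding partition_on_def by blast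
        then have "\<sigma> b \<in> C'" using E\<sigma> by blast
        then have "C = C'" using disjointD[OF partition_onD2[OF E] C C'(1)] \<open>\<sigma> b \<in> C\<close> by blast
        then show "b \<in> C" using C' by simp
      qed (use E\<sigma> C in blast)
      have \<tau>S: "x \<in> C \<longleftrightarrow> \<tau> x \<in> C" if "x \<in> S" for x
        using bspec[OF bspec[OF Ees C], of "(x, \<tau> x, col x)"] that xs(1) unfolding es_def by auto
      have \<tau>iff: "\<tau> b \<in> C \<longleftrightarrow> b \<in> C" if b: "b \<in> ?P" for b
      proof (cases "b \<in> S")
        case True
        then show ?thesis using \<tau>S by simp
      next
        case False
        then obtain s where "s \<in> S" "b = \<tau> s" using S(1) b by blast
        then show ?thesis using \<tau>S[of s] \<tau>[of s] SP by auto
      qed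
      have pC: "p b \<in> p ` C \<longleftrightarrow> b \<in> C" if "b \<in> ?P" for b
        using inj_on_image_mem_iff[OF bij_betw_imp_inj_on[OF p] that CP] .
      have bC: "b \<in> C \<union> p ` C \<longleftrightarrow> b \<in> C" if "b \<in> ?P" for b
        using that pw CP disj by blast
      have wC: "w \<in> C \<union> p ` C \<longleftrightarrow> w \<in> p ` C" if "w \<in> whites G" for w
        using that CP disj by blast
      have "closed_in (multigraph_of G) (C \<union> p ` C)"
        unfolding closed_in_multigraph_of
      proof (clarify)
        fix b w c assume e: "(b, w, c) \<in> cedges G"
        have b: "b \<in> ?P" and w: "w \<in> whites G" using cedges_ends[OF wf e] by auto
        have "c \<in> {0..D}" using colG e unfolding ecolor_def by (metis image_subset_iff snd_conv)
        then consider "c = 0" | "c \<in> {1..D}" by fastforce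
        then have "b \<in> C \<longleftrightarrow> w \<in> p ` C"
        proof cases
          case 1
          then have "b \<in> ?P - ?Z" "w = \<beta>0 b" using e edge0[of b w] by auto
          then obtain a where a: "a \<in> M" "b = g a" unfolding gimg[symmetric] by blast
          then have "w = p a" using gM(2)[OF a(1)] \<open>w = \<beta>0 b\<close> by simp
          moreover have "b = \<sigma> a" "a \<in> ?P" using a \<sigma>M[OF a(1)] MP by auto
          ultimately show ?thesis using pC[of a] \<sigma>iff[of a] by simp
        next
          case 2
          then have "w = p b \<or> w = p (\<tau> b)" using edge[OF 2, of b w] e by (auto split: if_splits)
          then show ?thesis using pC[OF b] pC[of "\<tau> b"] \<tau>iff[OF b] \<tau>[OF b] by auto
        qed
        then show "b \<in> C \<union> p ` C \<longleftrightarrow> w \<in> C \<union> p ` C" using bC[OF b] wC[OF w] by simp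
      qed
      moreover obtain x where "x \<in> C" using ne by blast
      ultimately have "verts (multigraph_of G) \<subseteq> C \<union> p ` C"
        using conn CP unfolding connected_cgraph_def
        by (intro connected_least[of _ _ x]) (auto simp: cverts_def)
      then have "?P \<subseteq> C" using bC unfolding verts_multigraph_of cverts_def by blast
      moreover have "?Q \<noteq> {}" using cardQ q by (metis card.empty less_numeral_extra(3))
      ultimately show ?thesis by blast
    qed
    then have "{C\<in>E. C \<inter> ?Q = {}} = {}" by blast
    then have "int D * int (card {C\<in>E. C \<inter> ?Q = {}}) = 0"
      by (simp only: card.empty of_nat_0 mult_zero_right)
    then show ?thesis using ineq unfolding orbs len cyc_def mcyc_def by linarith
  qed
  \<comment> \<open>The marked cycles are compared with the faces of the pairing that \<sigma>
    induces on the boundary graph.\<close>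
  have om: "(\<Sum>i=1..D. mcyc i) \<le> \<Phi>"
  proof -
    let ?dG = "boundary_graph D G"
    have wfB: "wf_cgraph B" using reg unfolding regular_cgraph_def by blast
    have dG: "blacks ?dG = ?Q" "whites ?dG = whites G \<inter> ?Z" by (simp_all add: boundary_graph_def)
    obtain k where kinj: "inj_on k (cverts ?dG)" and kb: "k ` blacks ?dG = blacks B" and kw: "k ` whites ?dG = whites B"
      and ke: "(\<lambda>(b, w, c). (k b, k w, c)) ` cedges ?dG = cedges B"
      using iso unfolding cgraph_iso_def by blast
    have kQ: "bij_betw k ?Q (blacks B)"
      unfolding bij_betw_def using kb inj_on_subset[OF kinj, of ?Q] unfolding dG cverts_def by blast
    have kW: "bij_betw k (whites G \<inter> ?Z) (whites B)"
      unfolding bij_betw_def using kw inj_on_subset[OF kinj, of "whites G \<inter> ?Z"] unfolding dG cverts_def by blast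
    have \<beta>Q: "\<beta> z \<in> whites G \<inter> ?Z" if z: "z \<in> ?Q" for z
    proof (rule ccontr)
      assume "\<not> ?thesis"
      then have "\<beta> z \<in> whites G - ?Z" using bij_betwE[OF \<beta>bij] z by blast
      then obtain b where b: "b \<in> ?P - ?Z" "\<beta> z = \<beta>0 b" using bij_betw_imp_surj_on[OF \<beta>0] by (metis imageE)
      then have "\<beta> z = \<beta> b" using \<beta>\<beta>0 by simp
      then have "z = b" using inj_onD[OF bij_betw_imp_inj_on[OF \<beta>bij]] z b by blast
      then show False using z b by blast
    qed
    have \<beta>QW: "bij_betw \<beta> ?Q (whites G \<inter> ?Z)"
      unfolding bij_betw_def
    proof
      show "inj_on \<beta> ?Q" using inj_on_subset[OF bij_betw_imp_inj_on[OF \<beta>bij]] by blast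
      show "\<beta> ` ?Q = whites G \<inter> ?Z"
      proof
        show "\<beta> ` ?Q \<subseteq> whites G \<inter> ?Z" using \<beta>Q by blast
        show "whites G \<inter> ?Z \<subseteq> \<beta> ` ?Q"
        proof
          fix w assume w: "w \<in> whites G \<inter> ?Z"
          then obtain b where "b \<in> ?P" "w = \<beta> b" using bij_betw_imp_surj_on[OF \<beta>bij] by blast
          then show "w \<in> \<beta> ` ?Q" using \<beta>Z[of b] w by blast
        qed
      qed
    qed
    define r where "r = inv_into ?Q k"
    have r: "bij_betw r (blacks B) ?Q" unfolding r_def by (rule bij_betw_inv_into[OF kQ])
    have kr: "k (r b) = b" if "b \<in> blacks B" for b
      unfolding r_def by (rule f_inv_into_f) (use kb dG that in blast)
    have rk: "r (k z) = z" if "z \<in> ?Q" for z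
      unfolding r_def by (rule inv_into_f_f[OF bij_betw_imp_inj_on[OF kQ] that])
    have rQ: "r b \<in> ?Q" if "b \<in> blacks B" for b using bij_betwE[OF r] that by blast
    \<comment> \<open>\<beta> pairs the black and white degree-D vertices joined by the added color
      \<open>0\<close> edges; \<phi> is this pairing carried over to \<open>B\<close>.\<close>
    define \<phi> where "\<phi> b = k (\<beta> (r b))" for b
    have \<phi>: "bij_betw \<phi> (blacks B) (whites B)"
      using bij_betw_trans[OF bij_betw_trans[OF r \<beta>QW] kW] unfolding \<phi>_def[abs_def] comp_def .
    obtain \<alpha> where \<alpha>: "\<And>c. c \<in> {1..D} \<Longrightarrow> bij_betw (\<alpha> c) (blacks B) (whites B)"
      "\<And>c b w. c \<in> {1..D} \<Longrightarrow> (b, w, c) \<in> cedges B \<longleftrightarrow> b \<in> blacks B \<and> w = \<alpha> c b"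
      by (rule regular_matchings[OF reg]) blast
    define h where "h c b = inv_into (blacks B) \<phi> (\<alpha> c b)" for c b
    interpret B: paired_graph D B \<alpha> \<phi> h
      unfolding h_def[abs_def] by (rule paired_graphI[OF reg \<alpha> \<phi>])
    \<comment> \<open>A boundary edge is a path that stops at a white degree-D vertex. One more
      edge, an added one of color \<open>0\<close>, ends at its black partner, so a step of
      \<open>h i\<close> stays on one cycle of \<open>f i\<close>.\<close>
    have return: "r (h i b) \<in> orb (f i) (r b)" if i: "i \<in> {1..D}" and b: "b \<in> blacks B" for i b
    proof -
      interpret face_perm G i ?Q "\<lambda>b. p (t i b)" \<beta> "f i" by (rule fp[OF i])
      have "(b, \<alpha> i b, i) \<in> cedges B" using \<alpha>(2)[OF i] b by blast
      then obtain z w where zw: "(z, w, i) \<in> cedges ?dG" "k z = b" "k w = \<alpha> i b"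
        unfolding ke[symmetric] by auto
      have z: "z \<in> ?Q" and w: "w \<in> whites G \<inter> ?Z" and pth: "\<exists>vs. alt_path G i 0 vs \<and> hd vs = z \<and> last vs = w"
        using zw(1) by (auto simp: boundary_graph_def)
      have zP: "z \<in> ?P" using z by blast
      obtain m where m: "w = p (t i ((f i ^^ m) z))"
        using pth alt_path_iff[OF zP z] by blast
      let ?y = "(f i ^^ Suc m) z"
      have wy: "w = \<beta> ?y" using m \<beta>_f[OF f_pow[OF zP, of m]] by simp
      have yQ: "?y \<in> ?Q" using \<beta>Z[OF f_pow[OF zP, of "Suc m"]] f_pow[OF zP, of "Suc m"] w wy by simp
      have ky: "k ?y \<in> blacks B" using bij_betwE[OF kQ] yQ by blast
      have "\<phi> (k ?y) = \<phi> (h i b)"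
        using B.\<phi>_h[OF i b] rk[OF yQ] wy zw(3) unfolding \<phi>_def by simp
      then have "k ?y = h i b" using B.\<phi>_eq[OF ky B.h_black[OF i b]] by simp
      then have "r (h i b) = ?y" using rk[OF yQ] by simp
      moreover have "r b = z" using rk[OF z] zw(2) by simp
      ultimately show ?thesis using funpow_in_orb[of "Suc m" "f i" z] by simp
    qed
    \<comment> \<open>The cycles of \<open>h i\<close> thus map onto the marked cycles of
      \<open>f i\<close>.\<close>
    have le: "mcyc i \<le> card (orb (h i) ` blacks B)" if i: "i \<in> {1..D}" for i
    proof -
      interpret face_perm G i ?Q "\<lambda>b. p (t i b)" \<beta> "f i" by (rule fp[OF i])
      have "{C \<in> orb (f i) ` ?P. C \<inter> ?Q \<noteq> {}} \<subseteq> (\<lambda>b. orb (f i) (r b)) ` blacks B"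
      proof
        fix C assume "C \<in> {C \<in> orb (f i) ` ?P. C \<inter> ?Q \<noteq> {}}"
        then obtain x z where x: "x \<in> ?P" "C = orb (f i) x" "z \<in> C" "z \<in> ?Q" by blast
        then have "C = orb (f i) (r (k z))" using orb_eq[OF perm x(1), of z] rk by simp
        moreover have "k z \<in> blacks B" using bij_betwE[OF kQ] x(4) by blast
        ultimately show "C \<in> (\<lambda>b. orb (f i) (r b)) ` blacks B" by blast
      qed
      then have "mcyc i \<le> card ((\<lambda>b. orb (f i) (r b)) ` blacks B)"
        unfolding mcyc_def using B.fin by (intro card_mono) auto
      also have "\<dots> \<le> card (orb (h i) ` blacks B)"
      proof (rule card_image_le_refine[OF B.fin])
        fix x y assume x: "x \<in> blacks B" and y: "y \<in> blacks B" and eq: "orb (h i) x = orb (h i) y"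
        have rx: "r x \<in> ?P" using rQ[OF x] by blast
        have "orb (h i) x \<subseteq> {b \<in> blacks B. r b \<in> orb (f i) (r x)}"
        proof (rule orb_least)
          show "x \<in> {b \<in> blacks B. r b \<in> orb (f i) (r x)}" using x by simp
          fix b assume "b \<in> {b \<in> blacks B. r b \<in> orb (f i) (r x)}"
          then have b: "b \<in> blacks B" "r b \<in> orb (f i) (r x)" by auto
          have "r (h i b) \<in> orb (f i) (r x)" using return[OF i b(1)] orb_eq[OF perm rx b(2)] by simp
          then show "h i b \<in> {b \<in> blacks B. r b \<in> orb (f i) (r x)}" using B.h_black[OF i b(1)] by simp
        qed
        moreover have "y \<in> orb (h i) x" unfolding eq by (rule orb_self)
        ultimately have "r y \<in> orb (f i) (r x)" by blast
        from orb_eq[OF perm rx this] show "orb (f i) (r x) = orb (f i) (r y)" by (rule sym)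
      qed
      finally show ?thesis .
    qed
    have "(\<Sum>i=1..D. mcyc i) \<le> (\<Sum>i=1..D. card (orb (h i) ` blacks B))"
      by (rule sum_mono) (use le in blast)
    also have "\<dots> = Phi0 D (add_pairing B (pairs_of B \<phi>))" by (rule B.Phi0_add_pairing[symmetric])
    also have "\<dots> \<le> \<Phi>" by (rule opt[OF pairing_pairs_of[OF wfB \<phi>]])
    finally show ?thesis .
  qed
  have "(\<Sum>i=1..D. int (mcyc i)) \<le> int \<Phi>" using om by (metis of_nat_le_iff of_nat_sum)
  then have "(int D - 1) * (\<Sum>i=1..D. int (mcyc i)) \<le> (int D - 1) * int \<Phi>"
    using D by (intro mult_left_mono) auto
  moreover have "(int D - 1) * (\<Sum>i=1..D. int (mcyc i)) = int D * (\<Sum>i=1..D. int (mcyc i)) - (\<Sum>i=1..D. int (mcyc i))"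
    by (simp add: algebra_simps)
  moreover have "(int D - 1) * (int (card (bubbles G)) + int \<Phi> - int D * int q) =
      (int D - 1) * int (card (bubbles G)) + (int D - 1) * int \<Phi> - int D * (int D - 1) * int q"
    by (simp add: algebra_simps)
  ultimately show ?thesis using F Phi0 by linarith
qed

section \<open>Graphs built from slots\<close>

text \<open>A relation instead of a function, so that no return has to be known in advance. The
  starting point may lie in \<open>Q\<close>; only the points strictly between are kept out.\<close>

definition first_return :: "('a \<Rightarrow> 'a) \<Rightarrow> 'a set \<Rightarrow> 'a \<Rightarrow> 'a \<Rightarrow> bool" where
  "first_return f Q s y \<longleftrightarrow> y \<in> Q \<and> (\<exists>m. (f ^^ Suc m) s = y \<and> (\<forall>n\<in>{1..m}. (f ^^ n) s \<notin> Q))"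

lemma first_return_base: "f s = y \<Longrightarrow> y \<in> Q \<Longrightarrow> first_return f Q s y"
  unfolding first_return_def by (intro conjI exI[of _ 0]) auto

lemma first_return_step:
  assumes "f s = s'" "s' \<notin> Q" "first_return f Q s' y" shows "first_return f Q s y"
proof -
  obtain m where y: "y \<in> Q" "(f ^^ Suc m) (f s) = y" and m: "\<forall>n\<in>{1..m}. (f ^^ n) (f s) \<notin> Q"
    using assms(1,3) unfolding first_return_def by blast
  have "(f ^^ n) s \<notin> Q" if n: "n \<in> {1..Suc m}" for n
  proof -
    obtain k where k: "n = Suc k" using n by (cases n) auto
    then have "(f ^^ n) s = (f ^^ k) (f s)" by (simp only: funpow_Suc_right comp_apply)
    then show ?thesis using m assms(1,2) n k by (cases "k = 0") auto
  qed
  moreover have "(f ^^ Suc (Suc m)) s = y" using y(2) by (simp only: funpow_Suc_right comp_apply)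
  ultimately show ?thesis unfolding first_return_def using y(1) by (intro conjI exI[of _ "Suc m"]) auto
qed

text \<open>Membership in \<open>T\<close> may change on a step into \<open>Q\<close>, so it is
  followed only up to the last point before the return. In the application the steps into
  \<open>Q\<close> are the color \<open>0\<close> edges left out of the graph.\<close>

lemma first_return_invariant:
  assumes "first_return f Q s y" "s \<in> P" "f ` P \<subseteq> P"
    and inv: "\<And>t. t \<in> P \<Longrightarrow> f t \<notin> Q \<Longrightarrow> t \<in> T \<longleftrightarrow> f t \<in> T"
  obtains t where "t \<in> P" "f t = y" "t \<in> T \<longleftrightarrow> s \<in> T"
proof -
  obtain m where y: "(f ^^ Suc m) s = y" and m: "\<forall>n\<in>{1..m}. (f ^^ n) s \<notin> Q"
    using assms(1) unfolding first_return_def by blast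
  have "(f ^^ n) s \<in> P \<and> ((f ^^ n) s \<in> T \<longleftrightarrow> s \<in> T)" if "n \<le> m" for n
    using that
  proof (induction n)
    case (Suc n)
    then have "(f ^^ n) s \<in> P" "(f ^^ n) s \<in> T \<longleftrightarrow> s \<in> T" by auto
    moreover have "f ((f ^^ n) s) \<notin> Q" using bspec[OF m, of "Suc n"] Suc.prems by simp
    ultimately show ?case using inv[of "(f ^^ n) s"] assms(3) by auto
  qed (use assms(2) in simp)
  from this[of m] show ?thesis using that[of "(f ^^ m) s"] y by simp
qed

text \<open>The first white vertex without a color \<open>0\<close> edge on the way from
  \<open>z\<close> is the one whose missing edge would lead to the first return.\<close>

lemma (in face_perm) alt_path_first_return:
  assumes z: "z \<in> blacks K" "z \<in> Q" and ret: "first_return f Q z y" and y': "y' \<in> blacks K" "y' \<in> Q"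
  shows "(\<exists>vs. alt_path K i 0 vs \<and> hd vs = z \<and> last vs = \<beta> y') \<longleftrightarrow> y' = y"
proof -
  obtain m where y: "y \<in> Q" "(f ^^ Suc m) z = y" and m: "\<forall>n\<in>{1..m}. (f ^^ n) z \<notin> Q"
    using ret unfolding first_return_def by blast
  have \<beta>: "\<beta> y' = \<alpha> ((f ^^ k) z) \<longleftrightarrow> y' = (f ^^ Suc k) z" for k
    using \<beta>_f[OF f_pow[OF z(1), of k]] \<beta>_eq[OF y'(1) f_pow[OF z(1), of "Suc k"]] by simp
  have "k = m" if "\<forall>n\<in>{1..k}. (f ^^ n) z \<notin> Q" "y' = (f ^^ Suc k) z" for k
  proof (rule ccontr)
    assume "k \<noteq> m"
    then consider "Suc k \<in> {1..m}" | "Suc m \<in> {1..k}" by fastforce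
    then show False using bspec[OF m, of "Suc k"] bspec[OF that(1), of "Suc m"] that(2) y'(2) y by cases auto
  qed
  then show ?thesis unfolding alt_path_iff[OF z] \<beta> using m y(2) by metis
qed

text \<open>The maps below are easier to define out of the abstract graph, while
  \<open>cgraph_iso\<close> is asked for in the other direction.\<close>

lemma cgraph_iso_inverse:
  assumes inj: "inj_on k (cverts H)" and "k ` blacks H = blacks G" "k ` whites H = whites G"
    and e: "(\<lambda>(b, w, c). (k b, k w, c)) ` cedges H = cedges G" and wf: "wf_cgraph H"
  shows "cgraph_iso G H"
proof -
  let ?f = "inv_into (cverts H) k"
  have fk: "?f (k v) = v" if "v \<in> cverts H" for v using inv_into_f_f[OF inj that] .
  have cv: "cverts G = k ` cverts H" using assms(2,3) unfolding cverts_def by blast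
  have "inj_on ?f (cverts G)" unfolding cv by (rule inj_on_inv_into) simp
  moreover have "?f ` blacks G = blacks H"
    unfolding assms(2)[symmetric] image_image using fk by (simp add: cverts_def)
  moreover have "?f ` whites G = whites H"
    unfolding assms(3)[symmetric] image_image using fk by (simp add: cverts_def)
  moreover have "(\<lambda>(b, w, c). (?f b, ?f w, c)) ` cedges G = cedges H"
  proof -
    have "(\<lambda>(b, w, c). (?f b, ?f w, c)) ` cedges G = (\<lambda>e. e) ` cedges H"
      unfolding e[symmetric] image_image
    proof (rule image_cong[OF refl])
      fix e assume "e \<in> cedges H"
      then obtain b w c where bw: "e = (b, w, c)" "b \<in> cverts H" "w \<in> cverts H"
        using wf unfolding wf_cgraph_def cverts_def by (cases e) auto
      then show "(case case e of (b, w, c) \<Rightarrow> (k b, k w, c) of (b, w, c) \<Rightarrow> (?f b, ?f w, c)) = e"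
        using fk by simp
    qed
    then show ?thesis by simp
  qed
  ultimately show ?thesis unfolding cgraph_iso_def by blast
qed

section \<open>The colored graph of a slot permutation\<close>

text \<open>Each slot \<open>s\<close> stands for a pair of vertices \<open>bl s\<close>, \<open>wh s\<close> joined by \<open>D - 1\<close> parallel edges;
  \<open>\<tau>\<close> matches the two slots of a bubble, and the color \<open>0\<close> edges join \<open>wh s\<close> to
  \<open>bl (\<sigma> s)\<close>, except that the edges into \<open>Q\<close> are left out.\<close>

locale slot_graph =
  fixes D :: nat and P :: "'s set" and \<sigma> \<tau> :: "'s \<Rightarrow> 's" and col :: "'s \<Rightarrow> nat" and Q :: "'s set"
    and bl wh :: "'s \<Rightarrow> 'v"
  assumes D: "D \<ge> 3" and fin: "finite P"
    and \<sigma>: "inj_on \<sigma> P" "\<sigma> ` P \<subseteq> P"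
    and \<tau>: "s \<in> P \<Longrightarrow> \<tau> s \<in> P \<and> \<tau> s \<noteq> s \<and> \<tau> (\<tau> s) = s \<and> col s \<in> {1..D} \<and> col (\<tau> s) = col s"
    and Q: "Q \<subseteq> P"
    and bl: "inj_on bl P" and wh: "inj_on wh P" and bl_wh: "s \<in> P \<Longrightarrow> s' \<in> P \<Longrightarrow> bl s \<noteq> wh s'"
begin

definition t :: "nat \<Rightarrow> 's \<Rightarrow> 's" where
  "t c s = (if c = col s then \<tau> s else s)"

definition graph :: "'v cgraph" where
  "graph = \<lparr> blacks = bl ` P, whites = wh ` P,
     cedges = (\<lambda>(s, c). (bl s, wh (t c s), c)) ` (P \<times> {1..D}) \<union>
       (\<lambda>s. (bl (\<sigma> s), wh s, 0)) ` {s \<in> P. \<sigma> s \<notin> Q} \<rparr>"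

lemma graph_sel [simp]: "blacks graph = bl ` P" "whites graph = wh ` P" "cverts graph = bl ` P \<union> wh ` P"
  by (simp_all add: graph_def cverts_def)

lemma tP: "s \<in> P \<Longrightarrow> t c s \<in> P" and tt: "s \<in> P \<Longrightarrow> t c (t c s) = s"
  using \<tau>[of s] unfolding t_def by auto

lemma \<sigma>P: "s \<in> P \<Longrightarrow> \<sigma> s \<in> P"
  using \<sigma>(2) by blast

lemma \<sigma>_bij: "bij_betw \<sigma> P P"
  unfolding bij_betw_def using \<sigma> endo_inj_surj[OF fin \<sigma>(2,1)] by simp

lemma bl_eq: "s \<in> P \<Longrightarrow> s' \<in> P \<Longrightarrow> bl s = bl s' \<longleftrightarrow> s = s'"
  using bl unfolding inj_on_def by blast

lemma wh_eq: "s \<in> P \<Longrightarrow> s' \<in> P \<Longrightarrow> wh s = wh s' \<longleftrightarrow> s = s'"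
  using wh unfolding inj_on_def by blast

lemma wh_bl: "s \<in> P \<Longrightarrow> s' \<in> P \<Longrightarrow> wh s \<noteq> bl s'"
  using bl_wh[of s' s] by simp

lemma wf_graph: "wf_cgraph graph"
  unfolding wf_cgraph_def
proof (intro conjI)
  show "finite (cedges graph)" unfolding graph_def using fin by simp
  show "blacks graph \<inter> whites graph = {}" using bl_wh by auto
  show "cedges graph \<subseteq> blacks graph \<times> whites graph \<times> UNIV"
    unfolding graph_def using tP \<sigma>P by auto
qed (use fin in auto)

lemma edgeE:
  assumes "(b, w, c) \<in> cedges graph"
  obtains s where "s \<in> P" "c \<in> {1..D}" "b = bl s" "w = wh (t c s)"
  | s where "s \<in> P" "c = 0" "\<sigma> s \<notin> Q" "b = bl (\<sigma> s)" "w = wh s"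
  using assms unfolding graph_def by auto

lemma edgeI: "s \<in> P \<Longrightarrow> c \<in> {1..D} \<Longrightarrow> (bl s, wh (t c s), c) \<in> cedges graph"
  unfolding graph_def by force

lemma edge0I: "s \<in> P \<Longrightarrow> \<sigma> s \<notin> Q \<Longrightarrow> (bl (\<sigma> s), wh s, 0) \<in> cedges graph"
  unfolding graph_def by force

lemma edge_black:
  assumes "s \<in> P" "c \<in> {1..D}" shows "(bl s, w, c) \<in> cedges graph \<longleftrightarrow> w = wh (t c s)"
proof
  assume "(bl s, w, c) \<in> cedges graph"
  then show "w = wh (t c s)" using assms bl_eq by (elim edgeE) auto
qed (use edgeI[OF assms] in simp)

lemma edge_white:
  assumes "s \<in> P" "c \<in> {1..D}" shows "(b, wh s, c) \<in> cedges graph \<longleftrightarrow> b = bl (t c s)"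
proof
  assume "(b, wh s, c) \<in> cedges graph"
  then show "b = bl (t c s)"
  proof (cases rule: edgeE)
    case (1 s')
    then have "s = t c s'" using wh_eq[OF assms(1) tP[OF 1(1)]] by simp
    then show ?thesis using tt[OF 1(1)] 1(3) by simp
  qed (use assms in simp)
next
  assume "b = bl (t c s)"
  then show "(b, wh s, c) \<in> cedges graph" using edgeI[OF tP[OF assms(1), of c] assms(2)] tt[OF assms(1), of c] by simp
qed

lemma edge0_black:
  assumes "s \<in> P" shows "(bl s, w, 0) \<in> cedges graph \<longleftrightarrow> s \<notin> Q \<and> w = wh (inv_into P \<sigma> s)"
proof
  assume "(bl s, w, 0) \<in> cedges graph"
  then show "s \<notin> Q \<and> w = wh (inv_into P \<sigma> s)"
  proof (cases rule: edgeE)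
    case (2 s')
    then have "s = \<sigma> s'" using bl_eq[OF assms \<sigma>P[OF 2(1)]] by simp
    then show ?thesis using 2 inv_into_f_f[OF \<sigma>(1) 2(1)] by simp
  qed simp
next
  assume s: "s \<notin> Q \<and> w = wh (inv_into P \<sigma> s)"
  have "s \<in> \<sigma> ` P" using assms bij_betw_imp_surj_on[OF \<sigma>_bij] by simp
  then have "inv_into P \<sigma> s \<in> P" "\<sigma> (inv_into P \<sigma> s) = s" by (rule inv_into_into, rule f_inv_into_f)
  then show "(bl s, w, 0) \<in> cedges graph" using edge0I[of "inv_into P \<sigma> s"] s by simp
qed

lemma edge0_white:
  assumes "s \<in> P" shows "(b, wh s, 0) \<in> cedges graph \<longleftrightarrow> \<sigma> s \<notin> Q \<and> b = bl (\<sigma> s)"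
proof
  assume "(b, wh s, 0) \<in> cedges graph"
  then show "\<sigma> s \<notin> Q \<and> b = bl (\<sigma> s)"
  proof (cases rule: edgeE)
    case (2 s')
    then show ?thesis using wh_eq[OF assms 2(1)] by simp
  qed simp
qed (use edge0I[OF assms] in simp)

lemma color_degree_graph:
  assumes "s \<in> P"
  shows "c \<in> {1..D} \<Longrightarrow> color_degree graph c (bl s) = 1"
    and "c \<in> {1..D} \<Longrightarrow> color_degree graph c (wh s) = 1"
    and "color_degree graph 0 (bl s) = (if s \<in> Q then 0 else 1)"
    and "color_degree graph 0 (wh s) = (if \<sigma> s \<in> Q then 0 else 1)"
  using assms color_degree_black[OF wf_graph, of "bl s"] color_degree_white[OF wf_graph, of "wh s"]
  by (simp_all add: edge_black edge_white edge0_black edge0_white)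

lemma degD_black: "s \<in> P \<Longrightarrow> bl s \<in> degD_vertices graph \<longleftrightarrow> s \<in> Q"
  and degD_white: "s \<in> P \<Longrightarrow> wh s \<in> degD_vertices graph \<longleftrightarrow> \<sigma> s \<in> Q"
  unfolding degD_vertices_def using color_degree_graph(3,4) by auto

text \<open>The two vertices of a slot are adjacent, so closed sets of vertices come from sets of
  slots.\<close>

lemma connected_graph:
  assumes ne: "P \<noteq> {}"
    and T: "\<And>T. T \<subseteq> P \<Longrightarrow> T \<noteq> {} \<Longrightarrow> (\<And>s. s \<in> P \<Longrightarrow> s \<in> T \<longleftrightarrow> \<tau> s \<in> T) \<Longrightarrow>
      (\<And>s. s \<in> P \<Longrightarrow> \<sigma> s \<notin> Q \<Longrightarrow> s \<in> T \<longleftrightarrow> \<sigma> s \<in> T) \<Longrightarrow> T = P"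
  shows "connected_cgraph graph"
proof -
  obtain s0 where s0: "s0 \<in> P" using ne by blast
  show ?thesis
    unfolding connected_cgraph_def
  proof (rule connectedI_closed[OF wf_multigraph_of[OF wf_graph], of "bl s0"])
    show "bl s0 \<in> verts (multigraph_of graph)" using s0 by simp
    fix S assume cl: "closed_in (multigraph_of graph) S" and S: "bl s0 \<in> S"
    have e: "b \<in> S \<longleftrightarrow> w \<in> S" if "(b, w, c) \<in> cedges graph" for b w c
      using cl that unfolding closed_in_multigraph_of by blast
    have bw: "bl s \<in> S \<longleftrightarrow> wh s \<in> S" if s: "s \<in> P" for s
    proof -
      \<comment> \<open>A color different from that of the bubble joins the two vertices of the
        slot.\<close>
      define c where "c = (if col s = 1 then 2 else 1 :: nat)"
      have "c \<in> {1..D}" "c \<noteq> col s" using D unfolding c_def by auto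
      then show ?thesis using e[OF edgeI[OF s, of c]] unfolding t_def by simp
    qed
    have "{s \<in> P. bl s \<in> S} = P"
    proof (rule T)
      show "{s \<in> P. bl s \<in> S} \<noteq> {}" using s0 S by blast
      fix s assume s: "s \<in> P"
      show "s \<in> {s \<in> P. bl s \<in> S} \<longleftrightarrow> \<tau> s \<in> {s \<in> P. bl s \<in> S}"
        using s \<tau>[OF s] e[OF edgeI[OF s, of "col s"]] bw[of "\<tau> s"] unfolding t_def by simp
      assume "\<sigma> s \<notin> Q"
      then show "s \<in> {s \<in> P. bl s \<in> S} \<longleftrightarrow> \<sigma> s \<in> {s \<in> P. bl s \<in> S}"
        using s \<sigma>P[OF s] e[OF edge0I[OF s]] bw[OF s] by simp
    qed blast
    then show "verts (multigraph_of graph) \<subseteq> S" using bw by auto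
  qed
qed

lemma delete0_edge:
  "(b, w, c) \<in> cedges (delete0 graph) \<longleftrightarrow> (b, w, c) \<in> cedges graph \<and> c \<in> {1..D}"
proof -
  have "c = 0 \<or> c \<in> {1..D}" if "(b, w, c) \<in> cedges graph" using that by (cases rule: edgeE) auto
  then show ?thesis unfolding delete0_def ecolor_def by auto
qed

abbreviation bubble_verts :: "'s \<Rightarrow> 'v set" where
  "bubble_verts s \<equiv> {bl s, wh s, bl (\<tau> s), wh (\<tau> s)}"

lemma bubble_verts_mem:
  assumes "s \<in> P" "r \<in> P"
  shows "bl r \<in> bubble_verts s \<longleftrightarrow> r = s \<or> r = \<tau> s" "wh r \<in> bubble_verts s \<longleftrightarrow> r = s \<or> r = \<tau> s"
  using assms \<tau>[OF assms(1)] bl_eq wh_eq bl_wh wh_bl by auto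

lemma bubble_component:
  assumes s: "s \<in> P" shows "bubble_verts s \<in> components (multigraph_of (delete0 graph))"
proof (rule componentI[OF wf_multigraph_of[OF wf_delete0[OF wf_graph]], of _ "bl s"])
  note \<tau>s = \<tau>[OF s]
  show "closed_in (multigraph_of (delete0 graph)) (bubble_verts s)"
    unfolding closed_in_multigraph_of
  proof (clarify)
    fix b w c assume "(b, w, c) \<in> cedges (delete0 graph)"
    then have e: "(b, w, c) \<in> cedges graph" and c: "c \<in> {1..D}" unfolding delete0_edge by auto
    from e show "b \<in> bubble_verts s \<longleftrightarrow> w \<in> bubble_verts s"
    proof (cases rule: edgeE)
      case (1 r)
      have "r = s \<or> r = \<tau> s \<longleftrightarrow> t c r = s \<or> t c r = \<tau> s"
      proof (cases "c = col r")
        case True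
        then show ?thesis using \<tau>s \<tau>[OF 1(1)] unfolding t_def by metis
      qed (simp add: t_def)
      then show ?thesis
        unfolding 1(3,4) bubble_verts_mem(1)[OF s 1(1)] bubble_verts_mem(2)[OF s tP[OF 1(1)]] .
    qed (use c in simp)
  qed
  show "bl s \<in> verts (multigraph_of (delete0 graph))" using s by simp
  fix S assume cl: "closed_in (multigraph_of (delete0 graph)) S" and S: "bl s \<in> S"
  have e: "bl r \<in> S \<longleftrightarrow> wh (t c r) \<in> S" if "r \<in> P" "c \<in> {1..D}" for r c
    using cl edgeI[OF that] that unfolding closed_in_multigraph_of using delete0_edge by blast
  have bw: "bl r \<in> S \<longleftrightarrow> wh r \<in> S" if r: "r \<in> P" for r
  proof -
    define c where "c = (if col r = 1 then 2 else 1 :: nat)"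
    have "c \<in> {1..D}" "c \<noteq> col r" using D unfolding c_def by auto
    then show ?thesis using e[OF r, of c] unfolding t_def by simp
  qed
  show "bubble_verts s \<subseteq> S"
    using S bw[OF s] e[OF s, of "col s"] bw[of "\<tau> s"] \<tau>s unfolding t_def by simp
qed simp

lemma components_graph: "components (multigraph_of (delete0 graph)) = bubble_verts ` P"
proof
  show "bubble_verts ` P \<subseteq> components (multigraph_of (delete0 graph))" using bubble_component by blast
  show "components (multigraph_of (delete0 graph)) \<subseteq> bubble_verts ` P"
  proof
    fix C assume C: "C \<in> components (multigraph_of (delete0 graph))"
    note part = bubble_components[of graph]
    have "C \<noteq> {}" "C \<subseteq> bl ` P \<union> wh ` P" using C part unfolding partition_on_def by auto
    then obtain s where s: "s \<in> P" "bl s \<in> C \<or> wh s \<in> C" by blast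
    then have "C \<inter> bubble_verts s \<noteq> {}" by blast
    then have "C = bubble_verts s"
      using disjointD[OF partition_onD2[OF part] C bubble_component[OF s(1)]] by metis
    then show "C \<in> bubble_verts ` P" using s(1) by blast
  qed
qed

lemma bubble_iso:
  assumes s: "s \<in> P"
  shows "cgraph_iso (induced_cgraph (delete0 graph) (bubble_verts s)) (quartic_melonic D (col s))"
proof (rule cgraph_iso_inverse)
  let ?k = "case_quartic_vertex (bl s) (wh s) (bl (\<tau> s)) (wh (\<tau> s))"
  let ?I = "induced_cgraph (delete0 graph) (bubble_verts s)"
  let ?q = "quartic_melonic D (col s)"
  note \<tau>s = \<tau>[OF s]
  have cv: "cverts ?q = {Black1, White1, Black2, White2}" by (auto simp: cverts_def quartic_melonic_def)
  show "inj_on ?k (cverts ?q)"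
    unfolding cv using s \<tau>s bl_eq wh_eq bl_wh wh_bl by (auto simp: inj_on_def)
  show "?k ` blacks ?q = blacks ?I"
    using s \<tau>s bubble_verts_mem(1)[OF s] by (auto simp: quartic_melonic_def induced_cgraph_def delete0_def)
  show "?k ` whites ?q = whites ?I"
    using s \<tau>s bubble_verts_mem(2)[OF s] by (auto simp: quartic_melonic_def induced_cgraph_def delete0_def)
  show "wf_cgraph ?q"
    using finite_subset[of "cedges ?q" "UNIV"]
    unfolding wf_cgraph_def by (auto simp: quartic_melonic_def)
  have I: "(b, w, c) \<in> cedges ?I \<longleftrightarrow> (\<exists>r\<in>{s, \<tau> s}. c \<in> {1..D} \<and> b = bl r \<and> w = wh (t c r))" for b w c
  proof
    assume "(b, w, c) \<in> cedges ?I"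
    then have e: "(b, w, c) \<in> cedges graph" "c \<in> {1..D}" "b \<in> bubble_verts s"
      using delete0_edge[of b w c] by (auto simp: induced_cgraph_def)
    from e(1) show "\<exists>r\<in>{s, \<tau> s}. c \<in> {1..D} \<and> b = bl r \<and> w = wh (t c r)"
    proof (cases rule: edgeE)
      case (1 r)
      then have "r \<in> {s, \<tau> s}" using e(3) bubble_verts_mem(1)[OF s 1(1)] by simp
      then show ?thesis using 1 by blast
    qed (use e in simp)
  next
    assume "\<exists>r\<in>{s, \<tau> s}. c \<in> {1..D} \<and> b = bl r \<and> w = wh (t c r)"
    then obtain r where r: "r = s \<or> r = \<tau> s" "c \<in> {1..D}" "b = bl r" "w = wh (t c r)" by blast
    then have "r \<in> P" using s \<tau>s by auto
    moreover have "t c r = s \<or> t c r = \<tau> s" using r(1) \<tau>s unfolding t_def by auto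
    ultimately show "(b, w, c) \<in> cedges ?I"
      using r edgeI[of r c] delete0_edge[of b w c] by (auto simp: induced_cgraph_def)
  qed
  show "(\<lambda>(b, w, c). (?k b, ?k w, c)) ` cedges ?q = cedges ?I"
  proof
    show "(\<lambda>(b, w, c). (?k b, ?k w, c)) ` cedges ?q \<subseteq> cedges ?I"
    proof
      fix e assume "e \<in> (\<lambda>(b, w, c). (?k b, ?k w, c)) ` cedges ?q"
      then obtain b w c where q: "(b, w, c) \<in> cedges ?q" "e = (?k b, ?k w, c)" by auto
      then show "e \<in> cedges ?I"
        unfolding q(2) I using \<tau>s unfolding quartic_melonic_def t_def by auto
    qed
    show "cedges ?I \<subseteq> (\<lambda>(b, w, c). (?k b, ?k w, c)) ` cedges ?q"
    proof
      fix e assume "e \<in> cedges ?I"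
      then obtain r c where rc: "r = s \<or> r = \<tau> s" "c \<in> {1..D}" "e = (bl r, wh (t c r), c)"
        using I by (cases e) blast
      let ?m = "\<lambda>(b, w, c). (?k b, ?k w, c)"
      have q: "(Black1, if c = col s then White2 else White1, c) \<in> cedges ?q"
        "(Black2, if c = col s then White1 else White2, c) \<in> cedges ?q"
        using quartic_edges[OF rc(2), of "col s"] \<tau>s by auto
      have m: "(bl s, wh (t c s), c) = ?m (Black1, if c = col s then White2 else White1, c)"
        "(bl (\<tau> s), wh (t c (\<tau> s)), c) = ?m (Black2, if c = col s then White1 else White2, c)"
        using \<tau>s unfolding t_def by auto
      have "?m (Black1, if c = col s then White2 else White1, c) \<in> ?m ` cedges ?q"
        "?m (Black2, if c = col s then White1 else White2, c) \<in> ?m ` cedges ?q"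
        by (rule imageI[OF q(1)], rule imageI[OF q(2)])
      then have "{(bl s, wh (t c s), c), (bl (\<tau> s), wh (t c (\<tau> s)), c)} \<subseteq> ?m ` cedges ?q"
        unfolding m[symmetric] by (intro insert_subsetI empty_subsetI)
      moreover have "e \<in> {(bl s, wh (t c s), c), (bl (\<tau> s), wh (t c (\<tau> s)), c)}" using rc(1,3) by auto
      ultimately show "e \<in> ?m ` cedges ?q" by (rule subsetD)
    qed
  qed
qed

lemma graph_in_GG:
  assumes conn: "connected_cgraph graph"
  shows "graph \<in> GG D (card Q) (B4m D)"
proof -
  have "ecolor ` cedges graph \<subseteq> {0..D}" unfolding graph_def ecolor_def by auto
  moreover have "blacks graph \<inter> degD_vertices graph = bl ` Q" using degD_black Q by auto
  then have "card (blacks graph \<inter> degD_vertices graph) = card Q"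
    using card_image[OF inj_on_subset[OF bl Q]] by simp
  moreover have "whites graph \<inter> degD_vertices graph = wh ` inv_into P \<sigma> ` Q"
  proof -
    \<comment> \<open>The white degree-D vertices belong to the slots just before
      \<open>Q\<close>.\<close>
    have "{s \<in> P. \<sigma> s \<in> Q} = inv_into P \<sigma> ` Q"
      using Q inv_into_f_f[OF \<sigma>(1)] bij_betw_inv_into_right[OF \<sigma>_bij]
        bij_betwE[OF bij_betw_inv_into[OF \<sigma>_bij]] by (auto simp: image_iff) metis+
    moreover have "whites graph \<inter> degD_vertices graph = wh ` {s \<in> P. \<sigma> s \<in> Q}" using degD_white by auto
    ultimately show ?thesis by simp
  qed
  then have "card (whites graph \<inter> degD_vertices graph) = card Q"
  proof -
    have i1: "inj_on (inv_into P \<sigma>) Q"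
      using inj_on_subset[OF bij_betw_imp_inj_on[OF bij_betw_inv_into[OF \<sigma>_bij]] Q] .
    have "inv_into P \<sigma> ` Q \<subseteq> P" using Q bij_betw_imp_surj_on[OF bij_betw_inv_into[OF \<sigma>_bij]] by blast
    then have "card (wh ` inv_into P \<sigma> ` Q) = card Q"
      using card_image[OF inj_on_subset[OF wh]] card_image[OF i1] by metis
    then show ?thesis using \<open>whites graph \<inter> degD_vertices graph = wh ` inv_into P \<sigma> ` Q\<close> by simp
  qed
  moreover have "\<forall>H\<in>bubbles graph. \<exists>B\<in>B4m D. cgraph_iso H B"
    unfolding bubbles_def components_graph B4m_def using bubble_iso \<tau> by blast
  moreover have "\<forall>v\<in>cverts graph. \<forall>c\<in>{1..D}. color_degree graph c v = 1"
    using color_degree_graph(1,2) by auto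
  moreover have "\<forall>v\<in>cverts graph - degD_vertices graph. color_degree graph 0 v = 1"
    using color_degree_graph(3,4) degD_black degD_white by auto
  ultimately show ?thesis unfolding GG_def using wf_graph conn by blast
qed

text \<open>At a fixed slot of \<sigma> the color \<open>0\<close> edge is parallel to the
  \<open>D - 1\<close> edges of the slot, which gives a face of length two for each color except
  that of the bubble. An inequality suffices, because the lower bound on the degree limits the
  number of faces from above.\<close>

lemma card_leaf_faces:
  assumes "L \<subseteq> {s \<in> P. \<sigma> s = s \<and> s \<notin> Q}" and c: "c \<in> {1..D}"
  shows "card {s \<in> L. col s \<noteq> c} \<le> card {set vs | vs. alt_cycle graph 0 c vs}"
proof (rule card_inj_on_le)
  show "inj_on (\<lambda>s. {bl s, wh s}) {s \<in> L. col s \<noteq> c}"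
  proof (rule inj_onI)
    fix x y assume xy: "x \<in> {s \<in> L. col s \<noteq> c}" "y \<in> {s \<in> L. col s \<noteq> c}" and eq: "{bl x, wh x} = {bl y, wh y}"
    have "x \<in> P" "y \<in> P" using xy assms(1) by auto
    moreover have "bl x \<in> {bl y, wh y}" using eq by blast
    ultimately show "x = y" using bl_eq bl_wh by auto
  qed
  show "finite {set vs | vs. alt_cycle graph 0 c vs}"
  proof (rule finite_subset)
    show "{set vs | vs. alt_cycle graph 0 c vs} \<subseteq> Pow (cverts graph)"
      unfolding alt_cycle_def alt_path_def alt_walk_def by blast
    show "finite (Pow (cverts graph))" using fin by simp
  qed
  show "(\<lambda>s. {bl s, wh s}) ` {s \<in> L. col s \<noteq> c} \<subseteq> {set vs | vs. alt_cycle graph 0 c vs}"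
  proof (rule image_subsetI)
    fix s assume "s \<in> {s \<in> L. col s \<noteq> c}"
    then have s: "s \<in> P" "\<sigma> s = s" "s \<notin> Q" "col s \<noteq> c" using assms(1) by auto
    have "(bl s, wh s, 0) \<in> cedges graph" using edge0I[OF s(1)] s(2,3) by simp
    moreover have "(bl s, wh s, c) \<in> cedges graph" using edgeI[OF s(1) c] s(4) by (simp add: t_def)
    ultimately have "alt_cycle graph 0 c [bl s, wh s]"
      unfolding alt_cycle_def alt_path_def alt_walk_def cadj_def using s(1) bl_wh by auto
    then show "{bl s, wh s} \<in> {set vs | vs. alt_cycle graph 0 c vs}" by force
  qed
qed

text \<open>Carries the slot permutation \<open>\<sigma> \<circ> t c\<close> over to the black
  vertices; \<open>dec\<close> recovers the slot.\<close>

lemma face_perm_graph: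
  assumes c: "c \<in> {1..D}"
  defines "dec \<equiv> inv_into P bl"
  shows "face_perm graph c (bl ` Q) (\<lambda>b. wh (t c (dec b))) (\<lambda>b. wh (inv_into P \<sigma> (dec b))) (\<lambda>b. bl (\<sigma> (t c (dec b))))"
proof
  have dec: "dec (bl s) = s" if "s \<in> P" for s unfolding dec_def using inv_into_f_f[OF bl that] .
  show "wf_cgraph graph" by (rule wf_graph)
  show "wh (t c (dec b)) \<in> whites graph" if "b \<in> blacks graph" for b using that dec tP by auto
  show "inj_on (\<lambda>b. wh (t c (dec b))) (blacks graph)"
  proof (rule inj_onI)
    fix x y assume "x \<in> blacks graph" "y \<in> blacks graph" and eq: "wh (t c (dec x)) = wh (t c (dec y))"
    then obtain r s where rs: "r \<in> P" "s \<in> P" "x = bl r" "y = bl s" by auto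
    then have "t c r = t c s" using eq dec wh_eq[OF tP tP] by simp
    then show "x = y" using tt[of r c] tt[of s c] rs by metis
  qed
  show "(b, w, c) \<in> cedges graph \<longleftrightarrow> b \<in> blacks graph \<and> w = wh (t c (dec b))" for b w
    using cedges_ends(1)[OF wf_graph, of b w c] edge_black[OF _ c, of _ w] dec by auto
  show "bij_betw (\<lambda>b. wh (inv_into P \<sigma> (dec b))) (blacks graph) (whites graph)"
  proof -
    have "bij_betw dec (bl ` P) P" unfolding dec_def
      by (rule bij_betw_inv_into) (use bl in \<open>simp add: bij_betw_def\<close>)
    moreover have "bij_betw wh P (wh ` P)" using wh by (simp add: bij_betw_def)
    ultimately show ?thesis
      using bij_betw_trans[OF bij_betw_trans[OF _ bij_betw_inv_into[OF \<sigma>_bij]], of dec "bl ` P" wh "wh ` P"]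
      unfolding comp_def graph_sel by blast
  qed
  show "(b, w, 0) \<in> cedges graph \<longleftrightarrow> b \<in> blacks graph \<and> b \<notin> bl ` Q \<and> w = wh (inv_into P \<sigma> (dec b))" for b w
  proof (cases "b \<in> bl ` P")
    case True
    then obtain s where s: "s \<in> P" "b = bl s" by blast
    have "b \<in> bl ` Q \<longleftrightarrow> s \<in> Q" using inj_on_image_mem_iff[OF bl s(1) Q] s(2) by simp
    then show ?thesis using edge0_black[OF s(1), of w] s dec[OF s(1)] by simp
  next
    case False
    then show ?thesis using cedges_ends(1)[OF wf_graph, of b w 0] by auto
  qed
  fix b assume "b \<in> blacks graph"
  then obtain s where s: "s \<in> P" "b = bl s" by auto
  note r = \<sigma>P[OF tP[OF s(1), of c]]
  show "bl (\<sigma> (t c (dec b))) \<in> blacks graph" using r s dec[OF s(1)] by simp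
  show "wh (inv_into P \<sigma> (dec (bl (\<sigma> (t c (dec b)))))) = wh (t c (dec b))"
    using dec[OF r] dec[OF s(1)] s(2) inv_into_f_f[OF \<sigma>(1) tP[OF s(1), of c]] by simp
qed

text \<open>A path of color \<open>c\<close> from \<open>bl (\<mu> x)\<close> ends just before its
  first return to \<open>Q\<close>, at the white vertex that misses its edge into
  \<open>bl (\<mu> (h c x))\<close>. That vertex plays the role of \<open>\<phi> (h c x)\<close>,
  the white end of the color \<open>c\<close> edge of \<open>B\<close> at \<open>x\<close>.\<close>

lemma boundary_iso:
  assumes pg: "paired_graph D B \<alpha> \<phi> h" and \<mu>: "bij_betw \<mu> (blacks B) Q"
    and ret: "\<And>c x. c \<in> {1..D} \<Longrightarrow> x \<in> blacks B \<Longrightarrow> first_return (\<lambda>s. \<sigma> (t c s)) Q (\<mu> x) (\<mu> (h c x))"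
  shows "cgraph_iso (boundary_graph D graph) B"
proof -
  interpret B: paired_graph D B \<alpha> \<phi> h by (rule pg)
  let ?dG = "boundary_graph D graph" and ?\<sigma>' = "inv_into P \<sigma>"
  \<comment> \<open>A white vertex \<open>\<phi> b\<close> goes to the white vertex whose color
    \<open>0\<close> edge into \<open>bl (\<mu> b)\<close> was left out.\<close>
  define k where "k v = (if v \<in> blacks B then bl (\<mu> v) else wh (?\<sigma>' (\<mu> (inv_into (blacks B) \<phi> v))))" for v
  have kb: "k b = bl (\<mu> b)" if "b \<in> blacks B" for b using that by (simp add: k_def)
  have kw: "k (\<phi> b) = wh (?\<sigma>' (\<mu> b))" if "b \<in> blacks B" for b
    using B.disj B.\<phi>_white[OF that] inv_into_f_f[OF bij_betw_imp_inj_on[OF B.\<phi>_bij] that]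
    unfolding k_def by auto
  have W: "whites B = \<phi> ` blacks B" using bij_betw_imp_surj_on[OF B.\<phi>_bij] by simp
  have \<mu>Q: "\<mu> ` blacks B = Q" using bij_betw_imp_surj_on[OF \<mu>] .
  have \<mu>P: "\<mu> b \<in> P" if "b \<in> blacks B" for b using \<mu>Q Q that by blast
  have \<sigma>'P: "?\<sigma>' s \<in> P" "\<sigma> (?\<sigma>' s) = s" if "s \<in> P" for s
    using bij_betwE[OF bij_betw_inv_into[OF \<sigma>_bij]] bij_betw_inv_into_right[OF \<sigma>_bij] that by blast+
  have \<mu>eq: "a = b" if "a \<in> blacks B" "b \<in> blacks B" "\<mu> a = \<mu> b" for a b
    using inj_onD[OF bij_betw_imp_inj_on[OF \<mu>] that(3) that(1,2)] .
  have dGb: "blacks ?dG = bl ` Q" using degD_black Q by (auto simp: boundary_graph_def)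
  have dGw: "whites ?dG = wh ` ?\<sigma>' ` Q"
  proof
    show "whites ?dG \<subseteq> wh ` ?\<sigma>' ` Q"
    proof
      fix w assume "w \<in> whites ?dG"
      then obtain s where s: "s \<in> P" "w = wh s" "\<sigma> s \<in> Q" using degD_white by (auto simp: boundary_graph_def)
      then show "w \<in> wh ` ?\<sigma>' ` Q" using inv_into_f_f[OF \<sigma>(1) s(1)] by (metis imageI)
    qed
    show "wh ` ?\<sigma>' ` Q \<subseteq> whites ?dG"
      using \<sigma>'P Q degD_white by (auto simp: boundary_graph_def)
  qed
  show ?thesis
  proof (rule cgraph_iso_inverse[OF _ _ _ _ B.wf])
    show "inj_on k (cverts B)"
      unfolding cverts_def inj_on_Un W
    proof (intro conjI)
      show "inj_on k (blacks B)"
        by (rule inj_onI) (use kb bl_eq[OF \<mu>P \<mu>P] \<mu>eq in simp)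
      show "inj_on k (\<phi> ` blacks B)"
      proof (rule inj_onI, elim imageE)
        fix u v a b assume u: "u = \<phi> a" "a \<in> blacks B" and v: "v = \<phi> b" "b \<in> blacks B" and eq: "k u = k v"
        have "?\<sigma>' (\<mu> a) = ?\<sigma>' (\<mu> b)"
          using u v eq kw wh_eq[OF \<sigma>'P(1)[OF \<mu>P[OF u(2)]] \<sigma>'P(1)[OF \<mu>P[OF v(2)]]] by simp
        then have "\<mu> a = \<mu> b" using \<sigma>'P(2)[OF \<mu>P[OF u(2)]] \<sigma>'P(2)[OF \<mu>P[OF v(2)]] by metis
        then show "u = v" using \<mu>eq u v by blast
      qed
      have "k a \<noteq> k (\<phi> b)" if "a \<in> blacks B" "b \<in> blacks B" for a b
        using kb[OF that(1)] kw[OF that(2)] bl_wh[OF \<mu>P[OF that(1)] \<sigma>'P(1)[OF \<mu>P[OF that(2)]]] by simp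
      then show "k ` (blacks B - \<phi> ` blacks B) \<inter> k ` (\<phi> ` blacks B - blacks B) = {}" by blast
    qed
    show "k ` blacks B = blacks ?dG" 
    proof -
      have "k ` blacks B = bl ` \<mu> ` blacks B" unfolding image_image using kb by simp
      then show ?thesis unfolding dGb \<mu>Q .
    qed
    show "k ` whites B = whites ?dG" 
    proof -
      have "k ` whites B = wh ` ?\<sigma>' ` \<mu> ` blacks B" unfolding W image_image using kw by simp
      then show ?thesis unfolding dGw \<mu>Q .
    qed
    have path: "(bl (\<mu> x), wh (?\<sigma>' (\<mu> y)), c) \<in> cedges ?dG \<longleftrightarrow> y = h c x"
      if x: "x \<in> blacks B" and y: "y \<in> blacks B" and c: "c \<in> {1..D}" for x y c
    proof -
      let ?f = "\<lambda>s. \<sigma> (t c s)" and ?dec = "inv_into P bl"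
      let ?F = "\<lambda>b. bl (?f (?dec b))"
      interpret face_perm graph c "bl ` Q" "\<lambda>b. wh (t c (?dec b))" "\<lambda>b. wh (?\<sigma>' (?dec b))" ?F
        by (rule face_perm_graph[OF c])
      have dec: "?dec (bl s) = s" if "s \<in> P" for s using inv_into_f_f[OF bl that] .
      have pow: "(?f ^^ n) s \<in> P \<and> (?F ^^ n) (bl s) = bl ((?f ^^ n) s)" if "s \<in> P" for n s
        by (induction n) (use that dec \<sigma>P tP in auto)
      have blQ: "bl s \<in> bl ` Q \<longleftrightarrow> s \<in> Q" if "s \<in> P" for s using inj_on_image_mem_iff[OF bl that Q] .
      have "first_return ?F (bl ` Q) (bl (\<mu> x)) (bl (\<mu> (h c x)))"
      proof -
        obtain m where m: "\<mu> (h c x) \<in> Q" "(?f ^^ Suc m) (\<mu> x) = \<mu> (h c x)" "\<forall>n\<in>{1..m}. (?f ^^ n) (\<mu> x) \<notin> Q"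
          using ret[OF c x] unfolding first_return_def by blast
        have "(?F ^^ Suc m) (bl (\<mu> x)) = bl (\<mu> (h c x))"
          using conjunct2[OF pow[OF \<mu>P[OF x], of "Suc m"]] m(2) by simp
        moreover have "(?F ^^ n) (bl (\<mu> x)) \<notin> bl ` Q" if "n \<in> {1..m}" for n
          using pow[OF \<mu>P[OF x], of n] blQ[of "(?f ^^ n) (\<mu> x)"] bspec[OF m(3) that] by simp
        ultimately show ?thesis unfolding first_return_def using m(1) by blast
      qed
      moreover have "bl (\<mu> x) \<in> blacks graph" "bl (\<mu> x) \<in> bl ` Q" "bl (\<mu> y) \<in> blacks graph" "bl (\<mu> y) \<in> bl ` Q"
        using x y \<mu>P \<mu>Q by auto
      ultimately have "(\<exists>vs. alt_path graph c 0 vs \<and> hd vs = bl (\<mu> x) \<and> last vs = wh (?\<sigma>' (\<mu> y))) \<longleftrightarrow>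
          bl (\<mu> y) = bl (\<mu> (h c x))"
        using alt_path_first_return[of "bl (\<mu> x)" "bl (\<mu> (h c x))" "bl (\<mu> y)"] dec[OF \<mu>P[OF y]] by simp
      also have "\<dots> \<longleftrightarrow> y = h c x"
        using bl_eq[OF \<mu>P[OF y] \<mu>P[OF B.h_black[OF c x]]] \<mu>eq[OF y B.h_black[OF c x]] by blast
      finally have *: "(\<exists>vs. alt_path graph c 0 vs \<and> hd vs = bl (\<mu> x) \<and> last vs = wh (?\<sigma>' (\<mu> y))) \<longleftrightarrow> y = h c x" .
      have "bl (\<mu> x) \<in> blacks ?dG" "wh (?\<sigma>' (\<mu> y)) \<in> whites ?dG"
        unfolding dGb dGw using x y \<mu>Q by blast+
      then show ?thesis using * c by (simp add: boundary_graph_def)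
    qed
    show "(\<lambda>(b, w, c). (k b, k w, c)) ` cedges B = cedges ?dG"
    proof
      show "(\<lambda>(b, w, c). (k b, k w, c)) ` cedges B \<subseteq> cedges ?dG"
      proof (rule image_subsetI)
        fix e assume e: "e \<in> cedges B"
        obtain b w c where bwc: "e = (b, w, c)" by (cases e)
        note ends = B.contraction_ends[OF e[unfolded bwc]]
        have hb: "h c b \<in> blacks B" using B.h_black[OF ends(2,1)] .
        have "w = \<phi> (h c b)" using B.\<phi>_h[OF ends(2,1)] ends(3) by simp
        then show "(case e of (b, w, c) \<Rightarrow> (k b, k w, c)) \<in> cedges ?dG"
          using path[OF ends(1) hb ends(2)] kb[OF ends(1)] kw[OF hb] bwc by simp
      qed
      show "cedges ?dG \<subseteq> (\<lambda>(b, w, c). (k b, k w, c)) ` cedges B"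
      proof
        fix e assume e: "e \<in> cedges ?dG"
        then obtain b w c where bwc: "e = (b, w, c)" "b \<in> blacks ?dG" "w \<in> whites ?dG" "c \<in> {1..D}"
          by (cases e) (auto simp: boundary_graph_def)
        obtain x where x: "x \<in> blacks B" "b = bl (\<mu> x)" using bwc(2) \<mu>Q unfolding dGb by blast
        obtain y where y: "y \<in> blacks B" "w = wh (?\<sigma>' (\<mu> y))" using bwc(3) \<mu>Q unfolding dGw by blast
        have yh: "y = h c x" using path[OF x(1) y(1) bwc(4)] e bwc(1) x(2) y(2) by simp
        have "(x, \<phi> y, c) \<in> cedges B"
          using B.edge[OF bwc(4), of x "\<phi> y"] x(1) B.\<phi>_h[OF bwc(4) x(1)] yh by simp
        moreover have "e = (k x, k (\<phi> y), c)" using bwc(1) x y kb kw by simp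
        ultimately show "e \<in> (\<lambda>(b, w, c). (k b, k w, c)) ` cedges B" by force
      qed
    qed
  qed
qed

end

section \<open>Graphs attaining the bound\<close>

datatype 'v slot = In 'v nat | Out 'v nat | InLeaf 'v nat | OutLeaf 'v nat

fun slot_color :: "'v slot \<Rightarrow> nat" where
  "slot_color (In x i) = i"
| "slot_color (Out x i) = i"
| "slot_color (InLeaf x i) = i"
| "slot_color (OutLeaf x i) = i"

text \<open>The step from \<open>Out x D\<close> back to \<open>In x 1\<close> is the marked one,
  which the graph lacks. Leaves are fixed: their color \<open>0\<close> edge is parallel to the
  \<open>D - 1\<close> edges of the slot and becomes a loop after contraction.\<close>

fun slot_next :: "nat \<Rightarrow> 'v slot \<Rightarrow> 'v slot" where
  "slot_next D (In x i) = Out x i"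
| "slot_next D (Out x i) = (if i = D then In x 1 else In x (Suc i))"
| "slot_next D (InLeaf x i) = InLeaf x i"
| "slot_next D (OutLeaf x i) = OutLeaf x i"

text \<open>\<open>h'\<close> stands for the inverse of \<open>h\<close>. An ordinary bubble joins
  \<open>In x i\<close> to \<open>Out (h i x) i\<close>; for \<open>x\<close> in \<open>R i\<close>
  each of these two slots gets a leaf as its mate instead.\<close>

fun slot_mate :: "(nat \<Rightarrow> 'v \<Rightarrow> 'v) \<Rightarrow> (nat \<Rightarrow> 'v \<Rightarrow> 'v) \<Rightarrow> (nat \<Rightarrow> 'v set) \<Rightarrow> 'v slot \<Rightarrow> 'v slot" where
  "slot_mate h h' R (In x i) = (if x \<in> R i then InLeaf x i else Out (h i x) i)"
| "slot_mate h h' R (Out x i) = (if h' i x \<in> R i then OutLeaf (h' i x) i else In (h' i x) i)"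
| "slot_mate h h' R (InLeaf x i) = In x i"
| "slot_mate h h' R (OutLeaf x i) = Out (h i x) i"

text \<open>The slots of a graph attaining the bound: every black vertex \<open>x\<close> of \<open>B\<close> gets a path through
  \<open>In x 1\<close>, \<open>Out x 1\<close>, \<open>\<dots>\<close>, \<open>In x D\<close>, \<open>Out x D\<close>, and the bubble at \<open>In x i\<close> and
  \<open>Out (h i x) i\<close> multiplies the boundary permutation of color \<open>i\<close> by a transposition. In every
  cycle of \<open>h i\<close> one of these bubbles, at the element of \<open>R i\<close>, has to be left out. It is replaced by
  two bubbles with a loop, so that all vertices are treated alike.\<close>

locale slot_construction = paired_graph D B \<alpha> \<phi> h
  for D :: nat and B :: "'v cgraph" and \<alpha> \<phi> h +
  fixes R :: "nat \<Rightarrow> 'v set"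
  assumes D: "D \<ge> 3" and conn: "connected_cgraph B"
    and R: "i \<in> {1..D} \<Longrightarrow> R i \<subseteq> blacks B"
    and R_unique: "i \<in> {1..D} \<Longrightarrow> r \<in> R i \<Longrightarrow> r' \<in> R i \<Longrightarrow> r' \<in> orb (h i) r \<Longrightarrow> r' = r"
begin

definition h' :: "nat \<Rightarrow> 'v \<Rightarrow> 'v" where
  "h' i = inv_into (blacks B) (h i)"

definition main_slots :: "'v slot set" where
  "main_slots = (\<lambda>(x, i). In x i) ` (blacks B \<times> {1..D}) \<union> (\<lambda>(x, i). Out x i) ` (blacks B \<times> {1..D})"

definition leaf_slots :: "'v slot set" where
  "leaf_slots = (\<lambda>(i, x). InLeaf x i) ` Sigma {1..D} R \<union> (\<lambda>(i, x). OutLeaf x i) ` Sigma {1..D} R"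

definition slots :: "'v slot set" where
  "slots = main_slots \<union> leaf_slots"

definition marks :: "'v slot set" where
  "marks = (\<lambda>x. In x 1) ` blacks B"

abbreviation mate :: "'v slot \<Rightarrow> 'v slot" where
  "mate \<equiv> slot_mate h h' R"

lemma slots_iff [simp]:
  "In x i \<in> slots \<longleftrightarrow> x \<in> blacks B \<and> i \<in> {1..D}"
  "Out x i \<in> slots \<longleftrightarrow> x \<in> blacks B \<and> i \<in> {1..D}"
  "InLeaf x i \<in> slots \<longleftrightarrow> i \<in> {1..D} \<and> x \<in> R i"
  "OutLeaf x i \<in> slots \<longleftrightarrow> i \<in> {1..D} \<and> x \<in> R i"
  unfolding slots_def main_slots_def leaf_slots_def by auto

lemma fin_slots: "finite slots"
proof -
  have "finite (R i)" if "i \<in> {1..D}" for i using finite_subset[OF R[OF that] fin] .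
  then have "finite (Sigma {1..D} R)" by (intro finite_SigmaI) auto
  then show ?thesis unfolding slots_def main_slots_def leaf_slots_def using fin by simp
qed

lemma h_h':
  assumes "i \<in> {1..D}" "x \<in> blacks B"
  shows "h' i (h i x) = x" "h' i x \<in> blacks B" "h i (h' i x) = x"
proof -
  note perm = h_perm[OF assms(1)]
  have surj: "h i ` blacks B = blacks B" using endo_inj_surj[OF fin perm(2,1)] .
  show "h' i (h i x) = x" unfolding h'_def using inv_into_f_f[OF perm(1) assms(2)] .
  have "x \<in> h i ` blacks B" using surj assms(2) by simp
  then show "h' i x \<in> blacks B" "h i (h' i x) = x" unfolding h'_def by (rule inv_into_into, rule f_inv_into_f)
qed

lemma next_in_slots: "s \<in> slots \<Longrightarrow> slot_next D s \<in> slots"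
  by (cases s) auto

lemma next_inj: "inj_on (slot_next D) slots"
proof (rule inj_onI)
  fix s s' :: "'v slot" assume "s \<in> slots" "s' \<in> slots" "slot_next D s = slot_next D s'"
  then show "s = s'" by (cases s; cases s') (auto split: if_splits)
qed

lemma mate_slots:
  assumes "s \<in> slots"
  shows "mate s \<in> slots \<and> mate s \<noteq> s \<and> mate (mate s) = s \<and> slot_color s \<in> {1..D} \<and> slot_color (mate s) = slot_color s"
proof (cases s)
  case (In x i)
  then show ?thesis using assms h_h'[of i x] h_black[of i x] by auto
next
  case (Out x i)
  then show ?thesis using assms h_h'[of i x] R[of i] by auto
next
  case (InLeaf x i)
  then show ?thesis using assms R[of i] by auto
next
  case (OutLeaf x i)
  then have "i \<in> {1..D}" "x \<in> R i" "x \<in> blacks B" using assms R[of i] by auto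
  then show ?thesis using OutLeaf h_h'(1)[of i x] h_black[of i x] by auto
qed

lemma marks_slots: "marks \<subseteq> slots"
  unfolding marks_def using D by auto

section \<open>Tracing the faces from the marked slots\<close>

text \<open>The face permutation \<open>\<sigma> \<circ> t c\<close> of the slot graph, whose first
  returns to \<open>marks\<close> have to reproduce \<open>h c\<close>.\<close>

definition turn :: "nat \<Rightarrow> 'v slot \<Rightarrow> 'v slot" where
  "turn c s = slot_next D (if c = slot_color s then mate s else s)"

lemma In_marks [simp]: "In x i \<in> marks \<longleftrightarrow> x \<in> blacks B \<and> i = 1"
  and Out_marks [simp]: "Out x i \<notin> marks"
  and InLeaf_marks [simp]: "InLeaf x i \<notin> marks"
  and OutLeaf_marks [simp]: "OutLeaf x i \<notin> marks"
  unfolding marks_def by auto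

text \<open>Beyond position \<open>c\<close> the walk of color \<open>c\<close> crosses no bubble
  and runs along the path of \<open>y\<close> to its end.\<close>

lemma return_after:
  assumes y: "y \<in> blacks B" and j: "c < j" "j \<le> D"
  shows "first_return (turn c) marks (In y j) (In y 1)"
proof -
  have fwd: "first_return (turn c) marks (In y n) (In y 1)"
    if "first_return (turn c) marks (Out y n) (In y 1)" "c < n" for n
    by (rule first_return_step[of "turn c" "In y n" "Out y n", OF _ Out_marks that(1)])
      (use that(2) in \<open>simp add: turn_def\<close>)
  from j(2,1) show ?thesis
  proof (induction j rule: inc_induct)
    case base
    have "turn c (Out y D) = In y 1" using base by (simp add: turn_def)
    then show ?case using y base by (intro fwd first_return_base) simp_all
  next
    case (step n)
    have "turn c (Out y n) = In y (Suc n)" using step by (simp add: turn_def)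
    then have "first_return (turn c) marks (Out y n) (In y 1)"
      by (rule first_return_step) (use step in simp_all)
    then show ?case using step by (intro fwd) simp_all
  qed
qed

text \<open>For \<open>c = D\<close> the path of \<open>y\<close> ends right here, and the step
  itself is the return.\<close>

lemma return_exit:
  assumes y: "y \<in> blacks B" and c: "c \<in> {1..D}" and s: "turn c s = slot_next D (Out y c)"
  shows "first_return (turn c) marks s (In y 1)"
proof (cases "c = D")
  case True
  then have "turn c s = In y 1" using s by simp
  then show ?thesis by (rule first_return_base) (use y in simp)
next
  case False
  then have "turn c s = In y (Suc c)" using s by simp
  moreover have "In y (Suc c) \<notin> marks" using c by simp
  moreover have "first_return (turn c) marks (In y (Suc c)) (In y 1)"
    by (rule return_after[OF y]) (use c False in simp_all)
  ultimately show ?thesis by (rule first_return_step)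
qed

text \<open>With the bubble at \<open>x\<close> missing, color \<open>c\<close> walks backwards
  through the \<open>Out\<close> slots of the cycle of \<open>h c\<close>, from \<open>x\<close>
  round to \<open>h c x\<close>, where the leaf lets it exit. This is a cycle written as a product
  of transpositions, one fewer than its length.\<close>

lemma return_Out:
  assumes c: "c \<in> {1..D}" and x: "x \<in> blacks B" "x \<in> R c"
  shows "first_return (turn c) marks (Out x c) (In (h c x) 1)"
proof -
  note perm = fin h_perm[OF c]
  define N where "N = (LEAST n. n > 0 \<and> (h c ^^ n) x = x)"
  have ex: "\<exists>n. n > 0 \<and> (h c ^^ n) x = x" using funpow_period[OF perm x(1)] by metis
  have N: "N > 0" "(h c ^^ N) x = x" using LeastI_ex[OF ex] unfolding N_def by auto
  have least: "(h c ^^ n) x \<noteq> x" if "n > 0" "n < N" for n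
    using not_less_Least[of n "\<lambda>n. n > 0 \<and> (h c ^^ n) x = x"] that unfolding N_def by simp
  have bl: "(h c ^^ n) x \<in> blacks B" for n
    using orb_subset[OF perm(3) x(1)] funpow_in_orb[of n "h c" x] by blast
  have h'_pow: "h' c ((h c ^^ Suc n) x) = (h c ^^ n) x" for n
    using h_h'(1)[OF c bl[of n]] by simp
  \<comment> \<open>Induction on the distance from the exit at \<open>h c x\<close>; the start
    \<open>x\<close> is the iterate with \<open>Suc n = N\<close>.\<close>
  have "first_return (turn c) marks (Out ((h c ^^ Suc n) x) c) (In (h c x) 1)" if "Suc n \<le> N" for n
    using that
  proof (induction n)
    case 0
    have hx: "h c x \<in> blacks B" using h_black[OF c x(1)] .
    have "h' c (h c x) = x" using h_h'(1)[OF c x(1)] .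
    then have "turn c (Out (h c x) c) = OutLeaf x c" using x(2) by (simp add: turn_def)
    moreover have "first_return (turn c) marks (OutLeaf x c) (In (h c x) 1)"
      by (rule return_exit[OF hx c]) (simp add: turn_def)
    ultimately have "first_return (turn c) marks (Out (h c x) c) (In (h c x) 1)"
      by (rule first_return_step[of "turn c" "Out (h c x) c" "OutLeaf x c", OF _ OutLeaf_marks])
    then show ?case by simp
  next
    case (Suc n)
    let ?y = "(h c ^^ Suc n) x"
    \<comment> \<open>\<open>x\<close> is the only element of \<open>R c\<close> on its cycle, and
      the minimality of \<open>N\<close> keeps this iterate away from \<open>x\<close>.\<close>
    have "?y \<notin> R c"
    proof
      assume "?y \<in> R c"
      then have "?y = x" using R_unique[OF c x(2) _ funpow_in_orb] by blast
      then show False using least[of "Suc n"] Suc.prems by simp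
    qed
    moreover have "h' c ((h c ^^ Suc (Suc n)) x) = ?y" by (rule h'_pow)
    ultimately have "turn c (Out ((h c ^^ Suc (Suc n)) x) c) = Out ?y c"
      by (simp only: turn_def slot_color.simps slot_mate.simps slot_next.simps simp_thms if_True if_False)
    moreover have "first_return (turn c) marks (Out ?y c) (In (h c x) 1)" using Suc by (meson Suc_leD)
    ultimately show ?case
      by (rule first_return_step[of "turn c" "Out ((h c ^^ Suc (Suc n)) x) c" "Out ?y c", OF _ Out_marks])
  qed
  from this[of "N - 1"] show ?thesis using N by simp
qed

text \<open>Before position \<open>c\<close> the walk crosses no bubble. There an ordinary
  \<open>x\<close> crosses over to the path of \<open>h c x\<close>, while an \<open>x\<close> in
  \<open>R c\<close> visits its leaf and then takes the way of \<open>return_Out\<close>.\<close>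

lemma return_mark:
  assumes c: "c \<in> {1..D}" and x: "x \<in> blacks B"
  shows "first_return (turn c) marks (In x 1) (In (h c x) 1)"
proof -
  have at_c: "first_return (turn c) marks (In x c) (In (h c x) 1)"
  proof (cases "x \<in> R c")
    case True
    have "turn c (InLeaf x c) = Out x c" by (simp add: turn_def)
    then have "first_return (turn c) marks (InLeaf x c) (In (h c x) 1)"
      by (rule first_return_step[OF _ _ return_Out[OF c x True]]) simp
    from first_return_step[of "turn c" "In x c" "InLeaf x c", OF _ InLeaf_marks this]
    show ?thesis
      using True by (simp add: turn_def)
  next
    case False
    then show ?thesis by (intro return_exit h_black c x) (simp add: turn_def)
  qed
  have "first_return (turn c) marks (In x j) (In (h c x) 1)" if "j \<le> c" "1 \<le> j" for j
    using that
  proof (induction j rule: inc_induct)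
    case base
    show ?case by (rule at_c)
  next
    case (step n)
    have "turn c (Out x n) = In x (Suc n)" using step c by (simp add: turn_def)
    then have "first_return (turn c) marks (Out x n) (In (h c x) 1)"
      by (rule first_return_step) (use step in simp_all)
    moreover have "turn c (In x n) = Out x n" using step by (simp add: turn_def)
    ultimately show ?case
      using first_return_step[of "turn c" "In x n" "Out x n", OF _ Out_marks] by blast
  qed
  from this[of 1] show ?thesis using c by simp
qed

text \<open>The slots of one \<open>x\<close> hang together along its path. The paths of
  \<open>x\<close> and \<open>h c x\<close> are linked by the walk of \<open>return_mark\<close>,
  and connectedness of \<open>B\<close> does the rest.\<close>

lemma slots_connected:
  assumes T: "T \<subseteq> slots" "T \<noteq> {}" and mateT: "\<And>s. s \<in> slots \<Longrightarrow> s \<in> T \<longleftrightarrow> mate s \<in> T"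
    and nextT: "\<And>s. s \<in> slots \<Longrightarrow> slot_next D s \<notin> marks \<Longrightarrow> s \<in> T \<longleftrightarrow> slot_next D s \<in> T"
  shows "T = slots"
proof -
  have path: "In x i \<in> T \<longleftrightarrow> In x 1 \<in> T" if x: "x \<in> blacks B" and i: "1 \<le> i" "i \<le> D" for x i
    using i
  proof (induction i rule: dec_induct)
    case (step n)
    have "In x n \<in> T \<longleftrightarrow> Out x n \<in> T" using nextT[of "In x n"] x step by simp
    moreover have "Out x n \<in> T \<longleftrightarrow> In x (Suc n) \<in> T" using nextT[of "Out x n"] x step by simp
    ultimately show ?case using step by simp
  qed simp
  have out: "Out x i \<in> T \<longleftrightarrow> In x 1 \<in> T" if "x \<in> blacks B" "i \<in> {1..D}" for x i
    using nextT[of "In x i"] path[of x i] that by simp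
  have hT: "In (h c x) 1 \<in> T \<longleftrightarrow> In x 1 \<in> T" if c: "c \<in> {1..D}" and x: "x \<in> blacks B" for c x
  proof -
    have into: "turn c ` slots \<subseteq> slots"
      unfolding turn_def using next_in_slots mate_slots by (auto simp: image_subset_iff)
    have inv: "s \<in> T \<longleftrightarrow> turn c s \<in> T" if "s \<in> slots" "turn c s \<notin> marks" for s
      using mateT[OF that(1)] nextT[OF that(1)] nextT[of "mate s"] mate_slots[OF that(1)] that(2)
      unfolding turn_def by (simp split: if_splits)
    have "In x 1 \<in> slots" using x D by simp
    then obtain s where s: "s \<in> slots" "turn c s = In (h c x) 1" "s \<in> T \<longleftrightarrow> In x 1 \<in> T"
      using first_return_invariant[OF return_mark[OF c x] _ into inv] by blast
    \<comment> \<open>The last slot before the return, which must be \<open>Out (h c x) D\<close>;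
      the marked step after it is absent from the graph.\<close>
    define r where "r = (if c = slot_color s then mate s else s)"
    have r: "r \<in> slots" "r \<in> T \<longleftrightarrow> s \<in> T" "slot_next D r = In (h c x) 1"
      using s mate_slots[OF s(1)] mateT[OF s(1)] unfolding r_def turn_def by simp_all
    have "h c x \<in> blacks B" using h_black[OF c x] .
    then have "slot_next D r = slot_next D (Out (h c x) D)" "Out (h c x) D \<in> slots" using r(3) D by auto
    then have "r = Out (h c x) D" using inj_onD[OF next_inj] r(1) by blast
    then show ?thesis using out[OF \<open>h c x \<in> blacks B\<close>, of D] r(2) s(3) D by simp
  qed
  let ?A = "{x \<in> blacks B. In x 1 \<in> T}"
  have cl: "closed_in (multigraph_of B) (?A \<union> \<phi> ` ?A)"
    unfolding closed_in_multigraph_of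
  proof (clarify)
    fix b w c assume e: "(b, w, c) \<in> cedges B"
    note ends = contraction_ends[OF e]
    have w: "w = \<phi> (h c b)" using \<phi>_h[OF ends(2,1)] ends(3) by simp
    have hb: "h c b \<in> blacks B" using h_black[OF ends(2,1)] .
    have "b \<in> ?A \<union> \<phi> ` ?A \<longleftrightarrow> In b 1 \<in> T" using ends(1) disj[OF ends(1)] \<phi>_white by auto
    moreover have "w \<in> ?A \<union> \<phi> ` ?A \<longleftrightarrow> In (h c b) 1 \<in> T"
      unfolding w using hb disj \<phi>_white[OF hb] \<phi>_eq[OF hb] by auto
    ultimately show "b \<in> ?A \<union> \<phi> ` ?A \<longleftrightarrow> w \<in> ?A \<union> \<phi> ` ?A" using hT[OF ends(2,1)] by simp
  qed
  have main: "\<exists>x\<in>blacks B. s \<in> T \<longleftrightarrow> In x 1 \<in> T" if s: "s \<in> slots" for s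
  proof (cases s)
    case (In x i)
    then show ?thesis using s path[of x i] by auto
  next
    case (Out x i)
    then show ?thesis using s out[of x i] by auto
  next
    case (InLeaf x i)
    then have "i \<in> {1..D}" "x \<in> blacks B" using s R[of i] by auto
    then show ?thesis using InLeaf mateT[OF s] path[of x i] by auto
  next
    case (OutLeaf x i)
    then have "i \<in> {1..D}" "x \<in> blacks B" using s R[of i] by auto
    then have "h i x \<in> blacks B" "s \<in> T \<longleftrightarrow> In (h i x) 1 \<in> T"
      using OutLeaf mateT[OF s] out[of "h i x" i] h_black[of i x] by auto
    then show ?thesis by blast
  qed
  obtain s where "s \<in> T" using T(2) by blast
  then obtain x where x: "x \<in> blacks B" "In x 1 \<in> T" using main[of s] T(1) by blast
  have "verts (multigraph_of B) \<subseteq> ?A \<union> \<phi> ` ?A"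
    using conn x unfolding connected_cgraph_def by (intro connected_least[OF _ cl, of x]) (auto simp: cverts_def)
  then have sub: "blacks B \<subseteq> ?A \<union> \<phi> ` ?A" by (simp add: cverts_def)
  have "blacks B \<subseteq> ?A"
  proof
    fix b assume b: "b \<in> blacks B"
    then have "b \<notin> \<phi> ` ?A" using disj \<phi>_white by blast
    then show "b \<in> ?A" using sub b by blast
  qed
  then show ?thesis using main T(1) by blast
qed

section \<open>Counting slots, bubbles and faces\<close>

lemma card_main_slots: "card main_slots = 2 * (D * card (blacks B))"
proof -
  let ?in = "(\<lambda>(x, i). In x i) ` (blacks B \<times> {1..D})" and ?out = "(\<lambda>(x, i). Out x i) ` (blacks B \<times> {1..D})"
  have "card ?in = card (blacks B \<times> {1..D})" "card ?out = card (blacks B \<times> {1..D})"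
    by (auto intro!: card_image simp: inj_on_def)
  moreover have "card main_slots = card ?in + card ?out"
    unfolding main_slots_def using fin by (intro card_Un_disjoint) auto
  ultimately show ?thesis by (simp add: card_cartesian_product mult.commute)
qed

lemma fin_R: "i \<in> {1..D} \<Longrightarrow> finite (R i)"
  using finite_subset[OF R fin] .

lemma card_leaf_slots:
  assumes "I \<subseteq> {1..D}"
  shows "card {s \<in> leaf_slots. slot_color s \<in> I} = 2 * (\<Sum>i\<in>I. card (R i))"
proof -
  let ?in = "(\<lambda>(i, x). InLeaf x i) ` Sigma I R" and ?out = "(\<lambda>(i, x). OutLeaf x i) ` Sigma I R"
  have finI: "finite I" using finite_subset[OF assms] by simp
  have "finite (R i)" if "i \<in> I" for i using fin_R that assms by blast
  then have S: "finite (Sigma I R)" "card (Sigma I R) = (\<Sum>i\<in>I. card (R i))"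
    using finI card_SigmaI[OF finI, of R] by auto
  have "card ?in = card (Sigma I R)" "card ?out = card (Sigma I R)"
    by (auto intro!: card_image simp: inj_on_def)
  moreover have "card (?in \<union> ?out) = card ?in + card ?out"
    using S(1) by (intro card_Un_disjoint) auto
  moreover have "{s \<in> leaf_slots. slot_color s \<in> I} = ?in \<union> ?out"
    unfolding leaf_slots_def using assms by auto
  ultimately show ?thesis using S(2) by simp
qed

lemma card_slots: "card slots = 2 * (D * card (blacks B) + (\<Sum>i=1..D. card (R i)))"
proof -
  have "{s \<in> leaf_slots. slot_color s \<in> {1..D}} = leaf_slots" unfolding leaf_slots_def by auto
  then have "card leaf_slots = 2 * (\<Sum>i=1..D. card (R i))" using card_leaf_slots[of "{1..D}"] by simp
  moreover have "card slots = card main_slots + card leaf_slots"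
    using fin_slots unfolding slots_def by (intro card_Un_disjoint) (auto simp: main_slots_def leaf_slots_def)
  ultimately show ?thesis using card_main_slots by simp
qed

text \<open>Let \<open>q\<close> be the number of black vertices of \<open>B\<close> and
  \<open>\<Phi>\<close> the sum of the \<open>card (R i)\<close>. The \<open>D * q + \<Phi>\<close>
  bubbles cost \<open>D - 1\<close> each, and the \<open>2 * \<Phi>\<close> leaves bring
  \<open>D - 1\<close> faces each. When every cycle of \<open>h i\<close> has a representative in
  \<open>R i\<close>, this is the bound.\<close>

lemma slot_graph_exists:
  "\<exists>G :: nat cgraph. G \<in> GG D (card (blacks B)) (B4m D) \<and> cgraph_iso (boundary_graph D G) B \<and>
     graph_degree D G \<le> int D + (int D - 1) * (int D * int (card (blacks B)) - int (\<Sum>i=1..D. card (R i)))"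
proof -
  obtain enc :: "'v slot \<Rightarrow> nat" where enc: "inj_on enc slots"
    using finite_imp_inj_to_nat_seg[OF fin_slots] by blast
  \<comment> \<open>Even and odd numbers keep black and white vertices apart.\<close>
  define bl wh where "bl s = 2 * enc s" and "wh s = 2 * enc s + 1" for s
  interpret S: slot_graph D slots "slot_next D" mate slot_color marks bl wh
  proof
    show "bl s \<noteq> wh s'" for s s' unfolding bl_def wh_def by presburger
    show "inj_on bl slots" "inj_on wh slots" using enc by (auto simp: inj_on_def bl_def wh_def)
  qed (use D fin_slots next_inj next_in_slots mate_slots marks_slots in auto)
  have ne: "slots \<noteq> {}"
  proof -
    have "verts (multigraph_of B) \<noteq> {}"
      using conn unfolding connected_cgraph_def connected_def strongly_connected_def by simp
    then have "blacks B \<noteq> {}" using \<phi>_bij by (auto simp: cverts_def bij_betw_def)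
    then show ?thesis using marks_slots unfolding marks_def by blast
  qed
  have "card marks = card (blacks B)" unfolding marks_def by (rule card_image) (simp add: inj_on_def)
  moreover have "connected_cgraph S.graph" by (rule S.connected_graph[OF ne slots_connected])
  ultimately have GG: "S.graph \<in> GG D (card (blacks B)) (B4m D)" using S.graph_in_GG by simp
  have "bij_betw (\<lambda>x. In x 1) (blacks B) marks" unfolding marks_def by (auto simp: bij_betw_def inj_on_def)
  then have iso: "cgraph_iso (boundary_graph D S.graph) B"
    by (rule S.boundary_iso[OF paired_graph_axioms]) (use return_mark in \<open>simp add: S.t_def turn_def[abs_def]\<close>)
  \<comment> \<open>Every bubble has two black vertices by \<open>melonic_structure\<close>, and
    black vertices correspond to slots.\<close>
  have bub: "card (bubbles S.graph) = D * card (blacks B) + (\<Sum>i=1..D. card (R i))"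
  proof -
    obtain p \<tau> col X where \<tau>: "\<And>b. b \<in> blacks S.graph \<Longrightarrow> \<tau> b \<in> blacks S.graph \<and> \<tau> (\<tau> b) = b \<and> col b \<in> {1..D} \<and> col (\<tau> b) = col b"
      and X: "X \<union> \<tau> ` X = blacks S.graph" "X \<inter> \<tau> ` X = {}" "card X = card (bubbles S.graph)"
      by (rule melonic_structure[OF D GG]) blast
    have "finite X" using X(1) S.fin by (metis S.graph_sel(1) finite_Un finite_imageI)
    moreover have "inj_on \<tau> X" using \<tau> X(1) by (intro inj_on_inverseI[of _ \<tau>]) blast
    ultimately have "card (blacks S.graph) = 2 * card (bubbles S.graph)"
      using card_Un_disjoint[of X "\<tau> ` X"] X card_image[of \<tau> X] by simp
    moreover have "card (blacks S.graph) = card slots" using card_image[OF S.bl] unfolding S.graph_sel .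
    ultimately show ?thesis using card_slots by simp
  qed
  let ?\<Phi> = "\<Sum>i=1..D. card (R i)"
  have "(\<Sum>c=1..D. int (card {s \<in> leaf_slots. slot_color s \<noteq> c})) \<le> int (Phi0 D S.graph)"
    unfolding Phi0_def of_nat_sum
  proof (rule sum_mono)
    fix c assume c: "c \<in> {1..D}"
    have "leaf_slots \<subseteq> {s \<in> slots. slot_next D s = s \<and> s \<notin> marks}"
      unfolding slots_def leaf_slots_def by auto
    from S.card_leaf_faces[OF this c]
    show "int (card {s \<in> leaf_slots. slot_color s \<noteq> c}) \<le> int (card {set vs |vs. alt_cycle S.graph 0 c vs})" by simp
  qed
  moreover have "int (card {s \<in> leaf_slots. slot_color s \<noteq> c}) = 2 * int ?\<Phi> - 2 * int (card (R c))" if c: "c \<in> {1..D}" for c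
  proof -
    have "{s \<in> leaf_slots. slot_color s \<noteq> c} = {s \<in> leaf_slots. slot_color s \<in> {1..D} - {c}}"
      unfolding leaf_slots_def by auto
    then have "card {s \<in> leaf_slots. slot_color s \<noteq> c} = 2 * (\<Sum>i\<in>{1..D} - {c}. card (R i))"
      using card_leaf_slots[of "{1..D} - {c}"] by auto
    moreover have "?\<Phi> = card (R c) + (\<Sum>i\<in>{1..D} - {c}. card (R i))"
      using c by (intro sum.remove) auto
    ultimately show ?thesis by simp
  qed
  ultimately have "(\<Sum>c=1..D. 2 * int ?\<Phi> - 2 * int (card (R c))) \<le> int (Phi0 D S.graph)" by simp
  moreover have "(\<Sum>c=1..D. 2 * int ?\<Phi> - 2 * int (card (R c))) = 2 * (int D - 1) * int ?\<Phi>"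
    by (simp add: sum_subtractf sum_distrib_left[symmetric] algebra_simps)
  ultimately have "graph_degree D S.graph \<le> int D + (int D - 1) * int (D * card (blacks B) + ?\<Phi>) - 2 * (int D - 1) * int ?\<Phi>"
    unfolding graph_degree_def bub by simp
  also have "\<dots> = int D + (int D - 1) * (int D * int (card (blacks B)) - int ?\<Phi>)"
    by (simp add: algebra_simps)
  finally show ?thesis using GG iso by blast
qed

end

theorem corollary2p4p2:
  fixes D q :: nat and B :: "'v cgraph" and \<Omega>opt :: "'v set set"
  assumes "D \<ge> 3"
    and "regular_cgraph D B" and "connected_cgraph B" and "card (cverts B) = 2 * q"
    and "optimal_pairing D B \<Omega>opt"
  shows "(\<forall>G :: 'w cgraph. G \<in> GG D q (B4m D) \<and> cgraph_iso (boundary_graph D G) B \<longrightarrow>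
            graph_degree D G \<ge> 1 + (int D - 1) * (int q + Lm D (contraction B \<Omega>opt))) \<and>
         (\<exists>G :: nat cgraph. G \<in> GG D q (B4m D) \<and> cgraph_iso (boundary_graph D G) B \<and>
            graph_degree D G = 1 + (int D - 1) * (int q + Lm D (contraction B \<Omega>opt)))"
proof -
  have D1: "D \<ge> 1" using assms(1) by simp
  have wf: "wf_cgraph B" using assms(2) unfolding regular_cgraph_def by blast
  have pair: "pairing B \<Omega>opt"
    and opt: "\<And>\<Omega>. pairing B \<Omega> \<Longrightarrow> Phi0 D (add_pairing B \<Omega>) \<le> Phi0 D (add_pairing B \<Omega>opt)"
    using assms(5) unfolding optimal_pairing_def is_arg_max_def by (auto simp: not_less)
  note cardB = regular_card_blacks[OF assms(2) D1 assms(4)]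
  let ?\<Phi> = "Phi0 D (add_pairing B \<Omega>opt)"
  note bound = optimal_bound_eq[OF D1 assms(2-4) pair]
  have q: "q > 0"
  proof -
    have "verts (multigraph_of B) \<noteq> {}"
      using assms(3) unfolding connected_cgraph_def connected_def strongly_connected_def by simp
    moreover have "finite (cverts B)" using wf unfolding wf_cgraph_def cverts_def by simp
    ultimately have "card (cverts B) \<noteq> 0" by simp
    then show ?thesis using assms(4) by simp
  qed
  \<comment> \<open>Stated for an arbitrary vertex type: it is applied to the type in the theorem
    and to the graph constructed on \<open>nat\<close>.\<close>
  have lower: "graph_degree D G \<ge> 1 + (int D - 1) * (int q + Lm D (contraction B \<Omega>opt))"
    if "G \<in> GG D q (B4m D)" "cgraph_iso (boundary_graph D G) B" for G :: "'x cgraph"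
    using melonic_face_bound[OF assms(1,2) q opt that] unfolding bound graph_degree_def
    by (simp add: algebra_simps)
  obtain \<alpha> where \<alpha>: "\<And>c. c \<in> {1..D} \<Longrightarrow> bij_betw (\<alpha> c) (blacks B) (whites B)"
    "\<And>c b w. c \<in> {1..D} \<Longrightarrow> (b, w, c) \<in> cedges B \<longleftrightarrow> b \<in> blacks B \<and> w = \<alpha> c b"
    by (rule regular_matchings[OF assms(2)]) blast
  obtain \<phi> where \<phi>: "bij_betw \<phi> (blacks B) (whites B)" "\<Omega>opt = pairs_of B \<phi>"
    by (rule pairing_obtain[OF wf pair])
  define h where "h c b = inv_into (blacks B) \<phi> (\<alpha> c b)" for c b
  interpret P: paired_graph D B \<alpha> \<phi> h
    unfolding h_def[abs_def] by (rule paired_graphI[OF assms(2) \<alpha> \<phi>(1)])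
  \<comment> \<open>One element of each cycle of \<open>h i\<close>, so that
    \<open>card (R i)\<close> is the number of faces of color \<open>i\<close> of the optimally
    paired graph.\<close>
  define R where "R i = (\<lambda>X. SOME x. x \<in> X) ` (orb (h i) ` blacks B)" for i
  have some: "(SOME y. y \<in> orb (h i) x) \<in> orb (h i) x" for i x
    by (rule someI[of _ x]) simp
  have some_eq: "orb (h i) (SOME y. y \<in> orb (h i) x) = orb (h i) x" if "i \<in> {1..D}" "x \<in> blacks B" for i x
    by (rule orb_eq[OF P.fin P.h_perm[OF that(1)] that(2) some])
  interpret C: slot_construction D B \<alpha> \<phi> h R
  proof
    show "D \<ge> 3" "connected_cgraph B" by fact+
    fix i assume i: "i \<in> {1..D}"
    show "R i \<subseteq> blacks B"
      unfolding R_def using some orb_subset[OF P.h_perm(2)[OF i]] by (auto simp: image_subset_iff)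
    fix r r' assume r: "r \<in> R i" "r' \<in> R i" and o: "r' \<in> orb (h i) r"
    obtain x where x: "x \<in> blacks B" "r = (SOME y. y \<in> orb (h i) x)" using r(1) unfolding R_def by blast
    obtain x' where x': "x' \<in> blacks B" "r' = (SOME y. y \<in> orb (h i) x')" using r(2) unfolding R_def by blast
    have rb: "r \<in> blacks B" using some[of i x] x orb_subset[OF P.h_perm(2)[OF i] x(1)] by auto
    have "orb (h i) x' = orb (h i) r'" using some_eq[OF i x'(1)] x'(2) by simp
    also have "\<dots> = orb (h i) r" by (rule orb_eq[OF P.fin P.h_perm[OF i] rb o])
    also have "\<dots> = orb (h i) x" using some_eq[OF i x(1)] x(2) by simp
    finally show "r' = r" using x(2) x'(2) by simp
  qed
  have "card (R i) = card (orb (h i) ` blacks B)" if i: "i \<in> {1..D}" for i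
    unfolding R_def
  proof (rule card_image, rule inj_on_inverseI[of _ "orb (h i)"])
    fix X assume "X \<in> orb (h i) ` blacks B"
    then obtain x where "x \<in> blacks B" "X = orb (h i) x" by blast
    then show "orb (h i) (SOME x. x \<in> X) = X" using some_eq[OF i] by simp
  qed
  then have \<Phi>: "(\<Sum>i=1..D. card (R i)) = ?\<Phi>"
    unfolding \<phi>(2) P.Phi0_add_pairing by (intro sum.cong) auto
  obtain G :: "nat cgraph" where G: "G \<in> GG D q (B4m D)" "cgraph_iso (boundary_graph D G) B"
    and le: "graph_degree D G \<le> 1 + (int D - 1) * (int q + Lm D (contraction B \<Omega>opt))"
    using C.slot_graph_exists unfolding cardB \<Phi> bound by blast
  have "graph_degree D G = 1 + (int D - 1) * (int q + Lm D (contraction B \<Omega>opt))"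
    using le lower[OF G] by simp
  then show ?thesis using lower G by blast
qed

end
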